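(* Let $u$ be a weight on $\mathbb R$ and $w$ a weight on $(0,\infty)$. If $H:\Lambda^p_u(w)\to\Lambda^{p,\infty}_u(w)$ is bounded for some $0<p<\infty$, then for every $r>p$, $$H:\Lambda^r_u(w)\to\Lambda^r_u(w)$$ is bounded.
   Context: A weight $u$ on $\mathbb R$ is locally integrable with $u>0$ a.e.; $u(E)=\int_Eu$. A weight $w$ on $(0,\infty)$ is nonnegative locally integrable, $W(t)=\int_0^tw$. $f^*_u(t)=\inf\{y>0:u(\{|f|>y\})\le t\}$; $\|f\|_{\Lambda^p_u(w)}=\left(\int_0^\infty(f^*_u)^pw\right)^{1/p}$, $\|f\|_{\Lambda^{p,\infty}_u(w)}=\sup_{t>0}f^*_u(t)W(t)^{1/p}$, and the spaces consist of the measurable $f$ with finite quasi-norm. $Hf(x)=\frac1\pi\lim_{\varepsilon\to0^+}\int_{|x-y|>\varepsilon}\frac{f(y)}{x-y}dy$; "$H:X\to Y$ is bounded" means $Hf$ is defined a.e. for every $f\in X$ and $\|Hf\|_Y\le C\|f\|_X$. *)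

theory Defs
  imports "HOL-Analysis.Analysis"
begin

text \<open>Real powers of extended nonnegative reals (for a > 0): infinity stays infinity.\<close>
definition enn_powr :: "ennreal \<Rightarrow> real \<Rightarrow> ennreal" where
  "enn_powr x a = (if x = \<infinity> then \<infinity> else ennreal (enn2real x powr a))"

definition weight_R :: "(real \<Rightarrow> real) \<Rightarrow> bool" where
  "weight_R u \<longleftrightarrow> (\<forall>a b. set_integrable lebesgue {a..b} u) \<and> (AE x in lebesgue. u x > 0)"

definition weight_pos :: "(real \<Rightarrow> real) \<Rightarrow> bool" where
  "weight_pos w \<longleftrightarrow> (\<forall>t>0. w t \<ge> 0) \<and>
     (\<forall>a b. 0 < a \<longrightarrow> set_integrable lebesgue {a..b} w)"

definition Wfun :: "(real \<Rightarrow> real) \<Rightarrow> real \<Rightarrow> ennreal" where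
  "Wfun w t = (\<integral>\<^sup>+ s. ennreal (w s) * indicator {0<..<t} s \<partial>lebesgue)"

definition umeas :: "(real \<Rightarrow> real) \<Rightarrow> real measure" where
  "umeas u = density lebesgue (\<lambda>x. ennreal (u x))"

text \<open>Decreasing rearrangement of f with respect to u (inf of the empty set is infinity).\<close>
definition rearr :: "(real \<Rightarrow> real) \<Rightarrow> (real \<Rightarrow> real) \<Rightarrow> real \<Rightarrow> ennreal" where
  "rearr u f t = Inf {y::ennreal. 0 < y \<and> y < \<infinity> \<and>
       emeasure (umeas u) {x. ennreal \<bar>f x\<bar> > y} \<le> ennreal t}"

definition lorentz_norm :: "(real \<Rightarrow> real) \<Rightarrow> (real \<Rightarrow> real) \<Rightarrow> real \<Rightarrow> (real \<Rightarrow> real) \<Rightarrow> ennreal" where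
  "lorentz_norm u w p f =
     enn_powr (\<integral>\<^sup>+ t. enn_powr (rearr u f t) p * ennreal (w t) * indicator {0<..} t \<partial>lebesgue) (1/p)"

definition weak_lorentz_norm :: "(real \<Rightarrow> real) \<Rightarrow> (real \<Rightarrow> real) \<Rightarrow> real \<Rightarrow> (real \<Rightarrow> real) \<Rightarrow> ennreal" where
  "weak_lorentz_norm u w p f = (SUP t\<in>{0<..}. rearr u f t * enn_powr (Wfun w t) (1/p))"

definition lorentz_space :: "(real \<Rightarrow> real) \<Rightarrow> (real \<Rightarrow> real) \<Rightarrow> real \<Rightarrow> (real \<Rightarrow> real) set" where
  "lorentz_space u w p = {f. f \<in> borel_measurable lebesgue \<and> lorentz_norm u w p f < \<infinity>}"

definition hilbert_trunc :: "(real \<Rightarrow> real) \<Rightarrow> real \<Rightarrow> real \<Rightarrow> real" where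
  "hilbert_trunc f x \<epsilon> = (LINT y:{y. \<epsilon> < \<bar>x - y\<bar>}|lebesgue. f y / (x - y))"

definition hilbert_defined :: "(real \<Rightarrow> real) \<Rightarrow> real \<Rightarrow> bool" where
  "hilbert_defined f x \<longleftrightarrow>
     (\<forall>\<^sub>F \<epsilon> in at_right 0. set_integrable lebesgue {y. \<epsilon> < \<bar>x - y\<bar>} (\<lambda>y. f y / (x - y))) \<and>
     (\<exists>L. (hilbert_trunc f x \<longlongrightarrow> L) (at_right 0))"

definition hilbert :: "(real \<Rightarrow> real) \<Rightarrow> real \<Rightarrow> real" where
  "hilbert f x = Lim (at_right 0) (hilbert_trunc f x) / pi"

text \<open>H : X -> Y bounded, with Y given by its quasi-norm.\<close>
definition hilbert_bounded ::
  "(real \<Rightarrow> real) set \<Rightarrow> ((real \<Rightarrow> real) \<Rightarrow> ennreal) \<Rightarrow> ((real \<Rightarrow> real) \<Rightarrow> ennreal) \<Rightarrow> bool" where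
  "hilbert_bounded X normX normY \<longleftrightarrow>
     (\<forall>f\<in>X. AE x in lebesgue. hilbert_defined f x) \<and>
     (\<exists>C. \<forall>f\<in>X. normY (hilbert f) \<le> ennreal C * normX f)"

end

theory Submission
  imports Defs "HOL-Computational_Algebra.Polynomial"
begin

text \<open>
  Write \<open>V(E) = W(u(E))\<close>. By the layer-cake formula the \<open>r\<close>-th power of the norm of \<open>\<Lambda>\<^sup>r\<close> is
  \<open>\<integral> r y\<^sup>r\<^sup>-\<^sup>1 V(|f| > y) dy\<close>, so only level sets matter. Testing the weak type inequality on
  intervals shows that \<open>W\<close> is doubling, hence \<open>V\<close> is quasi-subadditive, and that
  \<open>V(1 / (1 + |x|) > y) \<le> C y\<^sup>-\<^sup>p\<close>.

  If \<open>F = f + i g\<close> is a polynomial without constant term in \<open>1 / (x + i)\<close>, then \<open>H f = g\<close> and, applying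
  the same to \<open>F\<^sup>2\<close>, Cotlar's identity \<open>H(2 f g) = g\<^sup>2 - f\<^sup>2\<close> holds. Inserting it into the weak type
  inequality bounds \<open>B = sup y\<^sup>2\<^sup>p V(|g| > y)\<close>, when \<open>|f| \<le> 1\<close>, by the \<open>\<Lambda>\<^sup>q\<close> integral of \<open>f\<close> plus
  \<open>B / 2\<close>, for every \<open>q\<close> between \<open>p\<close> and \<open>2 p\<close>; since \<open>B\<close> is finite it can be absorbed. By
  Stone-Weierstrass on the circle these functions approximate every bounded function of compact
  support, and interpolation with the weak type inequality at \<open>p\<close> gives the strong type for
  \<open>p < r < 2 p\<close>, first for compact support and then, by truncation, on all of \<open>\<Lambda>\<^sup>r\<close>. Iterating
  reaches every \<open>r > p\<close>.
\<close>

section \<open>Level sets and the layer-cake formula\<close>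

text \<open>Two obstacles shape the argument. Weak type at \<open>p\<close> says nothing about the
  existence of H f for f outside \<Lambda>^p, so until the final extension every estimate is made
  for functions already known to lie in \<Lambda>^p, and definedness on \<Lambda>^r has to be proved
  separately. And absorbing \<open>B / 2\<close> is legitimate only once \<open>B\<close> is finite:
  functions of order 1 / |x| at infinity satisfy V(|g| > y) <= C y^(-p), and products of two of them
  lie in \<Lambda>^p, which is why polynomials in 1 / (x + i) without constant term are the test
  class. What is obtained for q in (p, 2p) is not a weak type inequality but a restricted one, for
  |f| <= y at the level y itself; interpolation asks exactly this of the part of f below the height
  y. The limit 2p comes from squaring: Cotlar's identity expresses g^2 through H(2 f g), and a level
  bound of order p for g^2 is one of order 2p for g. A weight with W infinite near 0 is a separate
  degenerate case, because local integrability on (0, infinity) does not control w at 0.\<close>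

definition wmeas :: "(real \<Rightarrow> real) \<Rightarrow> real measure" where
  "wmeas w = density lebesgue (\<lambda>s. ennreal (w s) * indicator {0<..} s)"

text \<open>\<open>cap u w E\<close> is \<open>W(u(E))\<close>, and \<open>lint u w p f\<close> is the \<open>p\<close>-th power of the norm of \<open>f\<close>.\<close>

definition cap :: "(real \<Rightarrow> real) \<Rightarrow> (real \<Rightarrow> real) \<Rightarrow> real set \<Rightarrow> ennreal" where
  "cap u w E = emeasure (wmeas w) {s. ennreal s < emeasure (umeas u) E}"

definition lint :: "(real \<Rightarrow> real) \<Rightarrow> (real \<Rightarrow> real) \<Rightarrow> real \<Rightarrow> (real \<Rightarrow> real) \<Rightarrow> ennreal" where
  "lint u w p f = (\<integral>\<^sup>+ t. enn_powr (rearr u f t) p \<partial>wmeas w)"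

text \<open>The weights are given only through integrability on compact intervals; measurability on
  the whole domain is recovered as a pointwise limit along an exhaustion.\<close>

lemma borel_measurable_locally_integrable:
  fixes f :: "real \<Rightarrow> real"
  assumes "\<And>n::nat. set_integrable lebesgue (A n) f" "incseq A"
  shows "(\<lambda>x. indicator (\<Union>n. A n) x * f x) \<in> borel_measurable lebesgue"
proof (rule borel_measurable_LIMSEQ_real)
  show "(\<lambda>x. indicator (A n) x * f x) \<in> borel_measurable lebesgue" for n
    using assms(1)[of n] unfolding set_integrable_def by auto
  show "(\<lambda>i. indicator (A i) x * f x) \<longlonglongrightarrow> indicator (\<Union>n. A n) x * f x" for x
    by (intro tendsto_intros LIMSEQ_indicator_incseq assms(2))
qed

lemma antimono_borel_measurable_ennreal:
  fixes f :: "real \<Rightarrow> ennreal"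
  assumes "antimono f"
  shows "f \<in> borel_measurable borel"
proof (rule borel_measurableI_greater)
  fix a
  have "is_interval {x. a < f x}"
    unfolding is_interval_1 using assms by (auto simp: antimono_def intro: less_le_trans)
  then show "{x \<in> space borel. a < f x} \<in> sets borel"
    by (simp add: real_interval_borel_measurable)
qed

lemma nn_integral_powr_lessThan:
  fixes a Y :: real
  assumes "0 < a" "0 \<le> Y"
  shows "(\<integral>\<^sup>+y. ennreal (y powr (a - 1)) * indicator {0<..<Y} y \<partial>lborel) = ennreal (Y powr a / a)"
proof -
  have "(\<integral>\<^sup>+y. ennreal (y powr (a - 1)) * indicator {0<..<Y} y \<partial>lborel)
      = (\<integral>\<^sup>+y. ennreal (y powr (a - 1)) * indicator {0..Y} y \<partial>lborel)"
    by (rule nn_integral_cong_AE, rule AE_mp[OF AE_lborel_singleton[of Y]])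
       (auto simp: indicator_def)
  also have "\<dots> = ennreal (Y powr a / a)"
  proof -
    have "((\<lambda>x. x powr (a - 1)) has_integral Y powr a / a) {0..Y}"
      using has_integral_powr_from_0[of "a - 1" Y] assms by simp
    from nn_integral_has_integral_lebesgue'[OF _ this] show ?thesis by simp
  qed
  finally show ?thesis .
qed

lemma nn_integral_powr_atLeast:
  fixes a Y :: real
  assumes "0 < a" "0 < Y"
  shows "(\<integral>\<^sup>+y. ennreal (y powr (- a - 1)) * indicator {Y..} y \<partial>lborel) = ennreal (Y powr (- a) / a)"
proof -
  have "(\<integral>\<^sup>+y. ennreal (y powr (- a - 1)) * indicator {Y..} y \<partial>lborel) = ennreal (0 - (- (Y powr (- a) / a)))"
  proof (rule nn_integral_FTC_atLeast)
    show "((\<lambda>y. - (y powr (- a) / a)) has_real_derivative x powr (- a - 1)) (at x)" if "Y \<le> x" for x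
      using that assms by (auto intro!: derivative_eq_intros)
    show "((\<lambda>y. - (y powr (- a) / a)) \<longlongrightarrow> 0) at_top"
    proof -
      have "((\<lambda>y. y powr (- a)) \<longlongrightarrow> 0) at_top"
        using assms by (intro tendsto_neg_powr filterlim_ident) auto
      then have "((\<lambda>y. - (y powr (- a) / a)) \<longlongrightarrow> - (0 / a)) at_top"
        using assms by (intro tendsto_intros) auto
      then show ?thesis by simp
    qed
  qed auto
  then show ?thesis by simp
qed

lemma nn_integral_powr_Ioi:
  assumes "0 < (p::real)"
  shows "(\<integral>\<^sup>+y. ennreal (y powr (p - 1)) * indicator {0<..} y \<partial>lborel) = \<infinity>"
proof (rule ccontr)
  let ?I = "\<integral>\<^sup>+y. ennreal (y powr (p - 1)) * indicator {0<..} y \<partial>lborel"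
  assume "?I \<noteq> \<infinity>"
  then obtain c where c: "?I = ennreal c" "0 \<le> c" by (cases ?I) auto
  have le: "Y powr p / p \<le> c" if "0 \<le> Y" for Y
  proof -
    have "ennreal (Y powr p / p) \<le> ?I"
      by (subst nn_integral_powr_lessThan[symmetric, OF assms that])
         (intro nn_integral_mono, auto simp: indicator_def)
    then show ?thesis using c by simp
  qed
  have "((p * c + 1) powr (1/p)) powr p = p * c + 1"
    using assms c by (simp add: powr_powr)
  with le[of "(p * c + 1) powr (1/p)"] assms show False
    by (simp add: field_simps)
qed

text \<open>The set of \<open>y\<close> is the interval from 0 to (D R)^(1/a), so this is a power
  integral with the threshold y^a / D built in. Carrying \<open>a\<close> and \<open>D\<close> along
  avoids a later change of variables: a = D = 1 gives the usual layer-cake formula, a = 1 a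
  dilation, and a = p / q converts an integral of order p into one of order q.\<close>

lemma nn_integral_powr_layer:
  fixes R :: ennreal
  assumes "0 < p" "0 < a" "0 < D"
  shows "(\<integral>\<^sup>+y. ennreal (p * y powr (p - 1)) * indicator {y. 0 < y \<and> ennreal (y powr a / D) < R} y \<partial>lborel)
    = ennreal (D powr (p / a)) * enn_powr R (p / a)"
proof (cases R)
  case (real r)
  have eq: "{y. 0 < y \<and> ennreal (y powr a / D) < R} = {0<..<(D * r) powr (1/a)}"
  proof -
    have "y powr a / D < r \<longleftrightarrow> y < (D * r) powr (1/a)" if "0 < y" for y
    proof -
      have "y powr a / D < r \<longleftrightarrow> y powr a < D * r"
        using assms by (simp add: field_simps)
      also have "\<dots> \<longleftrightarrow> (y powr a) powr (1/a) < (D * r) powr (1/a)"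
      proof (cases "r = 0")
        case False
        then show ?thesis using real assms
          by (smt (verit) powr_less_mono2 powr_mono2 divide_pos_pos mult_nonneg_nonneg powr_ge_zero)
      next
        case True
        then show ?thesis using that by (simp add: not_less)
      qed
      finally show ?thesis using assms that by (simp add: powr_powr)
    qed
    then show ?thesis using assms real by (auto simp: ennreal_less_iff)
  qed
  have "(\<integral>\<^sup>+y. ennreal (p * y powr (p - 1)) * indicator {0<..<(D * r) powr (1/a)} y \<partial>lborel)
     = ennreal p * (\<integral>\<^sup>+y. ennreal (y powr (p - 1)) * indicator {0<..<(D * r) powr (1/a)} y \<partial>lborel)"
    using assms by (simp add: ennreal_mult mult.assoc nn_integral_cmult)
  also have "\<dots> = ennreal (((D * r) powr (1/a)) powr p)"
    using assms by (subst nn_integral_powr_lessThan) (auto simp: ennreal_mult[symmetric])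
  also have "((D * r) powr (1/a)) powr p = D powr (p/a) * r powr (p/a)"
    using assms real by (simp add: powr_powr powr_mult)
  finally show ?thesis unfolding eq using real by (simp add: enn_powr_def ennreal_mult)
next
  case top
  have "(\<integral>\<^sup>+y. ennreal (p * y powr (p - 1)) * indicator {0<..} y \<partial>lborel)
     = ennreal p * (\<integral>\<^sup>+y. ennreal (y powr (p - 1)) * indicator {0<..} y \<partial>lborel)"
    using assms by (simp add: ennreal_mult mult.assoc nn_integral_cmult)
  also have "\<dots> = \<infinity>"
    using assms by (simp add: nn_integral_powr_Ioi ennreal_mult_top)
  finally show ?thesis using top assms
    by (simp add: enn_powr_def ennreal_mult_top greaterThan_def)
qed

lemma antimono_rearr: "antimono (rearr u f)"
  unfolding rearr_def antimono_def
  by (intro allI impI Inf_superset_mono) (auto intro: order_trans ennreal_leI)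

lemma rearr_borel_measurable[measurable]: "rearr u f \<in> borel_measurable borel"
  by (rule antimono_borel_measurable_ennreal[OF antimono_rearr])

lemma enn_powr_borel_measurable[measurable]: "(\<lambda>x. enn_powr x a) \<in> borel_measurable borel"
  unfolding enn_powr_def by measurable

lemma sets_Collect_less_abs:
  fixes f :: "real \<Rightarrow> real"
  assumes [measurable]: "f \<in> borel_measurable lebesgue"
  shows "{x. y < \<bar>f x\<bar>} \<in> sets lebesgue"
proof -
  have "{x \<in> space lebesgue. y < \<bar>f x\<bar>} \<in> sets lebesgue" by measurable
  then show ?thesis by simp
qed

section \<open>The measures of the two weights and the decreasing rearrangement\<close>

locale lorentz_weights =
  fixes u w :: "real \<Rightarrow> real"
  assumes weight_u: "weight_R u" and weight_w: "weight_pos w"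
begin

abbreviation "um \<equiv> umeas u"
abbreviation "wm \<equiv> wmeas w"
abbreviation "V \<equiv> cap u w"
abbreviation "N \<equiv> lint u w"

lemma u_measurable[measurable]: "u \<in> borel_measurable lebesgue"
proof -
  have "(\<lambda>x. indicator (\<Union>n. {- real n..real n}) x * u x) \<in> borel_measurable lebesgue"
    using weight_u by (intro borel_measurable_locally_integrable)
      (auto simp: weight_R_def incseq_def)
  moreover have "(\<Union>n. {- real n..real n}) = UNIV"
  proof (intro equalityI subsetI UNIV_I UN_I)
    fix x :: real
    show "x \<in> {- real (nat \<lceil>\<bar>x\<bar>\<rceil>)..real (nat \<lceil>\<bar>x\<bar>\<rceil>)}" by (simp; linarith)
  qed
  ultimately show ?thesis by simp
qed

lemma w_measurable[measurable]: "(\<lambda>s. ennreal (w s) * indicator {0<..} s) \<in> borel_measurable lebesgue"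
proof -
  have "(\<lambda>x. indicator (\<Union>n. {1 / (real n + 1)..real n}) x * w x) \<in> borel_measurable lebesgue"
    using weight_w by (intro borel_measurable_locally_integrable)
      (auto simp: weight_pos_def incseq_def field_simps intro!: order_trans[of _ "_ * _"] frac_le)
  moreover have "(\<Union>n. {1 / (real n + 1)..real n}) = {0<..}"
  proof (intro equalityI subsetI)
    fix x :: real assume "x \<in> {0<..}"
    then have x: "0 < x" by simp
    obtain n where n: "1 / x < real n" "x < real n"
      using reals_Archimedean2[of "max (1/x) x"] by auto
    with x have "x \<in> {1 / (real n + 1)..real n}" by (auto simp: field_simps)
    then show "x \<in> (\<Union>n. {1 / (real n + 1)..real n})" by blast
  next
    fix x assume "x \<in> (\<Union>n. {1 / (real n + 1)..real n})"
    then obtain n where "1 / (real n + 1) \<le> x" by auto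
    moreover have "0 < 1 / (real n + 1)" by simp
    ultimately show "x \<in> {0<..}" unfolding greaterThan_iff by linarith
  qed
  ultimately have "(\<lambda>x. indicator {0<..} x * w x) \<in> borel_measurable lebesgue" by simp
  then have "(\<lambda>x. ennreal (indicator {0<..} x * w x)) \<in> borel_measurable lebesgue" by measurable
  also have "(\<lambda>x. ennreal (indicator {0<..} x * w x)) = (\<lambda>s. ennreal (w s) * indicator {0<..} s)"
    by (auto simp: indicator_def)
  finally show ?thesis .
qed

lemma sets_um[simp, measurable_cong]: "sets um = sets lebesgue" by (simp add: umeas_def)
lemma space_um[simp]: "space um = UNIV" by (simp add: umeas_def)
lemma sets_wm[simp, measurable_cong]: "sets wm = sets lebesgue" by (simp add: wmeas_def)
lemma space_wm[simp]: "space wm = UNIV" by (simp add: wmeas_def)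

lemma emeasure_um_Icc: "emeasure um {a..b} < \<infinity>"
proof -
  have i: "integrable lebesgue (\<lambda>x. indicator {a..b} x * u x)"
    using weight_u by (simp add: weight_R_def set_integrable_def)
  have "emeasure um {a..b} = (\<integral>\<^sup>+x. ennreal (indicator {a..b} x * u x) \<partial>lebesgue)"
    unfolding umeas_def by (subst emeasure_density)
      (auto intro!: nn_integral_cong simp: indicator_def)
  also have "\<dots> \<le> (\<integral>\<^sup>+x. ennreal (norm (indicator {a..b} x * u x)) \<partial>lebesgue)"
    by (intro nn_integral_mono ennreal_leI) auto
  also have "\<dots> < \<infinity>" using i by (simp add: integrable_iff_bounded)
  finally show ?thesis .
qed

text \<open>The density is positive almost everywhere. This lets conclusions about the measure
  \<open>um\<close> return to Lebesgue almost everywhere statements, in which the existence of H f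
  is phrased.\<close>

lemma um_0_imp_null: "E \<in> sets lebesgue \<Longrightarrow> emeasure um E = 0 \<Longrightarrow> E \<in> null_sets lebesgue"
proof -
  assume E: "E \<in> sets lebesgue" "emeasure um E = 0"
  then have "AE x in lebesgue. ennreal (u x) * indicator E x = 0"
    by (simp add: umeas_def emeasure_density nn_integral_0_iff_AE)
  moreover have "AE x in lebesgue. u x > 0" using weight_u by (simp add: weight_R_def)
  ultimately have "AE x in lebesgue. x \<notin> E"
    by eventually_elim (auto simp: indicator_def split: if_splits)
  then show ?thesis using E(1) by (simp add: AE_iff_null_sets)
qed

lemma Collect_ennreal_less[measurable]: "{s. ennreal s < T} \<in> sets lebesgue"
proof -
  have "{s. ennreal s < T} \<in> sets borel" by measurable
  then show ?thesis by simp
qed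

lemma wm_le_0: "emeasure wm {..0} = 0"
proof -
  have "emeasure wm {..0} = (\<integral>\<^sup>+x. ennreal (w x) * indicator {0<..} x * indicator {..0} x \<partial>lebesgue)"
    unfolding wmeas_def by (rule emeasure_density) (use w_measurable in auto)
  also have "\<dots> = (\<integral>\<^sup>+(x::real). 0 \<partial>lebesgue)" by (rule nn_integral_cong) (auto simp: indicator_def)
  finally show ?thesis by simp
qed

lemma wm_Icc: "0 < a \<Longrightarrow> emeasure wm {a..b} < \<infinity>"
proof -
  assume a: "0 < a"
  have i: "integrable lebesgue (\<lambda>x. indicator {a..b} x * w x)"
    using weight_w a by (simp add: weight_pos_def set_integrable_def)
  have "emeasure wm {a..b} = (\<integral>\<^sup>+x. ennreal (indicator {a..b} x * w x) \<partial>lebesgue)"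
    unfolding wmeas_def by (subst emeasure_density[OF w_measurable])
      (use a in \<open>auto intro!: nn_integral_cong simp: indicator_def\<close>)
  also have "\<dots> \<le> (\<integral>\<^sup>+x. ennreal (norm (indicator {a..b} x * w x)) \<partial>lebesgue)"
    by (intro nn_integral_mono ennreal_leI) auto
  also have "\<dots> < \<infinity>" using i by (simp add: integrable_iff_bounded)
  finally show ?thesis .
qed

text \<open>Required for the exchange of integrals in the layer-cake formula. The mass near 0 may be
  infinite, so the exhaustion uses compact intervals away from 0 together with the null half-line
  \<open>{..0}\<close>.\<close>

lemma sigma_finite_wm: "sigma_finite_measure wm"
proof
  let ?A = "insert {..0} (range (\<lambda>n. {1 / (real n + 1)..real n}))"
  have "\<Union>?A = space wm"
  proof (intro equalityI subsetI)
    fix x :: real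
    show "x \<in> \<Union>?A"
    proof (cases "x \<le> 0")
      case False
      obtain n where n: "1 / x < real n" "x < real n"
        using reals_Archimedean2[of "max (1/x) x"] by auto
      with False have "x \<in> {1 / (real n + 1)..real n}" by (auto simp: field_simps)
      then show ?thesis by blast
    qed auto
  qed auto
  moreover have "emeasure wm a \<noteq> \<infinity>" if "a \<in> ?A" for a
  proof -
    consider "a = {..0}" | n :: nat where "a = {1 / (real n + 1)..real n}" using \<open>a \<in> ?A\<close> by blast
    then show ?thesis
    proof cases
      case 1
      then show ?thesis by (simp add: wm_le_0)
    next
      case 2
      have "0 < 1 / (real n + 1)" by simp
      from wm_Icc[OF this, of "real n"] show ?thesis using 2 by simp
    qed
  qed
  ultimately show "\<exists>A. countable A \<and> A \<subseteq> sets wm \<and> \<Union>A = space wm \<and> (\<forall>a\<in>A. emeasure wm a \<noteq> \<infinity>)"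
    by (intro exI[of _ ?A]) auto
qed

text \<open>Rearrangement and distribution function are generalized inverses, with strict
  inequalities on both sides. From right to left this rests on right continuity of the distribution
  function: a strict excess over \<open>t\<close> survives raising the level by some 1 / (n + 1). It
  turns integrals of the rearrangement into integrals of \<open>V\<close> over level sets.\<close>

lemma less_rearr_iff:
  assumes [measurable]: "f \<in> borel_measurable lebesgue" and y: "0 \<le> y"
  shows "ennreal y < rearr u f t \<longleftrightarrow> ennreal t < emeasure um {x. y < \<bar>f x\<bar>}"
proof
  assume L: "ennreal t < emeasure um {x. y < \<bar>f x\<bar>}"
  let ?E = "\<lambda>n. {x. y + 1 / real (Suc n) < \<bar>f x\<bar>}"
  have "incseq ?E"
  proof (intro incseq_SucI subsetI)
    fix n x assume "x \<in> ?E n"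
    moreover have "1 / real (Suc (Suc n)) \<le> 1 / real (Suc n)" by (intro divide_left_mono) auto
    ultimately show "x \<in> ?E (Suc n)" by auto
  qed
  then have "(SUP n. emeasure um (?E n)) = emeasure um (\<Union>n. ?E n)"
    using sets_Collect_less_abs[OF assms(1)] by (intro SUP_emeasure_incseq) auto
  also have "(\<Union>n. ?E n) = {x. y < \<bar>f x\<bar>}"
  proof (intro equalityI subsetI)
    fix x assume "x \<in> {x. y < \<bar>f x\<bar>}"
    then have "0 < \<bar>f x\<bar> - y" by simp
    then obtain n where "1 / real (Suc n) < \<bar>f x\<bar> - y" by (rule nat_approx_posE)
    then show "x \<in> (\<Union>n. ?E n)" by (auto intro!: exI[of _ n])
  next
    fix x assume "x \<in> (\<Union>n. ?E n)"
    then obtain n where "y + 1 / real (Suc n) < \<bar>f x\<bar>" by blast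
    moreover have "0 < 1 / real (Suc n)" by simp
    ultimately show "x \<in> {x. y < \<bar>f x\<bar>}" unfolding mem_Collect_eq by linarith
  qed
  finally obtain n where n: "ennreal t < emeasure um (?E n)"
    using L by (metis (no_types, lifting) less_SUP_iff)
  have "ennreal (y + 1 / real (Suc n)) \<le> rearr u f t"
    unfolding rearr_def
  proof (rule Inf_greatest, rule ccontr)
    fix z assume z: "z \<in> {z. 0 < z \<and> z < \<infinity> \<and> emeasure um {x. z < ennreal \<bar>f x\<bar>} \<le> ennreal t}"
      and lt: "\<not> ennreal (y + 1 / real (Suc n)) \<le> z"
    have "{x \<in> space lebesgue. z < ennreal \<bar>f x\<bar>} \<in> sets lebesgue" by measurable
    then have "emeasure um (?E n) \<le> emeasure um {x. z < ennreal \<bar>f x\<bar>}"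
    proof (intro emeasure_mono)
      show "?E n \<subseteq> {x. z < ennreal \<bar>f x\<bar>}"
        using lt by (auto simp: not_le intro: less_le_trans ennreal_leI)
    qed auto
    with z n show False by auto
  qed
  moreover have "ennreal y < ennreal (y + 1 / real (Suc n))"
    using y by (subst ennreal_less_iff) auto
  ultimately show "ennreal y < rearr u f t" by (rule less_le_trans[rotated])
next
  assume R: "ennreal y < rearr u f t"
  show "ennreal t < emeasure um {x. y < \<bar>f x\<bar>}"
  proof (rule ccontr)
    assume L: "\<not> ?thesis"
    obtain z where z: "ennreal y < z" "z < rearr u f t" using dense[OF R] by blast
    then have zt: "z < \<infinity>" using less_le_trans top_greatest by (metis infinity_ennreal_def order_less_le_trans)
    have "emeasure um {x. z < ennreal \<bar>f x\<bar>} \<le> emeasure um {x. y < \<bar>f x\<bar>}"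
    proof (rule emeasure_mono)
      show "{x. z < ennreal \<bar>f x\<bar>} \<subseteq> {x. y < \<bar>f x\<bar>}"
        using z(1) y by (auto dest: less_trans simp: ennreal_less_iff)
    qed (use sets_Collect_less_abs[OF assms(1)] in auto)
    with L have "emeasure um {x. z < ennreal \<bar>f x\<bar>} \<le> ennreal t" by auto
    moreover have "0 < z" using z(1) by (auto intro: le_less_trans)
    ultimately have "rearr u f t \<le> z"
      unfolding rearr_def using zt by (intro Inf_lower) auto
    with z(2) show False by simp
  qed
qed

lemma cap_eq_wm_rearr:
  assumes "f \<in> borel_measurable lebesgue" "0 \<le> y"
  shows "V {x. y < \<bar>f x\<bar>} = emeasure wm {t. ennreal y < rearr u f t}"
  unfolding cap_def less_rearr_iff[OF assms] ..

text \<open>Tonelli for the region y^a / D < rearr u f t: integrating in y first gives a power of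
  the rearrangement, integrating in t first gives \<open>V\<close> of a level set, by the duality
  between rearrangement and distribution function.\<close>

theorem layer_cake_powr:
  assumes f: "f \<in> borel_measurable lebesgue" and "0 < p" "0 < a" "0 < D"
  shows "(\<integral>\<^sup>+y. ennreal (p * y powr (p - 1)) * V {x. y powr a / D < \<bar>f x\<bar>} * indicator {0<..} y \<partial>lborel)
    = ennreal (D powr (p / a)) * N (p / a) f"
proof -
  interpret W: sigma_finite_measure wm by (rule sigma_finite_wm)
  interpret P: pair_sigma_finite wm lborel ..
  have [measurable]: "rearr u f \<in> borel_measurable wm"
    using rearr_borel_measurable[of u f] by (simp add: wmeas_def measurable_completion)
  let ?k = "\<lambda>t y. ennreal (p * y powr (p - 1)) * indicator {y. 0 < y \<and> ennreal (y powr a / D) < rearr u f t} y"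
  have [measurable]: "(\<lambda>(t, y). ?k t y) \<in> borel_measurable (wm \<Otimes>\<^sub>M lborel)"
    unfolding indicator_def by measurable
  have "ennreal (D powr (p / a)) * N (p / a) f = (\<integral>\<^sup>+t. (\<integral>\<^sup>+y. ?k t y \<partial>lborel) \<partial>wm)"
    unfolding lint_def by (subst nn_integral_powr_layer) (use assms in \<open>auto simp: nn_integral_cmult\<close>)
  also have "\<dots> = (\<integral>\<^sup>+y. (\<integral>\<^sup>+t. ?k t y \<partial>wm) \<partial>lborel)"
    by (rule P.Fubini'[symmetric]) measurable
  also have "\<dots> = (\<integral>\<^sup>+y. ennreal (p * y powr (p - 1)) * V {x. y powr a / D < \<bar>f x\<bar>} * indicator {0<..} y \<partial>lborel)"
  proof (rule nn_integral_cong)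
    fix y :: real
    have "(\<integral>\<^sup>+t. ?k t y \<partial>wm) = (\<integral>\<^sup>+t. (ennreal (p * y powr (p - 1)) * indicator {0<..} y) * indicator {t. ennreal (y powr a / D) < rearr u f t} t \<partial>wm)"
      by (intro nn_integral_cong) (auto simp: indicator_def)
    also have "\<dots> = ennreal (p * y powr (p - 1)) * indicator {0<..} y * emeasure wm {t. ennreal (y powr a / D) < rearr u f t}"
      by (subst nn_integral_cmult) auto
    finally show "(\<integral>\<^sup>+t. ?k t y \<partial>wm) = ennreal (p * y powr (p - 1)) * V {x. y powr a / D < \<bar>f x\<bar>} * indicator {0<..} y"
      using assms by (simp add: cap_eq_wm_rearr mult_ac)
  qed
  finally show ?thesis by simp
qed

end

lemma enn_powr_mono: "x \<le> y \<Longrightarrow> 0 < a \<Longrightarrow> enn_powr x a \<le> enn_powr y a"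
  unfolding enn_powr_def
  by (auto intro!: ennreal_leI powr_mono2 enn2real_mono simp: top_unique less_top[symmetric])

lemma enn_powr_ennreal: "0 \<le> x \<Longrightarrow> enn_powr (ennreal x) a = ennreal (x powr a)"
  by (simp add: enn_powr_def)

lemma enn_powr_finite_iff: "enn_powr x a < \<infinity> \<longleftrightarrow> x < \<infinity>"
  by (auto simp: enn_powr_def less_top[symmetric])

lemma enn_powr_mult_ennreal:
  assumes "0 < c"
  shows "enn_powr (ennreal c * x) a = ennreal (c powr a) * enn_powr x a"
proof (cases x)
  case (real r)
  then show ?thesis using assms
    by (simp add: ennreal_mult[symmetric] enn_powr_ennreal powr_mult)
next
  case top
  then show ?thesis using assms by (simp add: enn_powr_def ennreal_mult_top)
qed

lemma enn_powr_powr_inverse: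
  assumes "0 < a"
  shows "enn_powr (enn_powr x (1 / a)) a = x"
  using assms by (cases x) (auto simp: enn_powr_ennreal powr_powr, simp add: enn_powr_def)

section \<open>Continuity of \<open>V\<close> along monotone sequences and elementary properties of
  \<open>N\<close>\<close>

context lorentz_weights
begin

lemma sets_level[intro]: "(f :: real \<Rightarrow> real) \<in> borel_measurable lebesgue \<Longrightarrow> {x. y < \<bar>f x\<bar>} \<in> sets lebesgue"
  by (rule sets_Collect_less_abs)

lemma cap_mono_um: "emeasure um A \<le> emeasure um B \<Longrightarrow> V A \<le> V B"
  unfolding cap_def by (rule emeasure_mono) (auto intro: less_le_trans)

lemma cap_mono: "A \<subseteq> B \<Longrightarrow> B \<in> sets lebesgue \<Longrightarrow> V A \<le> V B"
  by (intro cap_mono_um emeasure_mono) auto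

text \<open>Identities between Hilbert transforms hold only where all of them exist, so inclusions
  of level sets are available up to null sets; absolute continuity of \<open>um\<close> makes that
  sufficient.\<close>

lemma cap_mono_AE:
  assumes "AE x in lebesgue. x \<in> A \<longrightarrow> x \<in> B" "B \<in> sets lebesgue"
  shows "V A \<le> V B"
proof (rule cap_mono_um, rule emeasure_mono_AE)
  show "AE x in um. x \<in> A \<longrightarrow> x \<in> B"
    unfolding umeas_def by (subst AE_density) (use assms(1) in auto)
qed (use assms in auto)

lemma cap_um_0: "emeasure um A = 0 \<Longrightarrow> V A = 0"
  by (simp add: cap_def)

lemma cap_empty[simp]: "V {} = 0"
  by (simp add: cap_um_0)

text \<open>Continuity from below is applied twice, to \<open>um\<close> and then to
  \<open>wm\<close>. The strict inequality in \<open>cap\<close> matters: s lies below a supremum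
  exactly when it lies below some term, so the sets of s increase to the right union.\<close>

lemma cap_SUP:
  assumes "incseq A" "\<And>n. A n \<in> sets lebesgue"
  shows "V (\<Union>n. A n) = (SUP n. V (A n))"
proof -
  have u: "emeasure um (\<Union>n. A n) = (SUP n. emeasure um (A n))"
    by (rule SUP_emeasure_incseq[symmetric]) (use assms in auto)
  have "V (\<Union>n. A n) = emeasure wm (\<Union>n. {s. ennreal s < emeasure um (A n)})"
    unfolding cap_def u by (rule arg_cong[where f="emeasure wm"]) (auto simp: less_SUP_iff)
  also have "\<dots> = (SUP n. V (A n))"
    unfolding cap_def
  proof (rule SUP_emeasure_incseq[symmetric])
    have "emeasure um (A m) \<le> emeasure um (A n)" if "m \<le> n" for m n
      using assms that by (intro emeasure_mono) (auto simp: incseq_def)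
    then show "incseq (\<lambda>n. {s. ennreal s < emeasure um (A n)})"
      by (auto simp: incseq_def intro: less_le_trans)
  qed auto
  finally show ?thesis .
qed

text \<open>A Fatou property of \<open>V\<close>, the source of lower semicontinuity of
  \<open>N\<close>. The intersections over tails increase, so continuity from below applies.\<close>

lemma cap_liminf:
  assumes "\<And>n::nat. A n \<in> sets lebesgue"
  shows "V {x. \<forall>\<^sub>F n in sequentially. x \<in> A n} \<le> liminf (\<lambda>n. V (A n))"
proof -
  have eq: "{x. \<forall>\<^sub>F n in sequentially. x \<in> A n} = (\<Union>n. \<Inter>k\<in>{n..}. A k)"
    by (auto simp: eventually_sequentially)
  have "V (\<Union>n. \<Inter>k\<in>{n..}. A k) = (SUP n. V (\<Inter>k\<in>{n..}. A k))"
  proof (rule cap_SUP)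
    show "(\<Inter>k\<in>{n..}. A k) \<in> sets lebesgue" for n
      using assms by (intro sets.countable_INT') auto
    show "incseq (\<lambda>n. \<Inter>k\<in>{n..}. A k)" by (auto simp: incseq_def)
  qed
  also have "\<dots> \<le> (SUP n. INF k\<in>{n..}. V (A k))"
    using assms by (intro SUP_mono bexI INF_greatest cap_mono) auto
  finally show ?thesis unfolding eq liminf_SUP_INF .
qed

lemma antimono_cap_level:
  fixes f :: "real \<Rightarrow> real"
  assumes "f \<in> borel_measurable lebesgue"
  shows "antimono (\<lambda>y. V {x. y < \<bar>f x\<bar>})"
  using assms by (auto simp: antimono_def intro!: cap_mono)

lemma cap_level_measurable[measurable]:
  fixes f :: "real \<Rightarrow> real"
  assumes "f \<in> borel_measurable lebesgue"
  shows "(\<lambda>y. V {x. y < \<bar>f x\<bar>}) \<in> borel_measurable borel"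
  by (rule antimono_borel_measurable_ennreal[OF antimono_cap_level[OF assms]])

lemma lint_eq:
  assumes "f \<in> borel_measurable lebesgue" "0 < p"
  shows "N p f = (\<integral>\<^sup>+y. ennreal (p * y powr (p - 1)) * V {x. y < \<bar>f x\<bar>} * indicator {0<..} y \<partial>lborel)"
proof -
  have "(\<integral>\<^sup>+y. ennreal (p * y powr (p - 1)) * V {x. y powr 1 / 1 < \<bar>f x\<bar>} * indicator {0<..} y \<partial>lborel)
     = ennreal (1 powr (p / 1)) * N (p / 1) f"
    by (rule layer_cake_powr) (use assms in auto)
  moreover have "(\<integral>\<^sup>+y. ennreal (p * y powr (p - 1)) * V {x. y powr 1 / 1 < \<bar>f x\<bar>} * indicator {0<..} y \<partial>lborel)
     = (\<integral>\<^sup>+y. ennreal (p * y powr (p - 1)) * V {x. y < \<bar>f x\<bar>} * indicator {0<..} y \<partial>lborel)"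
    by (intro nn_integral_cong) (auto simp: indicator_def)
  ultimately show ?thesis by simp
qed

lemma lint_scale:
  assumes "f \<in> borel_measurable lebesgue" "0 < p" "0 < D"
  shows "(\<integral>\<^sup>+y. ennreal (p * y powr (p - 1)) * V {x. y / D < \<bar>f x\<bar>} * indicator {0<..} y \<partial>lborel)
    = ennreal (D powr p) * N p f"
proof -
  have "(\<integral>\<^sup>+y. ennreal (p * y powr (p - 1)) * V {x. y powr 1 / D < \<bar>f x\<bar>} * indicator {0<..} y \<partial>lborel)
     = ennreal (D powr (p / 1)) * N (p / 1) f"
    by (rule layer_cake_powr) (use assms in auto)
  moreover have "(\<integral>\<^sup>+y. ennreal (p * y powr (p - 1)) * V {x. y powr 1 / D < \<bar>f x\<bar>} * indicator {0<..} y \<partial>lborel)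
     = (\<integral>\<^sup>+y. ennreal (p * y powr (p - 1)) * V {x. y / D < \<bar>f x\<bar>} * indicator {0<..} y \<partial>lborel)"
    by (intro nn_integral_cong) (auto simp: indicator_def)
  ultimately show ?thesis by simp
qed

lemma lint_cmult:
  assumes f: "f \<in> borel_measurable lebesgue" and "0 < p" "c \<noteq> 0"
  shows "N p (\<lambda>x. c * f x) = ennreal (\<bar>c\<bar> powr p) * N p f"
proof -
  have "N p (\<lambda>x. c * f x) = (\<integral>\<^sup>+y. ennreal (p * y powr (p - 1)) * V {x. y < \<bar>c * f x\<bar>} * indicator {0<..} y \<partial>lborel)"
    using assms by (intro lint_eq) auto
  also have "\<dots> = (\<integral>\<^sup>+y. ennreal (p * y powr (p - 1)) * V {x. y / \<bar>c\<bar> < \<bar>f x\<bar>} * indicator {0<..} y \<partial>lborel)"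
    using assms by (simp add: abs_mult pos_divide_less_eq mult.commute)
  also have "\<dots> = ennreal (\<bar>c\<bar> powr p) * N p f"
    using assms by (intro lint_scale) auto
  finally show ?thesis .
qed

lemma lint_mono_AE:
  assumes "f \<in> borel_measurable lebesgue" "g \<in> borel_measurable lebesgue" "0 < p"
    "AE x in lebesgue. \<bar>f x\<bar> \<le> \<bar>g x\<bar>"
  shows "N p f \<le> N p g"
  unfolding lint_eq[OF assms(1,3)] lint_eq[OF assms(2,3)]
proof (intro nn_integral_mono mult_right_mono mult_left_mono)
  show "V {x. y < \<bar>f x\<bar>} \<le> V {x. y < \<bar>g x\<bar>}" for y
    by (rule cap_mono_AE) (use assms in auto)
qed auto

lemma lint_mono:
  assumes "f \<in> borel_measurable lebesgue" "g \<in> borel_measurable lebesgue" "0 < p"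
    "\<And>x. \<bar>f x\<bar> \<le> \<bar>g x\<bar>"
  shows "N p f \<le> N p g"
  using assms by (intro lint_mono_AE) auto

lemma lint_chebyshev:
  assumes "f \<in> borel_measurable lebesgue" "0 < p" "0 \<le> s"
  shows "ennreal (s powr p) * V {x. s < \<bar>f x\<bar>} \<le> N p f"
proof -
  have [measurable]: "{t. ennreal s < rearr u f t} \<in> sets lebesgue"
  proof -
    have "{t. ennreal s < rearr u f t} \<in> sets borel" by measurable
    then show ?thesis by simp
  qed
  have "ennreal (s powr p) * V {x. s < \<bar>f x\<bar>} = (\<integral>\<^sup>+t. ennreal (s powr p) * indicator {t. ennreal s < rearr u f t} t \<partial>wm)"
    using assms by (subst nn_integral_cmult_indicator) (auto simp: cap_eq_wm_rearr)
  also have "\<dots> \<le> N p f"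
    unfolding lint_def using assms enn_powr_mono[of "ennreal s" _ p]
    by (intro nn_integral_mono) (auto simp: indicator_def enn_powr_ennreal)
  finally show ?thesis .
qed

lemma lint_indicator:
  assumes "E \<in> sets lebesgue" "0 < p"
  shows "N p (indicator E) = V E"
proof -
  have "N p (indicator E) = (\<integral>\<^sup>+y. ennreal (p * y powr (p - 1)) * V {x. y < \<bar>indicat_real E x\<bar>} * indicator {0<..} y \<partial>lborel)"
    using assms by (intro lint_eq) auto
  also have "\<dots> = (\<integral>\<^sup>+y. (ennreal p * V E) * (ennreal (y powr (p - 1)) * indicator {0<..<1} y) \<partial>lborel)"
  proof (rule nn_integral_cong)
    fix y :: real
    have "{x. y < \<bar>indicat_real E x\<bar>} = (if y < 1 then E else {})" if "0 < y"
      using that by (auto simp: indicator_def)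
    then show "ennreal (p * y powr (p - 1)) * V {x. y < \<bar>indicat_real E x\<bar>} * indicator {0<..} y
      = (ennreal p * V E) * (ennreal (y powr (p - 1)) * indicator {0<..<1} y)"
      using assms by (auto simp: indicator_def ennreal_mult mult_ac)
  qed
  also have "\<dots> = ennreal p * V E * ennreal (1 powr p / p)"
    using assms by (subst nn_integral_cmult) (auto simp: nn_integral_powr_lessThan)
  also have "\<dots> = V E * ennreal (p * (1 powr p / p))"
    using assms by (subst ennreal_mult) (auto simp: mult_ac)
  also have "\<dots> = V E" using assms by simp
  finally show ?thesis .
qed

lemma Wfun_eq: "Wfun w t = emeasure wm {s. s < t}"
proof -
  have "emeasure wm {s. s < t} = (\<integral>\<^sup>+x. ennreal (w x) * indicator {0<..} x * indicator {s. s < t} x \<partial>lebesgue)"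
    unfolding wmeas_def by (rule emeasure_density) (use w_measurable in \<open>auto simp: lessThan_def[symmetric]\<close>)
  also have "\<dots> = Wfun w t"
    unfolding Wfun_def by (intro nn_integral_cong) (auto simp: indicator_def)
  finally show ?thesis by simp
qed

lemma lorentz_norm_eq: "lorentz_norm u w p f = enn_powr (N p f) (1 / p)"
proof -
  have [measurable]: "(\<lambda>t. enn_powr (rearr u f t) p) \<in> borel_measurable lebesgue"
    by (intro measurable_completion) measurable
  have "N p f = (\<integral>\<^sup>+ t. ennreal (w t) * indicator {0<..} t * enn_powr (rearr u f t) p \<partial>lebesgue)"
    unfolding lint_def wmeas_def by (rule nn_integral_density) measurable
  then show ?thesis unfolding lorentz_norm_def by (simp add: mult_ac)
qed

text \<open>Left continuity of W, in a form that allows \<open>T\<close> to be infinite. The weak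
  norm tests W at real t strictly below u(E), whereas \<open>V E\<close> is W at u(E) itself; this
  closes the gap.\<close>

lemma wm_less_le:
  assumes "\<And>t. 0 < t \<Longrightarrow> ennreal t < T \<Longrightarrow> emeasure wm {s. s < t} \<le> c"
  shows "emeasure wm {s. ennreal s < T} \<le> c"
proof -
  have le: "emeasure wm {s. s < t} \<le> c" if "ennreal t < T" for t
  proof (cases "0 < t")
    case False
    have "emeasure wm {s. s < t} \<le> emeasure wm {..0}"
      by (rule emeasure_mono) (use False in auto)
    then show ?thesis by (simp add: wm_le_0)
  qed (use assms that in auto)
  have *: "emeasure wm (\<Union>n. {s. s < t n}) \<le> c" if "incseq t" "\<And>n. ennreal (t n) < T" for t :: "nat \<Rightarrow> real"
  proof -
    have "emeasure wm (\<Union>n. {s. s < t n}) = (SUP n. emeasure wm {s. s < t n})"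
      by (rule SUP_emeasure_incseq[symmetric])
         (use that(1) in \<open>auto simp: incseq_def lessThan_def[symmetric] intro: less_le_trans\<close>)
    then show ?thesis using le that(2) by (auto intro!: SUP_least)
  qed
  show ?thesis
  proof (cases T)
    case (real r)
    show ?thesis
    proof (cases "r = 0")
      case False
      with real have r: "0 < r" by simp
      let ?t = "\<lambda>n. r - r / real (Suc n)"
      have "incseq ?t" using r by (intro incseq_SucI diff_left_mono divide_left_mono) auto
      moreover have "ennreal (?t n) < T" for n
        using r real by (auto simp: ennreal_less_iff field_simps)
      ultimately have "emeasure wm (\<Union>n. {s. s < ?t n}) \<le> c" by (rule *)
      moreover have "(\<Union>n. {s. s < ?t n}) = {s. s < r}"
      proof (intro equalityI subsetI)
        fix s assume "s \<in> {s. s < r}"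
        then have "0 < (r - s) / r" using r by simp
        then obtain n where "1 / real (Suc n) < (r - s) / r" by (rule nat_approx_posE)
        then have "s < ?t n" using r by (simp add: field_simps)
        then show "s \<in> (\<Union>n. {s. s < ?t n})" by blast
      next
        fix s assume "s \<in> (\<Union>n. {s. s < ?t n})"
        then obtain n where "s < ?t n" by blast
        moreover have "0 < r / real (Suc n)" using r by simp
        ultimately show "s \<in> {s. s < r}" unfolding mem_Collect_eq by linarith
      qed
      moreover have "{s. ennreal s < T} = {s. s < r}"
        using real r by (auto intro: ennreal_lessI) (meson ennreal_leI not_le)
      ultimately show ?thesis by simp
    qed (use real in auto)
  next
    case top
    have "emeasure wm (\<Union>n. {s. s < real n}) \<le> c"
      by (rule *) (auto simp: incseq_def top)
    moreover have "(\<Union>n. {s. s < real n}) = {s. ennreal s < T}"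
      using reals_Archimedean2 by (auto simp: top)
    ultimately show ?thesis by simp
  qed
qed

end

section \<open>The Hilbert transform\<close>

lemma hilbertI:
  assumes "\<forall>\<^sub>F \<epsilon> in at_right 0. set_integrable lebesgue {y. \<epsilon> < \<bar>x - y\<bar>} (\<lambda>y. f y / (x - y))"
    and "(hilbert_trunc f x \<longlongrightarrow> L) (at_right 0)"
  shows "hilbert_defined f x" "hilbert f x = L / pi"
  using assms tendsto_Lim[OF _ assms(2)] unfolding hilbert_defined_def hilbert_def by auto

lemma hilbert_definedD:
  assumes "hilbert_defined f x"
  shows "(hilbert_trunc f x \<longlongrightarrow> pi * hilbert f x) (at_right 0)"
proof -
  obtain L where L: "(hilbert_trunc f x \<longlongrightarrow> L) (at_right 0)" using assms by (auto simp: hilbert_defined_def)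
  then have "hilbert f x = L / pi" by (simp add: hilbert_def tendsto_Lim)
  with L show ?thesis by simp
qed

text \<open>Stated at a single point, because existence is known only almost everywhere. Both
  truncated integrals must exist for a common range of small \<open>\<epsilon>\<close> before they
  can be combined.\<close>

lemma hilbert_linear:
  assumes f: "hilbert_defined f x" and g: "hilbert_defined g x"
  shows "hilbert_defined (\<lambda>y. a * f y + b * g y) x"
    and "hilbert (\<lambda>y. a * f y + b * g y) x = a * hilbert f x + b * hilbert g x"
proof -
  let ?h = "\<lambda>y. a * f y + b * g y"
  have ev: "\<forall>\<^sub>F \<epsilon> in at_right 0. set_integrable lebesgue {y. \<epsilon> < \<bar>x - y\<bar>} (\<lambda>y. ?h y / (x - y)) \<and>
     hilbert_trunc ?h x \<epsilon> = a * hilbert_trunc f x \<epsilon> + b * hilbert_trunc g x \<epsilon>"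
  proof -
    have "\<forall>\<^sub>F \<epsilon> in at_right 0. set_integrable lebesgue {y. \<epsilon> < \<bar>x - y\<bar>} (\<lambda>y. f y / (x - y))"
      "\<forall>\<^sub>F \<epsilon> in at_right 0. set_integrable lebesgue {y. \<epsilon> < \<bar>x - y\<bar>} (\<lambda>y. g y / (x - y))"
      using f g by (auto simp: hilbert_defined_def)
    then show ?thesis
    proof eventually_elim
      case (elim \<epsilon>)
      let ?S = "{y. \<epsilon> < \<bar>x - y\<bar>}"
      have eq: "(\<lambda>y. indicator ?S y *\<^sub>R (?h y / (x - y))) = (\<lambda>y. a * (indicator ?S y *\<^sub>R (f y / (x - y))) + b * (indicator ?S y *\<^sub>R (g y / (x - y))))"
        by (auto simp: add_divide_distrib distrib_left mult_ac)
      define F where "F = (\<lambda>y. indicator ?S y *\<^sub>R (f y / (x - y)))"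
      define G where "G = (\<lambda>y. indicator ?S y *\<^sub>R (g y / (x - y)))"
      have "integrable lebesgue F" "integrable lebesgue G"
        using elim by (auto simp: F_def G_def set_integrable_def)
      then have "integrable lebesgue (\<lambda>y. a * F y + b * G y) \<and>
         (\<integral>y. a * F y + b * G y \<partial>lebesgue) = a * integral\<^sup>L lebesgue F + b * integral\<^sup>L lebesgue G" by auto
      then show ?case unfolding hilbert_trunc_def set_integrable_def set_lebesgue_integral_def eq F_def G_def .
    qed
  qed
  have "((\<lambda>\<epsilon>. a * hilbert_trunc f x \<epsilon> + b * hilbert_trunc g x \<epsilon>) \<longlongrightarrow> a * (pi * hilbert f x) + b * (pi * hilbert g x)) (at_right 0)"
    by (intro tendsto_intros hilbert_definedD f g)
  then have "(hilbert_trunc ?h x \<longlongrightarrow> a * (pi * hilbert f x) + b * (pi * hilbert g x)) (at_right 0)"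
    by (rule Lim_transform_eventually) (use ev in eventually_elim, auto)
  from hilbertI[OF _ this] ev show "hilbert_defined ?h x"
    and "hilbert ?h x = a * hilbert f x + b * hilbert g x"
    by (auto simp: eventually_conj_iff add_divide_distrib)
qed

lemma hilbert_cmult:
  assumes "hilbert_defined f x"
  shows "hilbert_defined (\<lambda>y. a * f y) x" "hilbert (\<lambda>y. a * f y) x = a * hilbert f x"
  using hilbert_linear[OF assms assms, of a 0] by simp_all

lemma hilbert_add:
  assumes "hilbert_defined f x" "hilbert_defined g x"
  shows "hilbert_defined (\<lambda>y. f y + g y) x" "hilbert (\<lambda>y. f y + g y) x = hilbert f x + hilbert g x"
  using hilbert_linear[OF assms, of 1 1] by simp_all

lemma hilbert_diff:
  assumes "hilbert_defined f x" "hilbert_defined g x"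
  shows "hilbert_defined (\<lambda>y. f y - g y) x" "hilbert (\<lambda>y. f y - g y) x = hilbert f x - hilbert g x"
  using hilbert_linear[OF assms, of 1 "-1"] by simp_all

text \<open>A Borel representative of \<open>f\<close> leaves every truncated integral unchanged and
  makes the integrand jointly measurable in (x, y), so the parameter integral is Borel in x even
  when \<open>f\<close> is merely Lebesgue measurable.\<close>

lemma hilbert_trunc_measurable:
  assumes "f \<in> borel_measurable lebesgue"
  shows "(\<lambda>x. hilbert_trunc f x \<epsilon>) \<in> borel_measurable borel"
proof -
  obtain f' where f'[measurable]: "f' \<in> borel_measurable lborel" and ae: "AE x in lborel. f x = f' x"
    using completion_ex_borel_measurable_real[OF assms] by auto
  have ae': "AE x in lebesgue. f x = f' x" by (rule AE_completion[OF ae])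
  have eq: "hilbert_trunc f x \<epsilon> = (\<integral>y. indicator {y. \<epsilon> < \<bar>x - y\<bar>} y * (f' y / (x - y)) \<partial>lborel)" for x
  proof -
    have m: "(\<lambda>y. indicat_real {y. \<epsilon> < \<bar>x - y\<bar>} y * (f' y / (x - y))) \<in> borel_measurable lborel"
      unfolding indicator_def by measurable
    have "hilbert_trunc f x \<epsilon> = (\<integral>y. indicator {y. \<epsilon> < \<bar>x - y\<bar>} y * (f' y / (x - y)) \<partial>lebesgue)"
      unfolding hilbert_trunc_def set_lebesgue_integral_def
    proof (rule integral_cong_AE)
      have "(\<lambda>y. indicat_real {y. \<epsilon> < \<bar>x - y\<bar>} y) \<in> borel_measurable borel"
        unfolding indicator_def by measurable
      then have [measurable]: "(\<lambda>y. indicat_real {y. \<epsilon> < \<bar>x - y\<bar>} y) \<in> borel_measurable lebesgue"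
        by (intro measurable_completion) auto
      have [measurable]: "(\<lambda>y. x - y) \<in> borel_measurable lebesgue" by (intro measurable_completion) auto
      show "(\<lambda>xa. indicat_real {y. \<epsilon> < \<bar>x - y\<bar>} xa *\<^sub>R (f xa / (x - xa))) \<in> borel_measurable lebesgue"
        using assms by measurable
      show "(\<lambda>y. indicat_real {y. \<epsilon> < \<bar>x - y\<bar>} y * (f' y / (x - y))) \<in> borel_measurable lebesgue"
        using m by (rule measurable_completion)
    qed (use ae' in eventually_elim, auto)
    also have "\<dots> = (\<integral>y. indicator {y. \<epsilon> < \<bar>x - y\<bar>} y * (f' y / (x - y)) \<partial>lborel)"
      by (rule integral_completion[OF m])
    finally show ?thesis .
  qed
  have [measurable]: "(\<lambda>(x, y). indicat_real {y. \<epsilon> < \<bar>x - y\<bar>} y * (f' y / (x - y))) \<in> borel_measurable (borel \<Otimes>\<^sub>M lborel)"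
    unfolding indicator_def by measurable
  show ?thesis unfolding eq
    by (rule lborel.borel_measurable_lebesgue_integral) measurable
qed

text \<open>Along 1 / (n + 1) the limit is a sequential one and hence measurable; completeness of
  Lebesgue measure absorbs the points where no limit exists and \<open>hilbert\<close> has an
  unspecified value.\<close>

lemma hilbert_measurable:
  assumes f: "f \<in> borel_measurable lebesgue" and d: "AE x in lebesgue. hilbert_defined f x"
  shows "hilbert f \<in> borel_measurable lebesgue"
proof (rule borel_measurable_AE)
  show "(\<lambda>x. lim (\<lambda>n. hilbert_trunc f x (1 / real (Suc n))) / pi) \<in> borel_measurable lebesgue"
    using hilbert_trunc_measurable[OF f]
    by (intro measurable_completion borel_measurable_divide borel_measurable_lim_metric) auto
  show "AE x in lebesgue. lim (\<lambda>n. hilbert_trunc f x (1 / real (Suc n))) / pi = hilbert f x"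
    using d
  proof eventually_elim
    case (elim x)
    have "filterlim (\<lambda>n. 1 / real (Suc n)) (at_right 0) sequentially"
      using LIMSEQ_Suc[OF lim_1_over_n[where 'a=real]] unfolding filterlim_at
      by (auto simp del: of_nat_Suc)
    from filterlim_compose[OF hilbert_definedD[OF elim] this]
    have "(\<lambda>n. hilbert_trunc f x (1 / real (Suc n))) \<longlonglongrightarrow> pi * hilbert f x" .
    then have "lim (\<lambda>n. hilbert_trunc f x (1 / real (Suc n))) = pi * hilbert f x" by (rule limI)
    then show ?case by simp
  qed
qed

lemma hilbert_AE_zero:
  assumes "AE x in lebesgue. f x = 0"
  shows "hilbert_defined f x" "hilbert f x = 0"
proof -
  have z: "AE y in lebesgue. indicat_real S y *\<^sub>R (f y / (x - y)) = 0" for S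
    using assms by eventually_elim auto
  have i: "set_integrable lebesgue {y. \<epsilon> < \<bar>x - y\<bar>} (\<lambda>y. f y / (x - y))" for \<epsilon>
  proof -
    have m: "(\<lambda>y. indicat_real {y. \<epsilon> < \<bar>x - y\<bar>} y *\<^sub>R (f y / (x - y))) \<in> borel_measurable lebesgue"
      by (rule borel_measurable_AE[of "\<lambda>_. 0"]) (use z[of "{y. \<epsilon> < \<bar>x - y\<bar>}"] in \<open>auto elim!: AE_mp\<close>)
    show ?thesis unfolding set_integrable_def
      by (rule integrable_cong_AE[OF m _ z, THEN iffD2]) auto
  qed
  have "hilbert_trunc f x = (\<lambda>_. 0)"
    unfolding hilbert_trunc_def set_lebesgue_integral_def using z by (auto intro!: integral_eq_zero_AE)
  then show "hilbert_defined f x" "hilbert f x = 0"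
    using hilbertI[of x f 0] i by auto
qed

lemma has_bochner_integral_inverse_shift:
  fixes c d x :: real
  assumes "c \<le> d" "x < c \<or> d < x"
  shows "has_bochner_integral lebesgue (\<lambda>y. indicator {c..d} y * (1 / (x - y))) (ln \<bar>x - c\<bar> - ln \<bar>x - d\<bar>)"
proof -
  have "has_bochner_integral lborel (\<lambda>y. indicator {c..d} y *\<^sub>R (1 / (x - y))) (- ln \<bar>x - d\<bar> - (- ln \<bar>x - c\<bar>))"
  proof (rule has_bochner_integral_FTC_Icc[OF assms(1)])
    fix y assume y: "c \<le> y" "y \<le> d"
    show "((\<lambda>y. - ln \<bar>x - y\<bar>) has_vector_derivative 1 / (x - y)) (at y within {c..d})"
    proof (cases "y < x")
      case True
      have "((\<lambda>y. - ln (x - y)) has_real_derivative 1 / (x - y)) (at y within {c..d})"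
        using True by (auto intro!: derivative_eq_intros simp: field_simps)
      then show ?thesis unfolding has_real_derivative_iff_has_vector_derivative
        by (rule has_vector_derivative_transform[rotated 2]) (use True y assms in auto)
    next
      case False
      have "((\<lambda>y. - ln (y - x)) has_real_derivative 1 / (x - y)) (at y within {c..d})"
        using False y assms by (auto intro!: derivative_eq_intros simp: field_simps)
      then show ?thesis unfolding has_real_derivative_iff_has_vector_derivative
        by (rule has_vector_derivative_transform[rotated 2]) (use False y assms in auto)
    qed
  qed (use assms in \<open>auto intro!: continuous_intros\<close>)
  then show ?thesis
    by (simp add: has_bochner_integral_iff integrable_completion integral_completion)
qed

text \<open>Once \<open>\<epsilon>\<close> is below the distance from \<open>x\<close> to both
  endpoints, the truncated integral no longer depends on it: for \<open>x\<close> outside the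
  interval nothing is cut away, and for \<open>x\<close> inside the two terms ln \<epsilon> cancel
  by symmetry.\<close>

lemma hilbert_indicator_Icc:
  fixes a b x :: real
  assumes "a \<le> b" "x \<noteq> a" "x \<noteq> b"
  shows "hilbert_defined (indicator {a..b}) x"
    and "hilbert (indicator {a..b}) x = ln (\<bar>x - a\<bar> / \<bar>x - b\<bar>) / pi"
proof -
  define \<delta> where "\<delta> = min \<bar>x - a\<bar> \<bar>x - b\<bar>"
  have \<delta>: "0 < \<delta>" using assms by (auto simp: \<delta>_def)
  have *: "has_bochner_integral lebesgue (\<lambda>y. indicator {y. \<epsilon> < \<bar>x - y\<bar>} y *\<^sub>R (indicator {a..b} y / (x - y))) (ln (\<bar>x - a\<bar> / \<bar>x - b\<bar>))"
    if e: "0 < \<epsilon>" "\<epsilon> < \<delta>" for \<epsilon>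
  proof (cases "x < a \<or> b < x")
    case True
    have eq: "(\<lambda>y. indicator {y. \<epsilon> < \<bar>x - y\<bar>} y *\<^sub>R (indicator {a..b} y / (x - y))) = (\<lambda>y. indicator {a..b} y * (1 / (x - y)))"
      using True e by (auto simp: indicator_def \<delta>_def fun_eq_iff)
    show ?thesis unfolding eq using has_bochner_integral_inverse_shift[OF assms(1) True] assms
      by (simp add: ln_div)
  next
    case False
    have "has_bochner_integral lebesgue (\<lambda>y. indicator {a..x-\<epsilon>} y * (1 / (x - y)) + indicator {x+\<epsilon>..b} y * (1 / (x - y)))
      ((ln \<bar>x - a\<bar> - ln \<bar>x - (x - \<epsilon>)\<bar>) + (ln \<bar>x - (x + \<epsilon>)\<bar> - ln \<bar>x - b\<bar>))"
      using False e by (intro has_bochner_integral_add has_bochner_integral_inverse_shift) (auto simp: \<delta>_def)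
    then have h: "has_bochner_integral lebesgue (\<lambda>y. indicator {a..x-\<epsilon>} y * (1 / (x - y)) + indicator {x+\<epsilon>..b} y * (1 / (x - y)))
      (ln (\<bar>x - a\<bar> / \<bar>x - b\<bar>))" using assms by (simp add: ln_div)
    \<comment> \<open>The two closed intervals and the open truncation region differ, within [a, b],
      only at the points x - \<epsilon> and x + \<epsilon>.\<close>
    have "AE y in lborel. y \<noteq> x - \<epsilon> \<and> y \<noteq> x + \<epsilon>"
      using AE_lborel_singleton[of "x - \<epsilon>"] AE_lborel_singleton[of "x + \<epsilon>"] by eventually_elim auto
    then have "AE y in lebesgue. y \<noteq> x - \<epsilon> \<and> y \<noteq> x + \<epsilon>" by (rule AE_completion)
    then have ae: "AE y in lebesgue. indicator {a..x-\<epsilon>} y * (1 / (x - y)) + indicator {x+\<epsilon>..b} y * (1 / (x - y))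
       = indicator {y. \<epsilon> < \<bar>x - y\<bar>} y *\<^sub>R (indicator {a..b} y / (x - y))"
      by eventually_elim (use False e in \<open>auto simp: indicator_def \<delta>_def\<close>)
    have m: "(\<lambda>y. indicator {a..x-\<epsilon>} y * (1 / (x - y)) + indicator {x+\<epsilon>..b} y * (1 / (x - y))) \<in> borel_measurable lebesgue"
      using h by (auto simp: has_bochner_integral_iff)
    show ?thesis
      using has_bochner_integral_cong_AE[OF m borel_measurable_AE[OF m ae] ae] h by simp
  qed
  have "\<forall>\<^sub>F \<epsilon> in at_right 0. 0 < \<epsilon> \<and> \<epsilon> < \<delta>"
    using \<delta> by (auto simp: eventually_at_right_field)
  then have ev: "\<forall>\<^sub>F \<epsilon> in at_right 0. set_integrable lebesgue {y. \<epsilon> < \<bar>x - y\<bar>} (\<lambda>y. indicator {a..b} y / (x - y)) \<and>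
     hilbert_trunc (indicator {a..b}) x \<epsilon> = ln (\<bar>x - a\<bar> / \<bar>x - b\<bar>)"
    by eventually_elim (use * in \<open>auto simp: has_bochner_integral_iff set_integrable_def hilbert_trunc_def set_lebesgue_integral_def\<close>)
  then have "(hilbert_trunc (indicator {a..b}) x \<longlongrightarrow> ln (\<bar>x - a\<bar> / \<bar>x - b\<bar>)) (at_right 0)"
    by (intro tendsto_eventually) (auto simp: eventually_conj_iff)
  from hilbertI[OF _ this] ev show "hilbert_defined (indicator {a..b}) x"
    "hilbert (indicator {a..b}) x = ln (\<bar>x - a\<bar> / \<bar>x - b\<bar>) / pi"
    by (auto simp: eventually_conj_iff)
qed

section \<open>Rational functions and Cotlar's identity\<close>

lemma set_integrable_inverse_square:
  fixes \<epsilon> x :: real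
  assumes "0 < \<epsilon>"
  shows "set_integrable lborel {y. \<epsilon> < \<bar>x - y\<bar>} (\<lambda>y. 1 / (x - y)\<^sup>2)"
proof -
  define k where "k = (\<lambda>s::real. indicator {\<epsilon>..} s * s powr (- 2))"
  have "integrable lborel k"
  proof (rule integrableI_bounded)
    show "k \<in> borel_measurable lborel" unfolding k_def by measurable
    have "(\<integral>\<^sup>+s. ennreal (norm (k s)) \<partial>lborel) = (\<integral>\<^sup>+y. ennreal (y powr (- 1 - 1)) * indicator {\<epsilon>..} y \<partial>lborel)"
      unfolding k_def by (intro nn_integral_cong) (auto simp: indicator_def)
    also have "\<dots> < \<infinity>" using assms by (subst nn_integral_powr_atLeast) auto
    finally show "(\<integral>\<^sup>+s. ennreal (norm (k s)) \<partial>lborel) < \<infinity>" .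
  qed
  from lborel_integrable_real_affine[OF this, of "-1" x] lborel_integrable_real_affine[OF this, of 1 "-x"]
  have i: "integrable lborel (\<lambda>y. k (x + - 1 * y) + k (- x + 1 * y))" by (intro Bochner_Integration.integrable_add) auto
  show ?thesis unfolding set_integrable_def
  proof (rule Bochner_Integration.integrable_bound[OF i])
    show "(\<lambda>y. indicat_real {y. \<epsilon> < \<bar>x - y\<bar>} y *\<^sub>R (1 / (x - y)\<^sup>2)) \<in> borel_measurable lborel"
      unfolding indicator_def by measurable
    show "AE y in lborel. norm (indicat_real {y. \<epsilon> < \<bar>x - y\<bar>} y *\<^sub>R (1 / (x - y)\<^sup>2)) \<le> norm (k (x + - 1 * y) + k (- x + 1 * y))"
    proof (rule AE_I2)
      fix y
      consider "\<epsilon> < x - y" | "\<epsilon> < y - x" | "\<not> \<epsilon> < \<bar>x - y\<bar>" by linarith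
      then show "norm (indicat_real {y. \<epsilon> < \<bar>x - y\<bar>} y *\<^sub>R (1 / (x - y)\<^sup>2)) \<le> norm (k (x + - 1 * y) + k (- x + 1 * y))"
        using assms by cases (auto simp: k_def indicator_def powr_minus_divide power2_commute powr_realpow[of _ 2, simplified])
    qed
  qed
qed

text \<open>From |x - y| <= (1 + |x|)(1 + |y|) the decay 1 / (1 + |y|) is at most (1 + |x|) / |x -
  y|. It thus supplies a second factor 1 / |x - y|, and the integrand is dominated by a multiple of
  (x - y)^(-2).\<close>

lemma set_integrable_hilbert_decay:
  fixes G :: "real \<Rightarrow> complex"
  assumes [measurable]: "G \<in> borel_measurable borel" and b: "\<And>y. norm (G y) \<le> C / (1 + \<bar>y\<bar>)" and e: "0 < \<epsilon>"
  shows "set_integrable lborel {y. \<epsilon> < \<bar>x - y\<bar>} (\<lambda>y. G y / of_real (x - y))"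
  unfolding set_integrable_def
proof (rule Bochner_Integration.integrable_bound)
  show "integrable lborel (\<lambda>y. C * (1 + \<bar>x\<bar>) * (indicat_real {y. \<epsilon> < \<bar>x - y\<bar>} y *\<^sub>R (1 / (x - y)\<^sup>2)))"
    using set_integrable_inverse_square[OF e, of x] unfolding set_integrable_def
    by (intro integrable_mult_right)
  show "(\<lambda>y. indicat_real {y. \<epsilon> < \<bar>x - y\<bar>} y *\<^sub>R (G y / of_real (x - y))) \<in> borel_measurable lborel"
    unfolding indicator_def by measurable
  show "AE y in lborel. norm (indicat_real {y. \<epsilon> < \<bar>x - y\<bar>} y *\<^sub>R (G y / of_real (x - y)))
     \<le> norm (C * (1 + \<bar>x\<bar>) * (indicat_real {y. \<epsilon> < \<bar>x - y\<bar>} y *\<^sub>R (1 / (x - y)\<^sup>2)))"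
  proof (rule AE_I2)
    fix y
    have C: "0 \<le> C" using b[of 0] norm_ge_zero[of "G 0"] by (simp del: norm_ge_zero)
    have "norm (G y / of_real (x - y)) \<le> C * (1 + \<bar>x\<bar>) * (1 / (x - y)\<^sup>2)" if "\<epsilon> < \<bar>x - y\<bar>"
    proof -
      have "\<bar>x - y\<bar> \<le> (1 + \<bar>x\<bar>) * (1 + \<bar>y\<bar>)"
      proof -
        have "\<bar>x - y\<bar> \<le> \<bar>x\<bar> + \<bar>y\<bar>" by simp
        also have "\<dots> \<le> \<bar>x\<bar> + \<bar>y\<bar> + (1 + \<bar>x\<bar> * \<bar>y\<bar>)" by simp
        finally show ?thesis by (simp add: algebra_simps)
      qed
      then have "\<bar>x - y\<bar> / (1 + \<bar>y\<bar>) \<le> 1 + \<bar>x\<bar>" by (simp add: pos_divide_le_eq)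
      then have "1 / (1 + \<bar>y\<bar>) \<le> (1 + \<bar>x\<bar>) / \<bar>x - y\<bar>" using that e by (simp add: field_simps)
      then have "C / (1 + \<bar>y\<bar>) \<le> C * ((1 + \<bar>x\<bar>) / \<bar>x - y\<bar>)" using C by (metis mult_left_mono times_divide_eq_right mult.right_neutral)
      with b[of y] have "norm (G y) \<le> C * ((1 + \<bar>x\<bar>) / \<bar>x - y\<bar>)" by linarith
      then have "norm (G y) / \<bar>x - y\<bar> \<le> C * ((1 + \<bar>x\<bar>) / \<bar>x - y\<bar>) / \<bar>x - y\<bar>" by (rule divide_right_mono) simp
      then show ?thesis by (simp add: norm_divide power2_eq_square abs_mult[symmetric] del: of_real_diff)
    qed
    then show "norm (indicat_real {y. \<epsilon> < \<bar>x - y\<bar>} y *\<^sub>R (G y / of_real (x - y)))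
     \<le> norm (C * (1 + \<bar>x\<bar>) * (indicat_real {y. \<epsilon> < \<bar>x - y\<bar>} y *\<^sub>R (1 / (x - y)\<^sup>2)))"
      using C by (auto simp: indicator_def abs_mult simp del: of_real_diff)
  qed
qed

section \<open>Principal values of powers of 1 / (y + i)\<close>

lemma add_ii_nz[simp]: "complex_of_real y + \<i> \<noteq> 0"
  by (simp add: complex_eq_iff)

lemma norm_add_ii: "norm (complex_of_real y + \<i>) = sqrt (1 + y\<^sup>2)"
  by (simp add: norm_complex_def add.commute)

lemma norm_inverse_add_ii_le: "norm (1 / (complex_of_real y + \<i>)) \<le> 2 / (1 + \<bar>y\<bar>)"
proof -
  have "((1 + \<bar>y\<bar>) / 2)\<^sup>2 \<le> 1 + y\<^sup>2"
    using sum_power2_ge_zero[of "1 - \<bar>y\<bar>" y] by (simp add: power2_eq_square algebra_simps)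
  then have "(1 + \<bar>y\<bar>) / 2 \<le> sqrt (1 + y\<^sup>2)" by (rule real_le_rsqrt)
  then have "1 / sqrt (1 + y\<^sup>2) \<le> 1 / ((1 + \<bar>y\<bar>) / 2)" by (intro divide_left_mono) (auto intro!: add_pos_nonneg mult_pos_pos)
  then show ?thesis by (simp add: norm_divide norm_add_ii)
qed

text \<open>A primitive of \<open>1 / ((y + i)\<^sup>k\<^sup>+\<^sup>1 (x - y))\<close>, obtained from
  \<open>1 / ((y + i) (x - y)) = (1 / (y + i) + 1 / (x - y)) / (x + i)\<close>.\<close>

primrec hilbert_prim :: "real \<Rightarrow> nat \<Rightarrow> real \<Rightarrow> complex" where
  "hilbert_prim x 0 y = (Ln (of_real y + \<i>) - of_real (ln \<bar>x - y\<bar>)) / (of_real x + \<i>)"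
| "hilbert_prim x (Suc k) y = (hilbert_prim x k y - 1 / (of_nat (Suc k) * (of_real y + \<i>) ^ Suc k)) / (of_real x + \<i>)"

lemma hilbert_prim_0: "hilbert_prim x 0 = (\<lambda>y. (Ln (of_real y + \<i>) - of_real (ln \<bar>x - y\<bar>)) / (of_real x + \<i>))"
  by (rule ext) (rule hilbert_prim.simps)

lemma hilbert_prim_Suc: "hilbert_prim x (Suc k) = (\<lambda>y. (hilbert_prim x k y - 1 / (of_nat (Suc k) * (of_real y + \<i>) ^ Suc k)) / (of_real x + \<i>))"
  by (rule ext) (rule hilbert_prim.simps)

lemma hilbert_prim_deriv:
  assumes "y \<noteq> x"
  shows "(hilbert_prim x k has_vector_derivative 1 / (of_real y + \<i>) ^ Suc k / of_real (x - y)) (at y)"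
proof (induction k)
  case 0
  have 1: "((\<lambda>y. Ln (of_real y + \<i>)) has_vector_derivative 1 / (of_real y + \<i>)) (at y)"
    by (rule has_vector_derivative_real_field[where f="\<lambda>z. Ln (z + \<i>)"])
       (auto intro!: derivative_eq_intros simp: complex_nonpos_Reals_iff inverse_eq_divide)
  have "((\<lambda>y. ln \<bar>x - y\<bar>) has_real_derivative - (1 / (x - y))) (at y)"
  proof (cases "y < x")
    case True
    have "((\<lambda>y. ln (x - y)) has_real_derivative - (1 / (x - y))) (at y)"
      using True by (auto intro!: derivative_eq_intros simp: field_simps)
    then show ?thesis
      by (rule has_field_derivative_transform_within_open[where S="{..<x}"]) (use True in auto)
  next
    case False
    have "((\<lambda>y. ln (y - x)) has_real_derivative - (1 / (x - y))) (at y)"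
      using False assms by (auto intro!: derivative_eq_intros simp: field_simps)
    then show ?thesis
      by (rule has_field_derivative_transform_within_open[where S="{x<..}"]) (use False assms in auto)
  qed
  then have 2: "((\<lambda>y. complex_of_real (ln \<bar>x - y\<bar>)) has_vector_derivative of_real (- (1 / (x - y)))) (at y)"
    by (intro has_vector_derivative_of_real) (simp add: has_real_derivative_iff_has_vector_derivative)
  have "((\<lambda>y. (Ln (of_real y + \<i>) - of_real (ln \<bar>x - y\<bar>)) / (of_real x + \<i>)) has_vector_derivative
     (1 / (of_real y + \<i>) - of_real (- (1 / (x - y)))) / (of_real x + \<i>)) (at y)"
    by (intro has_vector_derivative_divide has_vector_derivative_diff 1 2)
  moreover have "(1 / (of_real y + \<i>) - of_real (- (1 / (x - y)))) / (of_real x + \<i>) = 1 / (of_real y + \<i>) / complex_of_real (x - y)"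
  proof -
    have "complex_of_real x - of_real y \<noteq> 0" using assms by simp
    then show ?thesis by (simp add: divide_simps)
  qed
  ultimately show ?case unfolding hilbert_prim_0 by (simp del: of_real_diff)
next
  case (Suc k)
  have 1: "((\<lambda>y. 1 / (of_nat (Suc k) * (of_real y + \<i>) ^ Suc k)) has_vector_derivative - (1 / (of_real y + \<i>) ^ Suc (Suc k))) (at y)"
  proof (rule has_vector_derivative_real_field[where f="\<lambda>z. 1 / (of_nat (Suc k) * (z + \<i>) ^ Suc k)"])
    have *: "of_nat k * Y ^ (k - Suc 0) * Y = of_nat k * Y ^ k" for Y :: complex
      by (cases k) auto
    show "((\<lambda>z. 1 / (of_nat (Suc k) * (z + \<i>) ^ Suc k)) has_field_derivative - (1 / (of_real y + \<i>) ^ Suc (Suc k))) (at (of_real y))"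
      by (auto intro!: derivative_eq_intros simp: divide_simps simp del: of_nat_Suc)
         (simp add: * distrib_right)
  qed
  have "((\<lambda>y. (hilbert_prim x k y - 1 / (of_nat (Suc k) * (of_real y + \<i>) ^ Suc k)) / (of_real x + \<i>)) has_vector_derivative
     (1 / (of_real y + \<i>) ^ Suc k / of_real (x - y) - - (1 / (of_real y + \<i>) ^ Suc (Suc k))) / (of_real x + \<i>)) (at y)"
    by (intro has_vector_derivative_divide has_vector_derivative_diff 1 Suc)
  moreover have "(1 / (of_real y + \<i>) ^ Suc k / of_real (x - y) - - (1 / (of_real y + \<i>) ^ Suc (Suc k))) / (of_real x + \<i>)
     = 1 / (of_real y + \<i>) ^ Suc (Suc k) / complex_of_real (x - y)"
  proof -
    have "complex_of_real x - of_real y \<noteq> 0" using assms by simp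
    then show ?thesis by (simp add: divide_simps)
  qed
  ultimately show ?case unfolding hilbert_prim_Suc by (simp only:)
qed

lemma tendsto_inverse_power_add_ii:
  "((\<lambda>y. 1 / (of_nat (Suc k) * (complex_of_real y + \<i>) ^ Suc k)) \<longlongrightarrow> 0) at_top"
  "((\<lambda>y. 1 / (of_nat (Suc k) * (complex_of_real y + \<i>) ^ Suc k)) \<longlongrightarrow> 0) at_bot"
proof -
  have b: "norm (1 / (of_nat (Suc k) * (complex_of_real y + \<i>) ^ Suc k)) \<le> 2 / (1 + \<bar>y\<bar>)" for y
  proof -
    have "1 \<le> norm (complex_of_real y + \<i>)" by (simp add: norm_add_ii)
    then have n: "norm (complex_of_real y + \<i>) \<le> norm (complex_of_real y + \<i>) ^ Suc k" by (intro self_le_power) auto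
    have "norm (1 / (of_nat (Suc k) * (complex_of_real y + \<i>) ^ Suc k)) = 1 / (real (Suc k) * norm (complex_of_real y + \<i>) ^ Suc k)"
      by (simp add: norm_divide norm_mult norm_power del: of_nat_Suc power_Suc)
    also have "\<dots> \<le> 1 / (1 * norm (complex_of_real y + \<i>))"
      using n by (intro divide_left_mono mult_mono) (auto simp del: power_Suc intro!: mult_pos_pos)
    also have "\<dots> \<le> 2 / (1 + \<bar>y\<bar>)" using norm_inverse_add_ii_le[of y] by (simp add: norm_divide)
    finally show ?thesis .
  qed
  have l: "((\<lambda>y::real. 2 / (1 + \<bar>y\<bar>)) \<longlongrightarrow> 0) F" if "filterlim (\<lambda>y::real. y) at_infinity F" for F
  proof (rule tendsto_divide_0[OF tendsto_const])
    have "filterlim (\<lambda>y. \<bar>y\<bar>) at_top F" using filterlim_at_infinity_imp_norm_at_top[OF that] by simp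
    then show "filterlim (\<lambda>y. 1 + \<bar>y\<bar>) at_infinity F"
      by (intro filterlim_at_top_imp_at_infinity filterlim_tendsto_add_at_top[OF tendsto_const])
  qed
  show "((\<lambda>y. 1 / (of_nat (Suc k) * (complex_of_real y + \<i>) ^ Suc k)) \<longlongrightarrow> 0) at_top"
    by (rule Lim_null_comparison[OF always_eventually[OF allI[OF b]] l[OF filterlim_at_top_imp_at_infinity[OF filterlim_ident]]])
  show "((\<lambda>y. 1 / (of_nat (Suc k) * (complex_of_real y + \<i>) ^ Suc k)) \<longlongrightarrow> 0) at_bot"
    by (rule Lim_null_comparison[OF always_eventually[OF allI[OF b]] l[OF filterlim_at_bot_imp_at_infinity[OF filterlim_ident]]])
qed


lemma tendsto_ln_abs_ratio:
  fixes x :: real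
  shows "((\<lambda>y. ln (\<bar>y\<bar> / \<bar>x - y\<bar>)) \<longlongrightarrow> 0) at_top" "((\<lambda>y. ln (\<bar>y\<bar> / \<bar>x - y\<bar>)) \<longlongrightarrow> 0) at_bot"
proof -
  have l: "((\<lambda>y. ln (\<bar>y\<bar> / \<bar>x - y\<bar>)) \<longlongrightarrow> 0) F" if F: "filterlim (\<lambda>y::real. y) at_infinity F" for F
  proof -
    have "((\<lambda>y. x / y) \<longlongrightarrow> 0) F" by (rule tendsto_divide_0[OF tendsto_const F])
    then have "((\<lambda>y. ln (1 / \<bar>x / y - 1\<bar>)) \<longlongrightarrow> ln (1 / \<bar>0 - 1\<bar>)) F"
      by (intro tendsto_intros) auto
    moreover have "\<forall>\<^sub>F y in F. y \<noteq> 0"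
      using F filterlim_at_infinity_imp_eventually_ne by fastforce
    then have "\<forall>\<^sub>F y in F. ln (1 / \<bar>x / y - 1\<bar>) = ln (\<bar>y\<bar> / \<bar>x - y\<bar>)"
    proof eventually_elim
      case (elim y)
      have "x / y - 1 = (x - y) / y" using elim by (simp add: field_simps)
      then show ?case by (simp add: abs_divide)
    qed
    ultimately show ?thesis by (simp add: Lim_transform_eventually)
  qed
  show "((\<lambda>y. ln (\<bar>y\<bar> / \<bar>x - y\<bar>)) \<longlongrightarrow> 0) at_top" "((\<lambda>y. ln (\<bar>y\<bar> / \<bar>x - y\<bar>)) \<longlongrightarrow> 0) at_bot"
    by (rule l[OF filterlim_at_top_imp_at_infinity[OF filterlim_ident]], rule l[OF filterlim_at_bot_imp_at_infinity[OF filterlim_ident]])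
qed

lemma tendsto_Ln_one_plus:
  assumes "filterlim (\<lambda>y::real. y) at_infinity F"
  shows "((\<lambda>y. Ln (1 + \<i> / of_real y)) \<longlongrightarrow> 0) F"
proof -
  have "filterlim (\<lambda>y. complex_of_real y) at_infinity F"
    using assms by (simp add: filterlim_at_infinity_conv_norm_at_top)
  then have "((\<lambda>y. \<i> / complex_of_real y) \<longlongrightarrow> 0) F"
    by (intro tendsto_divide_0[OF tendsto_const])
  then have "((\<lambda>y. Ln (1 + \<i> / of_real y)) \<longlongrightarrow> Ln (1 + 0)) F"
    by (intro tendsto_intros) (auto simp: complex_nonpos_Reals_iff)
  then show ?thesis by simp
qed

lemma hilbert_prim_at_top: "(hilbert_prim x k \<longlongrightarrow> 0) at_top"
proof (induction k)
  case 0
  have "((\<lambda>y. (Ln (1 + \<i> / of_real y) + of_real (ln (\<bar>y\<bar> / \<bar>x - y\<bar>))) / (of_real x + \<i>)) \<longlongrightarrow> (0 + of_real 0) / (of_real x + \<i>)) at_top"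
    by (intro tendsto_intros tendsto_Ln_one_plus tendsto_ln_abs_ratio filterlim_at_top_imp_at_infinity[OF filterlim_ident]) simp
  then have "((\<lambda>y. (Ln (1 + \<i> / of_real y) + of_real (ln (\<bar>y\<bar> / \<bar>x - y\<bar>))) / (of_real x + \<i>)) \<longlongrightarrow> 0) at_top" by simp
  moreover have "\<forall>\<^sub>F y in at_top. (Ln (1 + \<i> / of_real y) + of_real (ln (\<bar>y\<bar> / \<bar>x - y\<bar>))) / (of_real x + \<i>) = hilbert_prim x 0 y"
    using eventually_gt_at_top[of "max 0 x"]
  proof eventually_elim
    case (elim y)
    have "Ln (of_real y + \<i>) = Ln (of_real y * (1 + \<i> / of_real y))" using elim by (simp add: distrib_left)
    also have "\<dots> = of_real (ln y) + Ln (1 + \<i> / of_real y)"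
      using elim by (subst Ln_times_of_real) (auto simp: complex_eq_iff)
    finally show ?case using elim by (simp add: ln_div)
  qed
  ultimately show ?case by (rule Lim_transform_eventually)
next
  case (Suc k)
  have "((\<lambda>y. (hilbert_prim x k y - 1 / (of_nat (Suc k) * (of_real y + \<i>) ^ Suc k)) / (of_real x + \<i>)) \<longlongrightarrow> (0 - 0) / (of_real x + \<i>)) at_top"
    by (intro tendsto_intros Suc tendsto_inverse_power_add_ii) simp
  then show ?case unfolding hilbert_prim_Suc by simp
qed

text \<open>The limit differs from the one at plus infinity because \<open>y + \<i>\<close> stays in
  the upper half-plane: its argument tends to pi here and to 0 there. This asymmetry is the only
  contribution that survives in the principal value, and it produces the factor -i in H F = -i
  F.\<close>

lemma hilbert_prim_at_bot: "(hilbert_prim x k \<longlongrightarrow> \<i> * pi / (of_real x + \<i>) ^ Suc k) at_bot"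
proof (induction k)
  case 0
  have "((\<lambda>y. (\<i> * pi + Ln (1 + \<i> / of_real y) + of_real (ln (\<bar>y\<bar> / \<bar>x - y\<bar>))) / (of_real x + \<i>)) \<longlongrightarrow> (\<i> * pi + 0 + of_real 0) / (of_real x + \<i>)) at_bot"
    by (intro tendsto_intros tendsto_Ln_one_plus tendsto_ln_abs_ratio filterlim_at_bot_imp_at_infinity[OF filterlim_ident]) simp
  then have "((\<lambda>y. (\<i> * pi + Ln (1 + \<i> / of_real y) + of_real (ln (\<bar>y\<bar> / \<bar>x - y\<bar>))) / (of_real x + \<i>)) \<longlongrightarrow> \<i> * pi / (of_real x + \<i>)) at_bot" by simp
  moreover have "\<forall>\<^sub>F y in at_bot. (\<i> * pi + Ln (1 + \<i> / of_real y) + of_real (ln (\<bar>y\<bar> / \<bar>x - y\<bar>))) / (of_real x + \<i>) = hilbert_prim x 0 y"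
  proof -
    have "\<forall>\<^sub>F y in at_bot. y < min 0 x" by (rule eventually_gt_at_bot)
    then show ?thesis
    proof eventually_elim
      case (elim y)
      \<comment> \<open>For y < 0 the principal branch gives Ln(y + i) = Ln(-y - i) + i pi, and -y -
        i has positive real part, so the positive factor -y can be split off.\<close>
      have "Ln (of_real y + \<i>) = Ln (- (- of_real y - \<i>))" by (simp add: add.commute)
      also have "\<dots> = Ln (- of_real y - \<i>) + \<i> * pi"
        by (subst Ln_minus) (auto simp: complex_eq_iff)
      also have "- of_real y - \<i> = of_real (- y) * (1 + \<i> / of_real y)" using elim by (simp add: distrib_left)
      also have "Ln \<dots> = Ln (of_real (- y)) + Ln (1 + \<i> / of_real y)"
        using elim by (subst Ln_times_of_real) (auto simp: complex_eq_iff)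
      also have "Ln (of_real (- y)) = of_real (ln (- y))" using elim by (intro Ln_of_real) auto
      finally have "Ln (of_real y + \<i>) = of_real (ln (- y)) + Ln (1 + \<i> / of_real y) + \<i> * pi" .
      moreover have "ln (\<bar>y\<bar> / \<bar>x - y\<bar>) = ln (- y) - ln \<bar>x - y\<bar>"
      proof -
        have "\<bar>y\<bar> = - y" using elim by simp
        show ?thesis unfolding \<open>\<bar>y\<bar> = - y\<close> using elim by (intro ln_divide_pos) auto
      qed
      ultimately show ?case by simp
    qed
  qed
  ultimately show ?case unfolding power_Suc power_0 mult_1_right by (rule Lim_transform_eventually)
next
  case (Suc k)
  have "((\<lambda>y. (hilbert_prim x k y - 1 / (of_nat (Suc k) * (of_real y + \<i>) ^ Suc k)) / (of_real x + \<i>)) \<longlongrightarrow> (\<i> * pi / (of_real x + \<i>) ^ Suc k - 0) / (of_real x + \<i>)) at_bot"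
    by (intro tendsto_intros Suc tendsto_inverse_power_add_ii) simp
  then show ?case unfolding hilbert_prim_Suc by (simp add: mult_ac)
qed

text \<open>The only singularity at \<open>x\<close> is ln |x - y|, which is even about
  \<open>x\<close> and drops out of the symmetric difference; the rest is continuous. This is where
  the principal value enters.\<close>

lemma hilbert_prim_jump: "((\<lambda>\<epsilon>. hilbert_prim x k (x - \<epsilon>) - hilbert_prim x k (x + \<epsilon>)) \<longlongrightarrow> 0) (at_right 0)"
proof (induction k)
  case 0
  have "((\<lambda>\<epsilon>. (Ln (of_real (x - \<epsilon>) + \<i>) - Ln (of_real (x + \<epsilon>) + \<i>)) / (of_real x + \<i>)) \<longlongrightarrow>
    (Ln (of_real (x - 0) + \<i>) - Ln (of_real (x + 0) + \<i>)) / (of_real x + \<i>)) (at_right 0)"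
    by (intro tendsto_intros) (auto simp: complex_nonpos_Reals_iff)
  then show ?case by (simp add: diff_divide_distrib)
next
  case (Suc k)
  define q where "q = (\<lambda>y. 1 / (of_nat (Suc k) * (complex_of_real y + \<i>) ^ Suc k))"
  have "((\<lambda>\<epsilon>. ((hilbert_prim x k (x - \<epsilon>) - hilbert_prim x k (x + \<epsilon>)) - (q (x - \<epsilon>) - q (x + \<epsilon>))) / (of_real x + \<i>)) \<longlongrightarrow>
    (0 - (q (x - 0) - q (x + 0))) / (of_real x + \<i>)) (at_right 0)"
    unfolding q_def by (intro tendsto_intros Suc) (auto simp del: of_nat_Suc)
  then have lim: "((\<lambda>\<epsilon>. ((hilbert_prim x k (x - \<epsilon>) - hilbert_prim x k (x + \<epsilon>)) - (q (x - \<epsilon>) - q (x + \<epsilon>))) / (of_real x + \<i>)) \<longlongrightarrow> 0) (at_right 0)"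
    by simp
  have eq: "(A - c) / a - (B - d) / a = ((A - B) - (c - d)) / a" for A B c d a :: complex
    by (simp add: diff_divide_distrib)
  show ?case unfolding hilbert_prim_Suc eq by (rule lim[unfolded q_def])
qed


text \<open>The pole of 1 / (x + i) lies in the lower half-plane, so these are boundary values of
  functions holomorphic in the upper one, a class closed under products. They vanish at infinity
  when \<open>poly Q 0 = 0\<close>.\<close>

definition rat_eval :: "complex poly \<Rightarrow> real \<Rightarrow> complex" where
  "rat_eval Q x = poly Q (1 / (of_real x + \<i>))"

lemma rat_eval_measurable[measurable]: "rat_eval Q \<in> borel_measurable borel"
  unfolding rat_eval_def by (intro borel_measurable_continuous_onI continuous_intros) simp

text \<open>Dividing off one factor z = 1 / (x + i) leaves a polynomial, bounded on the closed unit
  disc, which contains every such z; the factor itself gives the decay.\<close>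

lemma rat_eval_bound:
  assumes "poly Q 0 = 0"
  obtains C where "0 < C" "\<And>x. norm (rat_eval Q x) \<le> C / (1 + \<bar>x\<bar>)"
proof -
  obtain Q1 where Q: "Q = pCons 0 Q1" using assms by (cases Q) auto
  have "compact (poly Q1 ` cball 0 1)" by (intro compact_continuous_image continuous_intros compact_cball)
  then have "bounded (poly Q1 ` cball 0 1)" by (rule compact_imp_bounded)
  then obtain B where B: "0 < B" "\<And>z. norm z \<le> 1 \<Longrightarrow> norm (poly Q1 z) \<le> B"
    by (auto simp: bounded_pos)
  have "norm (rat_eval Q x) \<le> 2 * B / (1 + \<bar>x\<bar>)" for x
  proof -
    let ?z = "1 / (complex_of_real x + \<i>)"
    have "1 \<le> norm (complex_of_real x + \<i>)" by (simp add: norm_add_ii)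
    then have "norm ?z \<le> 1" by (simp add: norm_divide)
    then have "norm (poly Q1 ?z) \<le> B" by (rule B)
    then have "norm ?z * norm (poly Q1 ?z) \<le> 2 / (1 + \<bar>x\<bar>) * B"
      by (intro mult_mono norm_inverse_add_ii_le) auto
    then show ?thesis by (simp add: rat_eval_def Q norm_mult norm_divide mult.commute)
  qed
  with B(1) that[of "2 * B"] show thesis by auto
qed

text \<open>The fundamental theorem of calculus on the two rays beyond x - \<epsilon> and x +
  \<epsilon>. The boundary terms at the inner ends are kept exact, since only their difference has a
  limit.\<close>

lemma LBINT_hilbert_monomial:
  assumes e: "0 < \<epsilon>"
  shows "(LINT y:{y. \<epsilon> < \<bar>x - y\<bar>}|lborel. 1 / (of_real y + \<i>) ^ Suc k / complex_of_real (x - y))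
    = (hilbert_prim x k (x - \<epsilon>) - hilbert_prim x k (x + \<epsilon>)) - \<i> * pi / (of_real x + \<i>) ^ Suc k"
proof -
  let ?g = "\<lambda>y. 1 / (of_real y + \<i>) ^ Suc k / complex_of_real (x - y)"
  have "norm (1 / (complex_of_real y + \<i>) ^ Suc k) \<le> 2 / (1 + \<bar>y\<bar>)" for y
  proof -
    have "1 \<le> norm (complex_of_real y + \<i>)" by (simp add: norm_add_ii)
    then have n: "norm (complex_of_real y + \<i>) \<le> norm (complex_of_real y + \<i>) ^ Suc k" by (intro self_le_power) auto
    have "norm (1 / (complex_of_real y + \<i>) ^ Suc k) = 1 / norm (complex_of_real y + \<i>) ^ Suc k"
      by (simp add: norm_divide norm_power del: power_Suc)
    also have "\<dots> \<le> 1 / norm (complex_of_real y + \<i>)"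
      using n by (intro divide_left_mono) (auto simp del: power_Suc intro!: mult_pos_pos)
    also have "\<dots> \<le> 2 / (1 + \<bar>y\<bar>)" using norm_inverse_add_ii_le[of y] by (simp add: norm_divide)
    finally show ?thesis .
  qed
  then have int: "set_integrable lborel {y. \<epsilon> < \<bar>x - y\<bar>} ?g"
    by (intro set_integrable_hilbert_decay[where C=2] e) (auto intro!: borel_measurable_continuous_onI continuous_intros)
  have S: "{y. \<epsilon> < \<bar>x - y\<bar>} = {..<x - \<epsilon>} \<union> {x + \<epsilon><..}" using e by auto
  have i1: "set_integrable lborel {..<x - \<epsilon>} ?g" and i2: "set_integrable lborel {x + \<epsilon><..} ?g"
    by (rule set_integrable_subset[OF int]; auto simp: S)+
  have prim_cont: "isCont (hilbert_prim x k) y" if "y \<noteq> x" for y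
    using hilbert_prim_deriv[OF that, of k] by (rule has_vector_derivative_continuous)
  have g_cont: "isCont ?g y" if "y \<noteq> x" for y
    using that by (intro continuous_intros) auto
  have "(LBINT y=ereal (x + \<epsilon>)..\<infinity>. ?g y) = 0 - hilbert_prim x k (x + \<epsilon>)"
  proof (rule interval_integral_FTC_integrable[where F="hilbert_prim x k"])
    show "((hilbert_prim x k \<circ> real_of_ereal) \<longlongrightarrow> hilbert_prim x k (x + \<epsilon>)) (at_right (ereal (x + \<epsilon>)))"
      using prim_cont[of "x + \<epsilon>"] e by (auto simp: ereal_tendsto_simps isCont_def filterlim_at_split)
    show "((hilbert_prim x k \<circ> real_of_ereal) \<longlongrightarrow> 0) (at_left \<infinity>)"
      using hilbert_prim_at_top by (simp add: ereal_tendsto_simps)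
    show "(hilbert_prim x k has_vector_derivative ?g y) (at y)" if "ereal (x + \<epsilon>) < ereal y" for y
      by (rule hilbert_prim_deriv) (use e that in auto)
    show "isCont ?g y" if "ereal (x + \<epsilon>) < ereal y" for y
      by (rule g_cont) (use e that in auto)
    show "set_integrable lborel (einterval (ereal (x + \<epsilon>)) \<infinity>) ?g" using i2 by simp
  qed simp
  moreover have "(LBINT y=-\<infinity>..ereal (x - \<epsilon>). ?g y) = hilbert_prim x k (x - \<epsilon>) - \<i> * pi / (of_real x + \<i>) ^ Suc k"
  proof (rule interval_integral_FTC_integrable[where F="hilbert_prim x k"])
    show "((hilbert_prim x k \<circ> real_of_ereal) \<longlongrightarrow> hilbert_prim x k (x - \<epsilon>)) (at_left (ereal (x - \<epsilon>)))"
      using prim_cont[of "x - \<epsilon>"] e by (auto simp: ereal_tendsto_simps isCont_def filterlim_at_split)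
    show "((hilbert_prim x k \<circ> real_of_ereal) \<longlongrightarrow> \<i> * pi / (of_real x + \<i>) ^ Suc k) (at_right (-\<infinity>))"
      using hilbert_prim_at_bot by (simp add: ereal_tendsto_simps)
    show "(hilbert_prim x k has_vector_derivative ?g y) (at y)" if "ereal y < ereal (x - \<epsilon>)" for y
      by (rule hilbert_prim_deriv) (use e that in auto)
    show "isCont ?g y" if "ereal y < ereal (x - \<epsilon>)" for y
      by (rule g_cont) (use e that in auto)
    show "set_integrable lborel (einterval (-\<infinity>) (ereal (x - \<epsilon>))) ?g" using i1 by simp
  qed simp
  moreover have "(LINT y:{y. \<epsilon> < \<bar>x - y\<bar>}|lborel. ?g y) = (LINT y:{..<x - \<epsilon>}|lborel. ?g y) + (LINT y:{x + \<epsilon><..}|lborel. ?g y)"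
    unfolding S using e by (intro set_integral_Un i1 i2) auto
  ultimately show ?thesis
    by (simp add: interval_lebesgue_integral_def)
qed

lemma poly_eq_sum_Suc:
  fixes Q :: "'a::comm_ring_1 poly"
  assumes "poly Q 0 = 0"
  shows "poly Q z = (\<Sum>k<degree Q. coeff Q (Suc k) * z ^ Suc k)"
proof -
  have "poly Q z = (\<Sum>k\<le>degree Q. coeff Q k * z ^ k)" by (rule poly_altdef)
  also have "\<dots> = coeff Q 0 * z ^ 0 + (\<Sum>k<degree Q. coeff Q (Suc k) * z ^ Suc k)"
    by (rule sum.atMost_shift)
  also have "coeff Q 0 = 0" using assms by (simp add: poly_0_coeff_0)
  finally show ?thesis by simp
qed

lemma rat_eval_hilbert_tendsto:
  assumes Q: "poly Q 0 = 0"
  shows "((\<lambda>\<epsilon>. LINT y:{y. \<epsilon> < \<bar>x - y\<bar>}|lborel. rat_eval Q y / complex_of_real (x - y)) \<longlongrightarrow> - \<i> * pi * rat_eval Q x) (at_right 0)"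
proof -
  let ?m = "\<lambda>k y. 1 / (of_real y + \<i>) ^ Suc k / complex_of_real (x - y)"
  let ?J = "\<lambda>k \<epsilon>. (hilbert_prim x k (x - \<epsilon>) - hilbert_prim x k (x + \<epsilon>)) - \<i> * pi / (of_real x + \<i>) ^ Suc k"
  have ev: "\<forall>\<^sub>F \<epsilon> in at_right 0. (\<Sum>k<degree Q. coeff Q (Suc k) * ?J k \<epsilon>) =
     (LINT y:{y. \<epsilon> < \<bar>x - y\<bar>}|lborel. rat_eval Q y / complex_of_real (x - y))"
    using eventually_at_right_less
  proof eventually_elim
    case (elim \<epsilon>)
    have int: "set_integrable lborel {y. \<epsilon> < \<bar>x - y\<bar>} (\<lambda>y. rat_eval (monom 1 (Suc k)) y / complex_of_real (x - y))" for k
    proof -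
      obtain C where C: "\<And>x. norm (rat_eval (monom 1 (Suc k)) x) \<le> C / (1 + \<bar>x\<bar>)"
        using rat_eval_bound[of "monom 1 (Suc k)"] by (auto simp: poly_monom)
      show ?thesis by (rule set_integrable_hilbert_decay[OF _ C elim]) measurable
    qed
    then have int: "set_integrable lborel {y. \<epsilon> < \<bar>x - y\<bar>} (?m k)" for k
      by (simp add: rat_eval_def poly_monom power_one_over[symmetric] del: of_real_diff power_Suc)
    have "(LINT y:{y. \<epsilon> < \<bar>x - y\<bar>}|lborel. rat_eval Q y / complex_of_real (x - y))
       = (LINT y:{y. \<epsilon> < \<bar>x - y\<bar>}|lborel. (\<Sum>k<degree Q. coeff Q (Suc k) * ?m k y))"
      unfolding rat_eval_def poly_eq_sum_Suc[OF Q]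
      by (simp add: sum_divide_distrib power_one_over del: of_real_diff power_Suc)
    also have "\<dots> = (\<Sum>k<degree Q. coeff Q (Suc k) * (LINT y:{y. \<epsilon> < \<bar>x - y\<bar>}|lborel. ?m k y))"
      unfolding set_lebesgue_integral_def scaleR_sum_right
    proof (subst Bochner_Integration.integral_sum)
      have *: "indicat_real A y *\<^sub>R (c * v) = c * (indicat_real A y *\<^sub>R v)" for A y and c v :: complex by simp
      show "integrable lborel (\<lambda>y. indicat_real {y. \<epsilon> < \<bar>x - y\<bar>} y *\<^sub>R (coeff Q (Suc k) * ?m k y))" for k
        unfolding * using int[of k] unfolding set_integrable_def by (rule integrable_mult_right)
      show "(\<Sum>k<degree Q. LINT y|lborel. indicat_real {y. \<epsilon> < \<bar>x - y\<bar>} y *\<^sub>R (coeff Q (Suc k) * ?m k y)) =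
         (\<Sum>k<degree Q. coeff Q (Suc k) * (LINT y|lborel. indicat_real {y. \<epsilon> < \<bar>x - y\<bar>} y *\<^sub>R ?m k y))"
        unfolding * by (intro sum.cong refl integral_mult_right_zero)
    qed
    finally show ?case unfolding LBINT_hilbert_monomial[OF elim] by simp
  qed
  have "((\<lambda>\<epsilon>. \<Sum>k<degree Q. coeff Q (Suc k) * ?J k \<epsilon>) \<longlongrightarrow> (\<Sum>k<degree Q. coeff Q (Suc k) * (0 - \<i> * pi / (of_real x + \<i>) ^ Suc k))) (at_right 0)"
    by (intro tendsto_intros hilbert_prim_jump)
  moreover have "(\<Sum>k<degree Q. coeff Q (Suc k) * (0 - \<i> * pi / (of_real x + \<i>) ^ Suc k)) = - \<i> * pi * rat_eval Q x"
    unfolding rat_eval_def poly_eq_sum_Suc[OF Q] sum_distrib_left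
    by (intro sum.cong refl) (simp add: power_one_over del: power_Suc)
  ultimately have "((\<lambda>\<epsilon>. \<Sum>k<degree Q. coeff Q (Suc k) * ?J k \<epsilon>) \<longlongrightarrow> - \<i> * pi * rat_eval Q x) (at_right 0)"
    by (simp only:)
  from Lim_transform_eventually[OF this ev] show ?thesis .
qed

text \<open>H F = -i F splits into real and imaginary parts because the kernel is real. The second
  pair is the one that gets applied to F^2.\<close>

lemma hilbert_rat_eval:
  assumes Q: "poly Q 0 = 0"
  shows "hilbert_defined (\<lambda>y. Re (rat_eval Q y)) x" "hilbert (\<lambda>y. Re (rat_eval Q y)) x = Im (rat_eval Q x)"
    and "hilbert_defined (\<lambda>y. Im (rat_eval Q y)) x" "hilbert (\<lambda>y. Im (rat_eval Q y)) x = - Re (rat_eval Q x)"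
proof -
  obtain C where C: "\<And>x. norm (rat_eval Q x) \<le> C / (1 + \<bar>x\<bar>)"
    using rat_eval_bound[OF Q] by blast
  let ?S = "\<lambda>\<epsilon>. {y. \<epsilon> < \<bar>x - y\<bar>}"
  have int: "integrable lborel (\<lambda>y. indicator (?S \<epsilon>) y *\<^sub>R (rat_eval Q y / complex_of_real (x - y)))" if "0 < \<epsilon>" for \<epsilon>
    using set_integrable_hilbert_decay[OF _ C that] unfolding set_integrable_def by auto
  have eq: "Re (indicator A y *\<^sub>R (v / complex_of_real r)) = indicator A y *\<^sub>R (Re v / r)"
    "Im (indicator A y *\<^sub>R (v / complex_of_real r)) = indicator A y *\<^sub>R (Im v / r)" for A :: "real set" and y r v
    by auto
  have R: "set_integrable lebesgue (?S \<epsilon>) (\<lambda>y. Re (rat_eval Q y) / (x - y)) \<and>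
     hilbert_trunc (\<lambda>y. Re (rat_eval Q y)) x \<epsilon> = Re (LINT y:?S \<epsilon>|lborel. rat_eval Q y / complex_of_real (x - y))"
    if e: "0 < \<epsilon>" for \<epsilon>
  proof -
    have i: "integrable lborel (\<lambda>y. indicator (?S \<epsilon>) y *\<^sub>R (Re (rat_eval Q y) / (x - y)))"
      using integrable_Re[OF int[OF e]] unfolding eq .
    then have m: "(\<lambda>y. indicator (?S \<epsilon>) y *\<^sub>R (Re (rat_eval Q y) / (x - y))) \<in> borel_measurable lborel" by auto
    show ?thesis
      using i integral_Re[OF int[OF e]] unfolding set_integrable_def hilbert_trunc_def set_lebesgue_integral_def eq
        integrable_completion[OF m] integral_completion[OF m] by simp
  qed
  have I: "set_integrable lebesgue (?S \<epsilon>) (\<lambda>y. Im (rat_eval Q y) / (x - y)) \<and>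
     hilbert_trunc (\<lambda>y. Im (rat_eval Q y)) x \<epsilon> = Im (LINT y:?S \<epsilon>|lborel. rat_eval Q y / complex_of_real (x - y))"
    if e: "0 < \<epsilon>" for \<epsilon>
  proof -
    have i: "integrable lborel (\<lambda>y. indicator (?S \<epsilon>) y *\<^sub>R (Im (rat_eval Q y) / (x - y)))"
      using integrable_Im[OF int[OF e]] unfolding eq .
    then have m: "(\<lambda>y. indicator (?S \<epsilon>) y *\<^sub>R (Im (rat_eval Q y) / (x - y))) \<in> borel_measurable lborel" by auto
    show ?thesis
      using i integral_Im[OF int[OF e]] unfolding set_integrable_def hilbert_trunc_def set_lebesgue_integral_def eq
        integrable_completion[OF m] integral_completion[OF m] by simp
  qed
  have pos: "\<forall>\<^sub>F \<epsilon> in at_right (0::real). 0 < \<epsilon>" by (rule eventually_at_right_less)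
  have tR: "(hilbert_trunc (\<lambda>y. Re (rat_eval Q y)) x \<longlongrightarrow> Re (- \<i> * pi * rat_eval Q x)) (at_right 0)"
    using tendsto_Re[OF rat_eval_hilbert_tendsto[OF Q, of x]]
    by (rule Lim_transform_eventually) (use pos in eventually_elim, use R in auto)
  have tI: "(hilbert_trunc (\<lambda>y. Im (rat_eval Q y)) x \<longlongrightarrow> Im (- \<i> * pi * rat_eval Q x)) (at_right 0)"
    using tendsto_Im[OF rat_eval_hilbert_tendsto[OF Q, of x]]
    by (rule Lim_transform_eventually) (use pos in eventually_elim, use I in auto)
  have eR: "\<forall>\<^sub>F \<epsilon> in at_right 0. set_integrable lebesgue (?S \<epsilon>) (\<lambda>y. Re (rat_eval Q y) / (x - y))"
    using pos by eventually_elim (use R in auto)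
  have eI: "\<forall>\<^sub>F \<epsilon> in at_right 0. set_integrable lebesgue (?S \<epsilon>) (\<lambda>y. Im (rat_eval Q y) / (x - y))"
    using pos by eventually_elim (use I in auto)
  show "hilbert_defined (\<lambda>y. Re (rat_eval Q y)) x" "hilbert (\<lambda>y. Re (rat_eval Q y)) x = Im (rat_eval Q x)"
    using hilbertI[OF eR tR] by auto
  show "hilbert_defined (\<lambda>y. Im (rat_eval Q y)) x" "hilbert (\<lambda>y. Im (rat_eval Q y)) x = - Re (rat_eval Q x)"
    using hilbertI[OF eI tI] by auto
qed

lemma hilbert_cotlar:
  assumes Q: "poly Q 0 = 0"
  shows "hilbert_defined (\<lambda>y. 2 * Re (rat_eval Q y) * Im (rat_eval Q y)) x"
    "hilbert (\<lambda>y. 2 * Re (rat_eval Q y) * Im (rat_eval Q y)) x = (Im (rat_eval Q x))\<^sup>2 - (Re (rat_eval Q x))\<^sup>2"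
proof -
  have Q2: "poly (Q * Q) 0 = 0" using Q by simp
  have eq: "rat_eval (Q * Q) y = (rat_eval Q y)\<^sup>2" for y by (simp add: rat_eval_def power2_eq_square)
  show "hilbert_defined (\<lambda>y. 2 * Re (rat_eval Q y) * Im (rat_eval Q y)) x"
    "hilbert (\<lambda>y. 2 * Re (rat_eval Q y) * Im (rat_eval Q y)) x = (Im (rat_eval Q x))\<^sup>2 - (Re (rat_eval Q x))\<^sup>2"
    using hilbert_rat_eval(3,4)[OF Q2, of x] unfolding eq by (simp_all add: power2_eq_square mult_ac)
qed

section \<open>Approximation by rational functions\<close>

text \<open>The real trigonometric polynomials on the unit circle: there cnj v = 1 / v, and taking
  real parts turns negative powers into positive ones, so polynomials in v alone suffice. Values off
  the circle are left free.\<close>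

definition circle_re_polys :: "(complex \<Rightarrow> real) set" where
  "circle_re_polys = {r. \<exists>P. \<forall>v. norm v = 1 \<longrightarrow> r v = Re (poly P v)}"

lemma circle_re_polysI: "(\<And>v. norm v = 1 \<Longrightarrow> r v = Re (poly P v)) \<Longrightarrow> r \<in> circle_re_polys"
  unfolding circle_re_polys_def by blast

lemma circle_re_polys_add:
  assumes "r \<in> circle_re_polys" "s \<in> circle_re_polys"
  shows "(\<lambda>v. a * r v + b * s v) \<in> circle_re_polys"
proof -
  obtain P Q where P: "\<And>v. norm v = 1 \<Longrightarrow> r v = Re (poly P v)" and Q: "\<And>v. norm v = 1 \<Longrightarrow> s v = Re (poly Q v)"
    using assms by (auto simp: circle_re_polys_def)
  show ?thesis
    by (rule circle_re_polysI[where P="smult (of_real a) P + smult (of_real b) Q"]) (simp add: P Q)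
qed

text \<open>On the circle Re v = (v + cnj v) / 2 and Im v = (v - cnj v) / (2 i). Writing P = a + v
  P' gives cnj v * P = a * cnj v + P', and a * cnj v has the same real part as cnj a * v. This is
  the first witness; the second is the same computation with the factor 1 / i = -i.\<close>

lemma circle_re_polys_mult_Re_Im:
  assumes "r \<in> circle_re_polys"
  shows "(\<lambda>v. Re v * r v) \<in> circle_re_polys" "(\<lambda>v. Im v * r v) \<in> circle_re_polys"
proof -
  obtain P where P: "\<And>v. norm v = 1 \<Longrightarrow> r v = Re (poly P v)"
    using assms by (auto simp: circle_re_polys_def)
  obtain a P' where P': "P = pCons a P'" by (cases P)
  have n: "Re v * (Re v * t) + Im v * (Im v * t) = t" if "norm v = 1" for v t
  proof -
    have "(Re v)\<^sup>2 + (Im v)\<^sup>2 = 1" using that by (simp add: norm_complex_def)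
    then have "((Re v)\<^sup>2 + (Im v)\<^sup>2) * t = t" by simp
    then show ?thesis by (simp add: power2_eq_square algebra_simps)
  qed
  show "(\<lambda>v. Re v * r v) \<in> circle_re_polys"
  proof (rule circle_re_polysI[where P="smult (1/2) (pCons 0 P + pCons 0 [:cnj a:] + P')"])
    fix v :: complex assume v: "norm v = 1"
    show "Re v * r v = Re (poly (smult (1 / 2) (pCons 0 P + pCons 0 [:cnj a:] + P')) v)"
      using n[OF v, of "Re (poly P' v)"] by (simp add: P[OF v] P' field_simps)
  qed
  show "(\<lambda>v. Im v * r v) \<in> circle_re_polys"
  proof (rule circle_re_polysI[where P="smult (1/2) (smult (- \<i>) (pCons 0 P) + pCons 0 [:- \<i> * cnj a:] + smult \<i> P')"])
    fix v :: complex assume v: "norm v = 1"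
    show "Im v * r v = Re (poly (smult (1/2) (smult (- \<i>) (pCons 0 P) + pCons 0 [:- \<i> * cnj a:] + smult \<i> P')) v)"
      using n[OF v, of "Im (poly P' v)"] by (simp add: P[OF v] P' field_simps)
  qed
qed

text \<open>Keeping the factor \<open>r\<close> arbitrary makes the product case immediate, since f
  * g acts on \<open>r\<close> as g followed by f; only multiplication by the two coordinate
  functions needs work.\<close>

lemma real_polynomial_function_mult_circle_re_polys:
  assumes "real_polynomial_function g" "r \<in> circle_re_polys"
  shows "(\<lambda>v. g v * r v) \<in> circle_re_polys"
  using assms
proof (induction arbitrary: r rule: real_polynomial_function.induct)
  case (linear f)
  have f: "f v = f 1 * Re v + f \<i> * Im v" for v
  proof -
    interpret bounded_linear f by (rule linear)
    have "f v = f (Re v *\<^sub>R 1 + Im v *\<^sub>R \<i>)" by (rule arg_cong[where f=f]) (simp add: complex_eq_iff)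
    also have "\<dots> = f 1 * Re v + f \<i> * Im v" by (simp add: add scaleR)
    finally show ?thesis .
  qed
  have "(\<lambda>v. f v * r v) = (\<lambda>v. f 1 * (Re v * r v) + f \<i> * (Im v * r v))"
    by (subst f) (simp add: algebra_simps)
  then show ?case using circle_re_polys_add circle_re_polys_mult_Re_Im linear by auto
next
  case (const c)
  then show ?case using circle_re_polys_add[of r r c 0] by simp
next
  case (add f g)
  then show ?case using circle_re_polys_add[OF add.IH(1)[OF add.prems] add.IH(2)[OF add.prems], of 1 1]
    by (simp add: algebra_simps)
next
  case (mult f g)
  then show ?case using mult.IH(1)[OF mult.IH(2)[OF mult.prems]] by (simp add: algebra_simps)
qed

text \<open>The Cayley map v = (x - i) / (x + i) = 1 - 2 i / (x + i) carries the line to the circle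
  and infinity to 1, and it turns polynomials in v into polynomials in 1 / (x + i). Approximating (1
  + x^2) c(x) uniformly and multiplying back by 1 / (1 + x^2) = (1 - Re v) / 2 gives an error with
  quadratic decay, which is controlled in \<Lambda>^p and not just uniformly.\<close>

lemma rational_approximation:
  fixes c :: "real \<Rightarrow> real"
  assumes c: "continuous_on UNIV c" and L: "0 < L" "\<And>x. L \<le> \<bar>x\<bar> \<Longrightarrow> c x = 0" and \<delta>: "0 < \<delta>"
  obtains Q where "poly Q 0 = 0" "\<And>x. \<bar>c x - Re (rat_eval Q x)\<bar> \<le> \<delta> / (1 + x\<^sup>2)"
proof -
  \<comment> \<open>With 1 + x^2 = 2 / (1 - Re v) and x = - Im v / (1 - Re v) this is (1 + x^2) c(x)
    transported to the circle; at v = 1 the convention 2 / 0 = 0 supplies the value 0.\<close>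
  define h where "h = (\<lambda>v. 2 / (1 - Re v) * c (- Im v / (1 - Re v)))"
  \<comment> \<open>For v other than 1 on the circle, 1 - Re v <= d means |x| >= L. So
    \<open>h\<close> vanishes on an arc around v = 1, which settles continuity at the point at
    infinity.\<close>
  define d where "d = 2 / (1 + L\<^sup>2)"
  have d: "0 < d" using L by (auto simp: d_def intro!: divide_pos_pos add_pos_nonneg)
  have sph: "(Re v)\<^sup>2 + (Im v)\<^sup>2 = 1" if "v \<in> sphere 0 1" for v :: complex
    using that by (simp add: norm_complex_def)
  let ?A = "{v \<in> sphere 0 1. 1 - Re v \<le> d}" and ?B = "{v \<in> sphere 0 1. d \<le> 1 - Re v}"
  have sp: "sphere (0::complex) 1 = ?A \<union> ?B" by auto
  have "continuous_on (?A \<union> ?B) h"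
  proof (rule continuous_on_closed_Un)
    have "?A = sphere 0 1 \<inter> {v. 1 - Re v \<le> d}" "?B = sphere 0 1 \<inter> {v. d \<le> 1 - Re v}" by auto
    then show "closed ?A" "closed ?B"
      by (auto intro!: closed_Int closed_Collect_le continuous_intros)
    have h0: "h v = 0" if v: "v \<in> ?A" for v
    proof (cases "Re v = 1")
      case False
      have s: "(Re v)\<^sup>2 + (Im v)\<^sup>2 = 1" using v by (intro sph) auto
      then have "(Re v)\<^sup>2 \<le> 1" using zero_le_power2[of "Im v"] by linarith
      then have "\<bar>Re v\<bar> \<le> 1" by (simp add: abs_square_le_1)
      with False have r: "0 < 1 - Re v" by auto
      have "1 + (- Im v / (1 - Re v))\<^sup>2 = ((1 - Re v)\<^sup>2 + (Im v)\<^sup>2) / (1 - Re v)\<^sup>2"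
        using r by (simp add: field_simps)
      also have "(1 - Re v)\<^sup>2 + (Im v)\<^sup>2 = 2 * (1 - Re v)" using s by (simp add: power2_eq_square algebra_simps)
      also have "2 * (1 - Re v) / (1 - Re v)\<^sup>2 = 2 / (1 - Re v)"
      proof -
        have "2 * q / q\<^sup>2 = 2 / q" if "0 < q" for q :: real using that by (simp add: power2_eq_square)
        from this[OF r] show ?thesis .
      qed
      finally have "1 + (- Im v / (1 - Re v))\<^sup>2 = 2 / (1 - Re v)" .
      moreover have "1 + L\<^sup>2 \<le> 2 / (1 - Re v)"
      proof -
        have "1 - Re v \<le> 2 / (1 + L\<^sup>2)" using v by (simp add: d_def)
        moreover have "0 < 1 + L\<^sup>2" by (simp add: add_pos_nonneg)
        ultimately show ?thesis using r by (simp add: field_simps)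
      qed
      ultimately have "L\<^sup>2 \<le> (- Im v / (1 - Re v))\<^sup>2" by linarith
      then have "L \<le> \<bar>- Im v / (1 - Re v)\<bar>" using L(1) by (metis abs_le_square_iff abs_of_pos)
      then show ?thesis unfolding h_def using L(2) by simp
    qed (simp add: h_def)
    have "continuous_on ?A h \<longleftrightarrow> continuous_on ?A (\<lambda>_. 0 :: real)" by (rule continuous_on_cong[OF refl h0])
    then show "continuous_on ?A h" by simp
    show "continuous_on ?B h" unfolding h_def
      using d by (intro continuous_intros continuous_on_compose2[OF c]) auto
  qed
  then have "continuous_on (sphere 0 1) h" by (subst sp)
  with \<delta> obtain g where g: "real_polynomial_function g" "\<And>v. v \<in> sphere 0 1 \<Longrightarrow> \<bar>h v - g v\<bar> < \<delta>"
    using Stone_Weierstrass_real_polynomial_function[OF compact_sphere] by metis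
  have "(\<lambda>v. (1 - Re v) / 2) \<in> circle_re_polys"
    by (rule circle_re_polysI[where P="[:1/2, -1/2:]"]) simp
  from real_polynomial_function_mult_circle_re_polys[OF g(1) this]
  obtain P where P: "\<And>v. norm v = 1 \<Longrightarrow> g v * ((1 - Re v) / 2) = Re (poly P v)"
    by (auto simp: circle_re_polys_def)
  \<comment> \<open>Subtracting the constant removes the value at z = 0, that is at v = 1. The real
    part is unaffected, because the factor (1 - Re v) / 2 forces Re (poly P 1) = 0.\<close>
  define Q where "Q = pcompose P [:1, - 2 * \<i>:] - [:poly P 1:]"
  show thesis
  proof (rule that[of Q])
    show "poly Q 0 = 0" by (simp add: Q_def poly_pcompose)
    fix x :: real
    define v where "v = 1 - 2 * \<i> * (1 / (of_real x + \<i>))"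
    have pos: "0 < 1 + x\<^sup>2" by (simp add: add_pos_nonneg)
    have z: "1 / (of_real x + \<i>) = Complex (x / (1 + x\<^sup>2)) (- 1 / (1 + x\<^sup>2))"
    proof -
      have "Complex (x / (1 + x\<^sup>2)) (- 1 / (1 + x\<^sup>2)) * (of_real x + \<i>) = 1"
        using pos by (simp add: complex_eq_iff field_simps power2_eq_square)
      then show ?thesis by (simp only: nonzero_divide_eq_eq[OF add_ii_nz])
    qed
    have v: "Re v = 1 - 2 / (1 + x\<^sup>2)" "Im v = - (2 * x / (1 + x\<^sup>2))"
      unfolding v_def z by simp_all
    have "(Re v)\<^sup>2 + (Im v)\<^sup>2 = 1"
    proof -
      have "(1 - 2 / s)\<^sup>2 + 4 * (s - 1) / s\<^sup>2 = 1" if "0 < s" for s :: real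
        using that by (simp add: field_simps power2_eq_square)
      from this[OF pos] have "(1 - 2 / (1 + x\<^sup>2))\<^sup>2 + (2 * x / (1 + x\<^sup>2))\<^sup>2 = 1"
        by (simp add: power_divide power_mult_distrib)
      then show ?thesis by (simp add: v)
    qed
    then have nv: "norm v = 1" by (simp add: norm_complex_def)
    have R0: "Re (poly P 1) = 0" using P[of 1] by simp
    have "Re (rat_eval Q x) = Re (poly P v)"
      by (simp add: rat_eval_def Q_def poly_pcompose v_def R0)
    also have "\<dots> = g v / (1 + x\<^sup>2)"
    proof -
      have "(1 - Re v) / 2 = 1 / (1 + x\<^sup>2)" unfolding v using pos by (simp add: field_simps)
      then show ?thesis unfolding P[OF nv, symmetric] by (simp only: times_divide_eq_right mult_1_right)
    qed
    finally have R: "Re (rat_eval Q x) = g v / (1 + x\<^sup>2)" .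
    have "h v = (1 + x\<^sup>2) * c x" unfolding h_def v using pos by simp
    then have "c x = h v / (1 + x\<^sup>2)" using pos by simp
    with R have "\<bar>c x - Re (rat_eval Q x)\<bar> = \<bar>h v - g v\<bar> / (1 + x\<^sup>2)"
      using pos by (simp add: diff_divide_distrib[symmetric])
    also have "\<dots> \<le> \<delta> / (1 + x\<^sup>2)"
      using g(2)[of v] nv pos by (intro divide_right_mono) auto
    finally show "\<bar>c x - Re (rat_eval Q x)\<bar> \<le> \<delta> / (1 + x\<^sup>2)" .
  qed
qed

text \<open>Measurable functions are almost everywhere limits of continuous ones; clipping to
  [-1, 1] and multiplying by a tent that is 1 on |x| <= |M| keeps bound and support under control.
  The decay constant \<open>C\<close> does not depend on \<open>n\<close>, as the later dominated
  convergence requires.\<close>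

lemma rational_approximation_AE:
  fixes f :: "real \<Rightarrow> real"
  assumes f: "f \<in> borel_measurable lebesgue" and b: "\<And>x. \<bar>f x\<bar> \<le> 1" and M: "\<And>x. M < \<bar>x\<bar> \<Longrightarrow> f x = 0"
  obtains Q :: "nat \<Rightarrow> complex poly" and C where "\<And>n. poly (Q n) 0 = 0"
    "\<And>n x. \<bar>Re (rat_eval (Q n) x)\<bar> \<le> 1" "\<And>n x. \<bar>Re (rat_eval (Q n) x)\<bar> \<le> C / (1 + x\<^sup>2)"
    "AE x in lebesgue. (\<lambda>n. Re (rat_eval (Q n) x)) \<longlonglongrightarrow> f x"
proof -
  have "f measurable_on UNIV" using f by (simp add: lebesgue_measurable_imp_measurable_on)
  then obtain Z and g :: "nat \<Rightarrow> real \<Rightarrow> real" where Z: "negligible Z" and g: "\<And>n. continuous_on UNIV (g n)"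
    and lim: "\<And>x. x \<notin> Z \<Longrightarrow> (\<lambda>n. g n x) \<longlonglongrightarrow> f x"
    unfolding measurable_on_def by auto
  define L where "L = \<bar>M\<bar> + 1"
  have L: "0 < L" by (simp add: L_def)
  define t where "t = (\<lambda>x. max 0 (min 1 (L - \<bar>x\<bar>)))"
  define c where "c = (\<lambda>n x. t x * max (-1) (min 1 (g n x)))"
  define \<delta> where "\<delta> = (\<lambda>n. 1 / real (Suc n))"
  have \<delta>: "0 < \<delta> n" "\<delta> n \<le> 1" for n by (auto simp: \<delta>_def)
  have cc: "continuous_on UNIV (c n)" for n
    unfolding c_def t_def by (intro continuous_intros g)
  have c0: "c n x = 0" if "L \<le> \<bar>x\<bar>" for n x using that by (simp add: c_def t_def)
  have c1: "\<bar>c n x\<bar> \<le> 1" for n x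
  proof -
    have "\<bar>c n x\<bar> = \<bar>t x\<bar> * \<bar>max (-1) (min 1 (g n x))\<bar>" by (simp add: c_def abs_mult)
    also have "\<dots> \<le> 1 * 1" by (intro mult_mono) (auto simp: t_def)
    finally show ?thesis by simp
  qed
  have "\<exists>Q. poly Q 0 = 0 \<and> (\<forall>x. \<bar>c n x - Re (rat_eval Q x)\<bar> \<le> \<delta> n / (1 + x\<^sup>2))" for n
    using rational_approximation[OF cc L c0 \<delta>(1)] by metis
  then obtain Q' where Q': "\<And>n. poly (Q' n) 0 = 0" "\<And>n x. \<bar>c n x - Re (rat_eval (Q' n) x)\<bar> \<le> \<delta> n / (1 + x\<^sup>2)"
    by metis
  \<comment> \<open>The approximation error may push the real part up to 1 + \<delta> n; this factor
    restores the bound 1 and tends to 1.\<close>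
  define Q where "Q = (\<lambda>n. smult (of_real (1 / (1 + \<delta> n))) (Q' n))"
  have RQ: "Re (rat_eval (Q n) x) = 1 / (1 + \<delta> n) * Re (rat_eval (Q' n) x)" for n x
    by (simp only: rat_eval_def Q_def poly_smult times_complex.sel Re_complex_of_real Im_complex_of_real mult_zero_left diff_zero)
  have s: "\<delta> n / (1 + x\<^sup>2) \<le> \<delta> n" for n x
    using \<delta>(1)[of n] by (simp add: divide_le_eq add_pos_nonneg)
  show thesis
  proof (rule that[of Q "1 + (1 + L\<^sup>2)"])
    show "poly (Q n) 0 = 0" for n using Q' by (simp add: Q_def)
    show "\<bar>Re (rat_eval (Q n) x)\<bar> \<le> 1" for n x
    proof -
      have "\<bar>Re (rat_eval (Q' n) x)\<bar> \<le> 1 + \<delta> n" using Q'(2)[of n x] c1[of n x] s[of n x] by linarith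
      then show ?thesis using \<delta>(1)[of n] by (simp add: RQ abs_mult)
    qed
    show "\<bar>Re (rat_eval (Q n) x)\<bar> \<le> (1 + (1 + L\<^sup>2)) / (1 + x\<^sup>2)" for n x
    proof -
      have pos: "0 < 1 + x\<^sup>2" by (simp add: add_pos_nonneg)
      have "\<bar>Re (rat_eval (Q n) x)\<bar> \<le> \<bar>Re (rat_eval (Q' n) x)\<bar>"
        using \<delta>(1)[of n] mult_left_mono[of 1 "1 + \<delta> n" "\<bar>Re (rat_eval (Q' n) x)\<bar>"]
        by (simp add: RQ abs_mult divide_le_eq)
      also have "\<dots> \<le> \<delta> n / (1 + x\<^sup>2) + \<bar>c n x\<bar>" using Q'(2)[of n x] by linarith
      also have "\<dots> \<le> 1 / (1 + x\<^sup>2) + (1 + L\<^sup>2) / (1 + x\<^sup>2)"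
      proof (rule add_mono)
        show "\<delta> n / (1 + x\<^sup>2) \<le> 1 / (1 + x\<^sup>2)" using \<delta>(2) pos by (intro divide_right_mono) auto
        show "\<bar>c n x\<bar> \<le> (1 + L\<^sup>2) / (1 + x\<^sup>2)"
        proof (cases "L \<le> \<bar>x\<bar>")
          case True
          then show ?thesis using c0 pos by simp
        next
          case False
          then have "x\<^sup>2 \<le> L\<^sup>2" using L by (metis abs_le_square_iff abs_of_pos less_eq_real_def not_le)
          then have "1 \<le> (1 + L\<^sup>2) / (1 + x\<^sup>2)" using pos by (simp add: le_divide_eq)
          with c1[of n x] show ?thesis by linarith
        qed
      qed
      finally show ?thesis by (simp add: add_divide_distrib)
    qed
    have "AE x in lebesgue. x \<notin> Z" using Z by (simp add: AE_not_in negligible_iff_null_sets)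
    then show "AE x in lebesgue. (\<lambda>n. Re (rat_eval (Q n) x)) \<longlonglongrightarrow> f x"
    proof eventually_elim
      case (elim x)
      have d0: "\<delta> \<longlonglongrightarrow> 0" unfolding \<delta>_def by (rule LIMSEQ_Suc[OF lim_1_over_n])
      have "(\<lambda>n. c n x) \<longlonglongrightarrow> t x * max (-1) (min 1 (f x))"
        unfolding c_def by (intro tendsto_intros lim[OF elim])
      also have "t x * max (-1) (min 1 (f x)) = f x"
        using b[of x] M[of x] by (cases "M < \<bar>x\<bar>") (auto simp: t_def L_def max_def min_def abs_le_iff)
      finally have 1: "(\<lambda>n. c n x) \<longlonglongrightarrow> f x" .
      have 2: "(\<lambda>n. c n x - Re (rat_eval (Q' n) x)) \<longlonglongrightarrow> 0"
        by (rule Lim_null_comparison[OF always_eventually d0]) (use order_trans[OF Q'(2) s] in auto)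
      have "(\<lambda>n. 1 / (1 + \<delta> n) * (c n x - (c n x - Re (rat_eval (Q' n) x)))) \<longlonglongrightarrow> 1 / (1 + 0) * (f x - 0)"
        by (intro tendsto_intros 1 2 d0) auto
      then show ?case by (simp add: RQ)
    qed
  qed
qed

section \<open>Weak and strong type inequalities\<close>

context lorentz_weights
begin

text \<open>Phrased with p-th powers and level sets instead of quasi-norms, so that only
  \<open>V\<close> and \<open>N\<close> occur. Existence of H f is part of the notion: the
  inequality alone would also make sense for unspecified values of \<open>hilbert\<close>.\<close>

definition weak_type :: "real \<Rightarrow> bool" where
  "weak_type p \<longleftrightarrow> (\<forall>f. f \<in> borel_measurable lebesgue \<longrightarrow> N p f < \<infinity> \<longrightarrow> (AE x in lebesgue. hilbert_defined f x)) \<and>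
    (\<exists>C>0. \<forall>f. f \<in> borel_measurable lebesgue \<longrightarrow> N p f < \<infinity> \<longrightarrow>
      (\<forall>y>0. ennreal (y powr p) * V {x. y < \<bar>hilbert f x\<bar>} \<le> ennreal C * N p f))"

definition strong_type :: "real \<Rightarrow> bool" where
  "strong_type p \<longleftrightarrow> (\<forall>f. f \<in> borel_measurable lebesgue \<longrightarrow> N p f < \<infinity> \<longrightarrow> (AE x in lebesgue. hilbert_defined f x)) \<and>
    (\<exists>C>0. \<forall>f. f \<in> borel_measurable lebesgue \<longrightarrow> N p f < \<infinity> \<longrightarrow> N p (hilbert f) \<le> ennreal C * N p f)"

lemma strong_imp_weak_type:
  assumes "strong_type p" "0 < p"
  shows "weak_type p"
proof -
  obtain C where C: "0 < C" "\<And>f. f \<in> borel_measurable lebesgue \<Longrightarrow> N p f < \<infinity> \<Longrightarrow> N p (hilbert f) \<le> ennreal C * N p f"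
    and d: "\<And>f. f \<in> borel_measurable lebesgue \<Longrightarrow> N p f < \<infinity> \<Longrightarrow> AE x in lebesgue. hilbert_defined f x"
    using assms(1) unfolding strong_type_def by blast
  have "ennreal (y powr p) * V {x. y < \<bar>hilbert f x\<bar>} \<le> ennreal C * N p f"
    if "f \<in> borel_measurable lebesgue" "N p f < \<infinity>" "0 < y" for f y
    by (rule order_trans[OF lint_chebyshev[OF hilbert_measurable[OF that(1) d[OF that(1,2)]] assms(2) less_imp_le[OF that(3)]] C(2)[OF that(1,2)]])
  with C(1) d show ?thesis unfolding weak_type_def by blast
qed

lemma hilbert_bounded_strongI:
  assumes "strong_type p" "0 < p"
  shows "hilbert_bounded (lorentz_space u w p) (lorentz_norm u w p) (lorentz_norm u w p)"
proof -
  obtain C where C: "0 < C" "\<And>f. f \<in> borel_measurable lebesgue \<Longrightarrow> N p f < \<infinity> \<Longrightarrow> N p (hilbert f) \<le> ennreal C * N p f"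
    and d: "\<And>f. f \<in> borel_measurable lebesgue \<Longrightarrow> N p f < \<infinity> \<Longrightarrow> AE x in lebesgue. hilbert_defined f x"
    using assms(1) unfolding strong_type_def by blast
  have S: "f \<in> lorentz_space u w p \<longleftrightarrow> f \<in> borel_measurable lebesgue \<and> N p f < \<infinity>" for f
    unfolding lorentz_space_def lorentz_norm_eq enn_powr_finite_iff by simp
  have "lorentz_norm u w p (hilbert f) \<le> ennreal (C powr (1/p)) * lorentz_norm u w p f" if "f \<in> lorentz_space u w p" for f
  proof -
    have "enn_powr (N p (hilbert f)) (1/p) \<le> enn_powr (ennreal C * N p f) (1/p)"
      using that C(2)[of f] assms by (intro enn_powr_mono) (auto simp: S)
    then show ?thesis unfolding lorentz_norm_eq enn_powr_mult_ennreal[OF C(1)] .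
  qed
  moreover have "AE x in lebesgue. hilbert_defined f x" if "f \<in> lorentz_space u w p" for f
    using that by (intro d) (auto simp: S)
  ultimately show ?thesis unfolding hilbert_bounded_def by blast
qed

text \<open>For t below the mass of {|H f| > y} the rearrangement of H f at t exceeds y, so the weak
  norm bounds y W(t)^(1/p). Letting t increase to that mass gives the inequality with
  \<open>V\<close>.\<close>

lemma weak_type_hilbert_boundedD:
  assumes hb: "hilbert_bounded (lorentz_space u w p) (lorentz_norm u w p) (weak_lorentz_norm u w p)" and p: "0 < p"
  shows "weak_type p"
proof -
  have S: "f \<in> lorentz_space u w p \<longleftrightarrow> f \<in> borel_measurable lebesgue \<and> N p f < \<infinity>" for f
    unfolding lorentz_space_def lorentz_norm_eq enn_powr_finite_iff by simp
  obtain C where C: "\<And>f. f \<in> lorentz_space u w p \<Longrightarrow> weak_lorentz_norm u w p (hilbert f) \<le> ennreal C * lorentz_norm u w p f"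
    and d: "\<And>f. f \<in> lorentz_space u w p \<Longrightarrow> AE x in lebesgue. hilbert_defined f x"
    using hb unfolding hilbert_bounded_def by blast
  \<comment> \<open>\<open>ennreal C\<close> is 0 for negative \<open>C\<close>; a constant that is
    at least 1 is positive and can be raised to powers.\<close>
  define D where "D = max C 1"
  have D: "0 < D" by (simp add: D_def)
  have "ennreal (y powr p) * V {x. y < \<bar>hilbert f x\<bar>} \<le> ennreal (D powr p) * N p f"
    if f: "f \<in> borel_measurable lebesgue" "N p f < \<infinity>" and y: "0 < y" for f y
  proof -
    let ?E = "{x. y < \<bar>hilbert f x\<bar>}"
    have fS: "f \<in> lorentz_space u w p" using f by (simp add: S)
    have Hm: "hilbert f \<in> borel_measurable lebesgue" by (rule hilbert_measurable[OF f(1) d[OF fS]])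
    have *: "ennreal (y powr p) * emeasure wm {s. s < t} \<le> ennreal (D powr p) * N p f"
      if t: "0 < t" "ennreal t < emeasure um ?E" for t
    proof -
      have "ennreal y * enn_powr (Wfun w t) (1/p) \<le> rearr u (hilbert f) t * enn_powr (Wfun w t) (1/p)"
        using t(2) less_rearr_iff[OF Hm, of y t] y by (intro mult_right_mono) auto
      also have "\<dots> \<le> weak_lorentz_norm u w p (hilbert f)"
        unfolding weak_lorentz_norm_def using t(1) by (intro SUP_upper) auto
      also have "\<dots> \<le> ennreal C * lorentz_norm u w p f" by (rule C[OF fS])
      also have "\<dots> \<le> ennreal D * enn_powr (N p f) (1/p)"
        unfolding lorentz_norm_eq by (intro mult_right_mono ennreal_leI) (auto simp: D_def)
      finally have "enn_powr (ennreal y * enn_powr (Wfun w t) (1/p)) p \<le> enn_powr (ennreal D * enn_powr (N p f) (1/p)) p"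
        using p by (intro enn_powr_mono)
      then show ?thesis
        unfolding enn_powr_mult_ennreal[OF y] enn_powr_mult_ennreal[OF D] enn_powr_powr_inverse[OF p] Wfun_eq .
    qed
    have "emeasure wm {s. ennreal s < emeasure um ?E} \<le> ennreal (y powr (- p)) * (ennreal (D powr p) * N p f)"
    proof (rule wm_less_le)
      fix t assume "0 < t" "ennreal t < emeasure um ?E"
      from mult_left_mono[OF *[OF this], of "ennreal (y powr (- p))"]
      show "emeasure wm {s. s < t} \<le> ennreal (y powr (- p)) * (ennreal (D powr p) * N p f)"
        using y by (simp add: mult.assoc[symmetric] ennreal_mult[symmetric] powr_minus)
    qed
    from mult_left_mono[OF this, of "ennreal (y powr p)"] show ?thesis
      using y unfolding cap_def by (simp add: mult.assoc[symmetric] ennreal_mult[symmetric] powr_minus)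
  qed
  moreover have "0 < D powr p" using D by simp
  moreover have "AE x in lebesgue. hilbert_defined f x" if "f \<in> borel_measurable lebesgue" "N p f < \<infinity>" for f
    using that by (intro d) (simp add: S)
  ultimately show ?thesis unfolding weak_type_def by blast
qed

text \<open>Since w is integrable on [t, t0], an infinite W(t0) comes from the mass at 0, and W(t)
  is infinite for every t > 0. Finiteness of the norm then forces the rearrangement to vanish, so
  \<Lambda>^r contains only null functions, on which H is zero.\<close>

lemma strong_type_infinite_weight:
  assumes inf: "emeasure wm {s. s < t0} = \<infinity>" and r: "0 < r"
  shows "strong_type r"
proof -
  have *: "AE x in lebesgue. f x = 0" if f: "f \<in> borel_measurable lebesgue" "N r f < \<infinity>" for f
  proof -
    have "rearr u f t = 0" if t: "0 < t" for t
    proof (rule ccontr)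
      assume nz: "rearr u f t \<noteq> 0"
      have "\<infinity> = emeasure wm {s. s < t0}" using inf by simp
      also have "\<dots> \<le> emeasure wm ({s. s < t} \<union> {t..t0})"
        by (rule emeasure_mono) (auto simp: lessThan_def[symmetric])
      also have "\<dots> \<le> emeasure wm {s. s < t} + emeasure wm {t..t0}"
        by (rule emeasure_subadditive) (auto simp: lessThan_def[symmetric])
      finally have wt: "emeasure wm {s. s < t} = \<infinity>"
        using wm_Icc[OF t, of t0] by (auto simp: top_unique ennreal_add_eq_top)
      have "enn_powr (rearr u f t) r \<noteq> 0"
        using nz by (auto simp: enn_powr_def enn2real_eq_0_iff)
      then have "\<infinity> = enn_powr (rearr u f t) r * emeasure wm {s. s < t}"
        using wt by (simp add: ennreal_mult_top)
      also have "\<dots> = (\<integral>\<^sup>+s. enn_powr (rearr u f t) r * indicator {s. s < t} s \<partial>wm)"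
        by (subst nn_integral_cmult_indicator) (auto simp: lessThan_def[symmetric])
      also have "\<dots> \<le> N r f"
        unfolding lint_def using antimono_rearr[of u f] r
        by (intro nn_integral_mono) (auto simp: indicator_def antimono_def intro!: enn_powr_mono)
      finally show False using f(2) by simp
    qed
    then have le: "emeasure um {x. 0 < \<bar>f x\<bar>} \<le> ennreal t" if "0 < t" for t
      using less_rearr_iff[OF f(1), of 0 t] that by auto
    have "emeasure um {x. 0 < \<bar>f x\<bar>} = 0"
    proof (rule ccontr)
      assume "emeasure um {x. 0 < \<bar>f x\<bar>} \<noteq> 0"
      then have "0 < emeasure um {x. 0 < \<bar>f x\<bar>}" by (simp add: zero_less_iff_neq_zero)
      then obtain z where z: "0 < z" "z < emeasure um {x. 0 < \<bar>f x\<bar>}" using dense by blast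
      then have "z \<noteq> \<infinity>" by auto
      then obtain t where t: "z = ennreal t" "0 \<le> t" by (cases z) auto
      with z have "0 < t" "ennreal t < emeasure um {x. 0 < \<bar>f x\<bar>}" by auto
      with le[of t] show False by auto
    qed
    then have "{x. 0 < \<bar>f x\<bar>} \<in> null_sets lebesgue"
      using sets_Collect_less_abs[OF f(1)] by (intro um_0_imp_null)
    from AE_not_in[OF this] show ?thesis by eventually_elim auto
  qed
  have "N r (hilbert f) \<le> ennreal 1 * N r f" if "f \<in> borel_measurable lebesgue" "N r f < \<infinity>" for f
  proof -
    have "hilbert f = (\<lambda>_. 0)" using hilbert_AE_zero(2)[OF *[OF that]] by auto
    then show ?thesis using that r by (auto intro!: lint_mono)
  qed
  moreover have "AE x in lebesgue. hilbert_defined f x" if "f \<in> borel_measurable lebesgue" "N r f < \<infinity>" for f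
    using hilbert_AE_zero(1)[OF *[OF that]] by simp
  ultimately show ?thesis unfolding strong_type_def using zero_less_one by blast
qed

end

text \<open>\<open>hilbert_defined\<close> asks for absolute integrability of the truncated kernel,
  and 1 / |x - y| diverges logarithmically at infinity. It serves to show that constants cannot lie
  in \<Lambda>^p.\<close>

lemma not_hilbert_defined_1: "\<not> hilbert_defined (\<lambda>_. 1) x"
proof
  assume "hilbert_defined (\<lambda>_. 1) x"
  then have "\<forall>\<^sub>F \<epsilon> in at_right 0. 0 < \<epsilon> \<and> set_integrable lebesgue {y. \<epsilon> < \<bar>x - y\<bar>} (\<lambda>y. 1 / (x - y))"
    unfolding hilbert_defined_def by (auto intro: eventually_conj eventually_at_right_less)
  from eventually_happens'[OF trivial_limit_at_right_real this]
  obtain \<epsilon> where e: "0 < \<epsilon>" "set_integrable lebesgue {y. \<epsilon> < \<bar>x - y\<bar>} (\<lambda>y. 1 / (x - y))"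
    by blast
  define g where "g = (\<lambda>y. \<bar>indicator {y. \<epsilon> < \<bar>x - y\<bar>} y * (1 / (x - y))\<bar>)"
  have g: "integrable lebesgue g"
    using e(2) unfolding g_def set_integrable_def by (intro integrable_abs) simp
  have "ln M - ln (2 * \<epsilon>) \<le> integral\<^sup>L lebesgue g" if M: "2 * \<epsilon> \<le> M" for M
  proof -
    have h: "has_bochner_integral lebesgue (\<lambda>y. indicator {x - M..x - 2 * \<epsilon>} y * (1 / (x - y))) (ln \<bar>x - (x - M)\<bar> - ln \<bar>x - (x - 2 * \<epsilon>)\<bar>)"
      using M e(1) by (intro has_bochner_integral_inverse_shift) auto
    then have "ln M - ln (2 * \<epsilon>) = (\<integral>y. indicator {x - M..x - 2 * \<epsilon>} y * (1 / (x - y)) \<partial>lebesgue)"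
      using M e(1) by (simp add: has_bochner_integral_iff)
    also have "\<dots> \<le> integral\<^sup>L lebesgue g"
      using h e(1) by (intro integral_mono g) (auto simp: has_bochner_integral_iff g_def indicator_def)
    finally show ?thesis .
  qed
  then have "ln (2 * \<epsilon> * exp (\<bar>integral\<^sup>L lebesgue g\<bar> + 1)) - ln (2 * \<epsilon>) \<le> integral\<^sup>L lebesgue g"
    using e(1) by simp
  moreover have "ln (2 * \<epsilon> * exp (\<bar>integral\<^sup>L lebesgue g\<bar> + 1)) = ln (2 * \<epsilon>) + (\<bar>integral\<^sup>L lebesgue g\<bar> + 1)"
    using e(1) by (subst ln_mult_pos) auto
  ultimately show False by linarith
qed

section \<open>Doubling of the weight\<close>

context lorentz_weights
begin

lemma um_Icc: "emeasure um {a..b} = ennreal (integral {a..b} u)"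
proof -
  have si: "set_integrable lebesgue {a..b} u" using weight_u by (simp add: weight_R_def)
  have "AE x in lebesgue. 0 < u x" using weight_u by (simp add: weight_R_def)
  then have nn: "AE x in lebesgue. 0 \<le> indicator {a..b} x *\<^sub>R u x"
    by eventually_elim (simp add: indicator_def)
  have "emeasure um {a..b} = (\<integral>\<^sup>+x. ennreal (indicator {a..b} x *\<^sub>R u x) \<partial>lebesgue)"
    unfolding umeas_def by (subst emeasure_density) (auto intro!: nn_integral_cong simp: indicator_def)
  also have "\<dots> = ennreal (LINT x:{a..b}|lebesgue. u x)"
    unfolding set_lebesgue_integral_def using si nn by (intro nn_integral_eq_integral) (auto simp: set_integrable_def)
  finally show ?thesis using set_lebesgue_integral_eq_integral(2)[OF si] by simp
qed

text \<open>The primitive of \<open>u\<close> is continuous, so the intermediate value theorem cuts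
  off the masses 2 t and then t; infinite total mass guarantees a large enough interval to start
  from.\<close>

lemma exists_adjacent_intervals:
  assumes inf: "emeasure um UNIV = \<infinity>" and t: "0 < t"
  obtains a m b where "a < m" "m < b" "emeasure um {a..m} = ennreal t" "emeasure um {m..b} = ennreal t"
proof -
  have "(SUP n. emeasure um {- real n..real n}) = emeasure um (\<Union>n. {- real n..real n})"
    by (rule SUP_emeasure_incseq) (auto simp: incseq_def)
  also have "(\<Union>n. {- real n..real n}) = UNIV"
  proof (intro equalityI subsetI UNIV_I UN_I)
    fix x :: real
    show "x \<in> {- real (nat \<lceil>\<bar>x\<bar>\<rceil>)..real (nat \<lceil>\<bar>x\<bar>\<rceil>)}" by (simp; linarith)
  qed
  finally have sup: "(SUP n. emeasure um {- real n..real n}) = emeasure um UNIV" .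
  have "ennreal (2 * t) < (SUP n. emeasure um {- real n..real n})" unfolding sup inf by simp
  then obtain n where n: "ennreal (2 * t) < emeasure um {- real n..real n}" by (auto simp: less_SUP_iff)
  define a where "a = - real n"
  define c where "c = real n"
  have io: "u integrable_on {x..y}" for x y
    using weight_u set_lebesgue_integral_eq_integral(1) unfolding weight_R_def by blast
  have ac: "a \<le> c" by (simp add: a_def c_def)
  have big: "2 * t < integral {a..c} u"
    using n t unfolding um_Icc a_def c_def by (simp add: ennreal_less_iff)
  have cont: "continuous_on {a..y} (\<lambda>x. integral {a..x} u)" for y
    by (rule indefinite_integral_continuous_1[OF io])
  have z: "integral {a..a} u = 0" by simp
  obtain b where b: "a \<le> b" "b \<le> c" "integral {a..b} u = 2 * t"
    using IVT'[of "\<lambda>x. integral {a..x} u" a "2 * t" c] z big t ac cont by auto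
  obtain m where m: "a \<le> m" "m \<le> b" "integral {a..m} u = t"
    using IVT'[of "\<lambda>x. integral {a..x} u" a t b] z b t cont by auto
  have "integral {a..m} u + integral {m..b} u = integral {a..b} u"
    by (rule Henstock_Kurzweil_Integration.integral_combine[OF m(1,2) io])
  with m b have mb: "integral {m..b} u = t" by simp
  have "a \<noteq> m" "m \<noteq> b" using m(3) mb t by auto
  with m mb show thesis by (intro that[of a m b]) (auto simp: um_Icc)
qed

end

lemma abs_ln_gt:
  fixes q :: real
  assumes "0 < q" "q < 4/5 \<or> 5/4 < q"
  shows "ln (5/4) < \<bar>ln q\<bar>"
proof (cases "5/4 < q")
  case True
  then have "ln (5/4) < ln q" by (subst ln_less_cancel_iff) auto
  then show ?thesis by linarith
next
  case False
  with assms have "q < 4/5" by auto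
  then have "ln q < ln (4/5)" using assms by (subst ln_less_cancel_iff) auto
  also have "ln (4/5) = - ln (5/4::real)" using ln_inverse[of "5/4::real"] by simp
  finally show ?thesis by linarith
qed

text \<open>Written in the affine coordinate s = (x - a) / d with \<open>d\<close> of either sign:
  reflection only changes the sign of H, so one statement serves test intervals on both sides of
  \<open>a\<close>.\<close>

lemma hilbert_indicator_segment:
  fixes a d s :: real
  assumes "d \<noteq> 0" "0 < k" "s \<noteq> 0" "s \<noteq> k"
  shows "\<bar>hilbert (indicator {min a (a + k * d)..max a (a + k * d)}) (a + s * d)\<bar> = \<bar>ln (\<bar>s\<bar> / \<bar>s - k\<bar>)\<bar> / pi"
proof -
  let ?x = "a + s * d" and ?b = "a + k * d"
  have e: "?x - a = s * d" "?x - ?b = (s - k) * d" by (auto simp: algebra_simps)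
  have "?x - a \<noteq> 0" "?x - ?b \<noteq> 0" unfolding e using assms by auto
  then have ne: "?x \<noteq> a" "?x \<noteq> ?b" by auto
  have r: "\<bar>?x - a\<bar> / \<bar>?x - ?b\<bar> = \<bar>s\<bar> / \<bar>s - k\<bar>" unfolding e using assms by (simp add: abs_mult)
  have r': "\<bar>?x - ?b\<bar> / \<bar>?x - a\<bar> = inverse (\<bar>s\<bar> / \<bar>s - k\<bar>)" unfolding e using assms by (simp add: abs_mult)
  show ?thesis
  proof (cases "a \<le> ?b")
    case True
    then have "hilbert (indicator {min a ?b..max a ?b}) ?x = ln (\<bar>?x - a\<bar> / \<bar>?x - ?b\<bar>) / pi"
      using hilbert_indicator_Icc(2)[OF True ne] by simp
    then show ?thesis unfolding r by (simp add: abs_divide)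
  next
    case False
    then have "?b \<le> a" by simp
    from False have "hilbert (indicator {min a ?b..max a ?b}) ?x = ln (\<bar>?x - ?b\<bar> / \<bar>?x - a\<bar>) / pi"
      using hilbert_indicator_Icc(2)[OF \<open>?b \<le> a\<close> ne(2,1)] by (simp add: min_def max_def)
    then show ?thesis unfolding r' ln_inverse by (simp add: abs_divide)
  qed
qed

text \<open>The transform of one interval vanishes at its midpoint, s = 1/2 for \<open>E1\<close>.
  The half interval \<open>E2\<close> has its zero at s = 1/4, so the two are never small together.
  For 1 < s <= 2 the ratios s / (s - 1) >= 2 and s / (s - 1/2) >= 4/3 both exceed 5/4.\<close>

lemma hilbert_segment_large:
  fixes a d s :: real
  defines "E1 \<equiv> {min a (a + 1 * d)..max a (a + 1 * d)}" and "E2 \<equiv> {min a (a + 1/2 * d)..max a (a + 1/2 * d)}"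
  assumes d: "d \<noteq> 0" and s: "0 < s" "s \<le> 2" "s \<noteq> 1" "s \<noteq> 1/2"
  defines "P \<equiv> \<lambda>E. ln (5/4) / pi < \<bar>hilbert (indicator E) (a + s * d)\<bar>"
  shows "1 < s \<Longrightarrow> P E1 \<and> P E2" "P E1 \<or> P E2"
proof -
  have 1: "P E1" if "\<bar>s\<bar> / \<bar>s - 1\<bar> < 4/5 \<or> 5/4 < \<bar>s\<bar> / \<bar>s - 1\<bar>"
    unfolding P_def E1_def using hilbert_indicator_segment[OF d, of 1 s a] s that
    by (simp add: divide_strict_right_mono abs_ln_gt)
  have 2: "P E2" if "\<bar>s\<bar> / \<bar>s - 1/2\<bar> < 4/5 \<or> 5/4 < \<bar>s\<bar> / \<bar>s - 1/2\<bar>"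
    unfolding P_def E2_def using hilbert_indicator_segment[OF d, of "1/2" s a] s that
    by (simp add: divide_strict_right_mono abs_ln_gt)
  have main: "if 1 < s then P E1 \<and> P E2 else P E1 \<or> P E2"
  proof (cases "1 < s")
    case True
    then have "5/4 < \<bar>s\<bar> / \<bar>s - 1\<bar>" "5/4 < \<bar>s\<bar> / \<bar>s - 1/2\<bar>" using s by (auto simp: less_divide_eq)
    then show ?thesis using 1 2 True by auto
  next
    case False
    then have s1: "s < 1" using s by simp
    show ?thesis
    \<comment> \<open>Exactly for 4/9 <= s <= 5/9 does s / (1 - s) lie between 4/5 and 5/4, where
      \<open>E1\<close> gives nothing; there s / |s - 1/2| is at least 8, and \<open>E2\<close>
      takes over.\<close>
    proof (cases "4/9 \<le> s \<and> s \<le> 5/9")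
      case True
      have "5/4 < \<bar>s\<bar> / \<bar>s - 1/2\<bar>"
      proof (cases "s < 1/2")
        case t: True
        then show ?thesis using True by (auto simp: less_divide_eq)
      next
        case False
        then show ?thesis using True s by (auto simp: less_divide_eq)
      qed
      then show ?thesis using 2 False by auto
    next
      case f: False
      have "\<bar>s\<bar> / \<bar>s - 1\<bar> < 4/5 \<or> 5/4 < \<bar>s\<bar> / \<bar>s - 1\<bar>"
        using f s s1 by (auto simp: less_divide_eq divide_less_eq)
      then show ?thesis using 1 False by auto
    qed
  qed
  show "1 < s \<Longrightarrow> P E1 \<and> P E2" using main by simp
  show "P E1 \<or> P E2" using main by (cases "1 < s") auto
qed

text \<open>The assumption \<open>fin\<close> separates off weights with W infinite near 0. The
  exponent is a locale parameter because the final iteration interprets the locale anew for larger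
  and larger values of it.\<close>

locale hilbert_weak = lorentz_weights +
  fixes p :: real
  assumes p_pos: "0 < p" and weak: "weak_type p" and fin: "\<And>t. emeasure wm {s. s < t} < \<infinity>"
begin

lemma weak_defined: "f \<in> borel_measurable lebesgue \<Longrightarrow> N p f < \<infinity> \<Longrightarrow> AE x in lebesgue. hilbert_defined f x"
  using weak unfolding weak_type_def by blast

lemma weak_measurable: "f \<in> borel_measurable lebesgue \<Longrightarrow> N p f < \<infinity> \<Longrightarrow> hilbert f \<in> borel_measurable lebesgue"
  by (rule hilbert_measurable[OF _ weak_defined])

lemma weak_bound:
  obtains C where "0 < C" "\<And>f y. f \<in> borel_measurable lebesgue \<Longrightarrow> N p f < \<infinity> \<Longrightarrow> 0 < y \<Longrightarrow>
     V {x. y < \<bar>hilbert f x\<bar>} \<le> ennreal (C * y powr (- p)) * N p f"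
proof -
  obtain C where C: "0 < C" "\<And>f y. f \<in> borel_measurable lebesgue \<Longrightarrow> N p f < \<infinity> \<Longrightarrow> 0 < y \<Longrightarrow>
     ennreal (y powr p) * V {x. y < \<bar>hilbert f x\<bar>} \<le> ennreal C * N p f"
    using weak unfolding weak_type_def by blast
  have "V {x. y < \<bar>hilbert f x\<bar>} \<le> ennreal (C * y powr (- p)) * N p f"
    if "f \<in> borel_measurable lebesgue" "N p f < \<infinity>" "0 < y" for f y
  proof -
    have "V {x. y < \<bar>hilbert f x\<bar>} = ennreal (y powr (- p)) * (ennreal (y powr p) * V {x. y < \<bar>hilbert f x\<bar>})"
      using that(3) by (simp add: mult.assoc[symmetric] ennreal_mult[symmetric] powr_minus)
    also have "\<dots> \<le> ennreal (y powr (- p)) * (ennreal C * N p f)" by (intro mult_left_mono C(2) that) auto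
    finally show ?thesis using C(1) by (simp add: ennreal_mult mult_ac)
  qed
  with C(1) show thesis by (rule that)
qed

lemma cap_finite: "emeasure um E < \<infinity> \<Longrightarrow> V E < \<infinity>"
proof -
  assume "emeasure um E < \<infinity>"
  then obtain t where t: "emeasure um E = ennreal t" "0 \<le> t" by (cases "emeasure um E") auto
  have "V E \<le> emeasure wm {s. s < t + 1}" unfolding cap_def t
  proof (rule emeasure_mono)
    show "{s. ennreal s < ennreal t} \<subseteq> {s. s < t + 1}"
      by (auto simp: not_less dest!: leD) (smt (verit) ennreal_leI not_le)
  qed (auto simp: lessThan_def[symmetric])
  then show ?thesis using fin[of "t + 1"] by (rule le_less_trans)
qed

lemma cap_Icc_finite: "V {a..b} < \<infinity>"
  by (intro cap_finite emeasure_um_Icc)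

text \<open>Otherwise the constant 1 would lie in \<Lambda>^p, but its Hilbert transform exists
  nowhere.\<close>

lemma cap_UNIV: "V UNIV = \<infinity>"
proof (rule ccontr)
  assume "V UNIV \<noteq> \<infinity>"
  then have "N p (indicator UNIV) < \<infinity>" using p_pos by (subst lint_indicator) (auto simp: less_top)
  then have "AE x in lebesgue. hilbert_defined (indicator UNIV) x" by (intro weak_defined) auto
  then have "AE x in (lebesgue :: real measure). False"
    using not_hilbert_defined_1 by (simp add: indicator_def)
  then have "AE x in (lborel :: real measure). False" by (simp only: AE_completion_iff)
  then show False by (simp add: eventually_False ae_filter_eq_bot_iff)
qed

lemma um_UNIV: "emeasure um UNIV = \<infinity>"
proof (rule ccontr)
  assume "emeasure um UNIV \<noteq> \<infinity>"
  then have "emeasure um UNIV < \<infinity>" by (simp add: less_top)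
  from cap_finite[OF this] show False by (simp add: cap_UNIV)
qed

text \<open>Take adjacent intervals of equal mass t and test with the longer one, E. Up to null
  sets, the sets where the transforms of E and of its outer half are large together cover E once and
  the neighbour J twice. Their masses add up to at least 3 t, so one of them has mass at least 3 t /
  2, and weak type bounds its W-value by a multiple of W(t).\<close>

lemma wm_three_halves:
  obtains C where "0 < C" "\<And>t. 0 < t \<Longrightarrow> emeasure wm {s. ennreal s < ennreal (3/2 * t)} \<le> ennreal C * emeasure wm {s. ennreal s < ennreal t}"
proof -
  obtain C where C: "0 < C" "\<And>f y. f \<in> borel_measurable lebesgue \<Longrightarrow> N p f < \<infinity> \<Longrightarrow> 0 < y \<Longrightarrow>
     V {x. y < \<bar>hilbert f x\<bar>} \<le> ennreal (C * y powr (- p)) * N p f"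
    using weak_bound by blast
  define \<kappa> where "\<kappa> = ln (5/4) / pi"
  have k: "0 < \<kappa>" by (simp add: \<kappa>_def)
  have *: "V {x. \<kappa> < \<bar>hilbert (indicator {c..d}) x\<bar>} \<le> ennreal (C * \<kappa> powr (- p)) * V {c..d}"
     and m: "{x. \<kappa> < \<bar>hilbert (indicator {c..d}) x\<bar>} \<in> sets lebesgue" for c d :: real
  proof -
    have N: "N p (indicator {c..d}) = V {c..d}" using p_pos by (intro lint_indicator) auto
    then have "N p (indicator {c..d}) < \<infinity>" using cap_Icc_finite by simp
    moreover have "indicat_real {c..d} \<in> borel_measurable lebesgue" by (rule borel_measurable_indicator) simp
    ultimately show "V {x. \<kappa> < \<bar>hilbert (indicator {c..d}) x\<bar>} \<le> ennreal (C * \<kappa> powr (- p)) * V {c..d}"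
      "{x. \<kappa> < \<bar>hilbert (indicator {c..d}) x\<bar>} \<in> sets lebesgue"
      using C(2)[of "indicator {c..d}" \<kappa>] k N weak_measurable[of "indicator {c..d}"] by auto
  qed
  have main: "emeasure wm {s. ennreal s < ennreal (3/2 * t)} \<le> ennreal (C * \<kappa> powr (- p)) * emeasure wm {s. ennreal s < ennreal t}"
    if t: "0 < t" and d: "d \<noteq> 0" and E: "emeasure um {min a (a + d)..max a (a + d)} = ennreal t"
      and J: "emeasure um J = ennreal t" "J \<in> sets lebesgue" "\<And>x. x \<in> J \<Longrightarrow> \<exists>s. 1 \<le> s \<and> s \<le> 2 \<and> x = a + s * d" for t a d J
  proof -
    let ?E1 = "{min a (a + 1 * d)..max a (a + 1 * d)}" and ?E2 = "{min a (a + 1/2 * d)..max a (a + 1/2 * d)}"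
    let ?G = "\<lambda>E. {x. \<kappa> < \<bar>hilbert (indicator E) x\<bar>}"
    have "AE x in lborel. x \<noteq> a \<and> x \<noteq> a + d \<and> x \<noteq> a + 1/2 * d"
      using AE_lborel_singleton[of a] AE_lborel_singleton[of "a + d"] AE_lborel_singleton[of "a + 1/2 * d"] by eventually_elim auto
    then have "AE x in lebesgue. x \<noteq> a \<and> x \<noteq> a + d \<and> x \<noteq> a + 1/2 * d" by (rule AE_completion)
    \<comment> \<open>Two pointwise facts in one inequality: on \<open>?E1\<close> at least one of
      the transforms is large, on \<open>J\<close> both are. The three excluded points are the
      endpoints and the midpoint of \<open>?E1\<close>.\<close>
    then have ae: "AE x in lebesgue. (indicator ?E1 x + 2 * indicator J x :: ennreal) \<le> indicator (?G ?E1) x + indicator (?G ?E2) x"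
    proof eventually_elim
      case (elim x)
      define s where "s = (x - a) / d"
      have x: "x = a + s * d" using d by (simp add: s_def)
      have s: "s \<noteq> 0" "s \<noteq> 1" "s \<noteq> 1/2" using elim x by auto
      have G1: "x \<in> ?G ?E1 \<and> x \<in> ?G ?E2" if "1 < s" "s \<le> 2"
      proof -
        have "0 < s" using that by simp
        from hilbert_segment_large(1)[OF d this that(2) s(2,3) that(1), of a]
        show ?thesis unfolding \<kappa>_def x mem_Collect_eq .
      qed
      have G2: "x \<in> ?G ?E1 \<or> x \<in> ?G ?E2" if "0 < s" "s \<le> 2"
        using hilbert_segment_large(2)[OF d that s(2,3), of a] unfolding \<kappa>_def x mem_Collect_eq .
      have J1: "1 < s \<and> s \<le> 2" if xJ: "x \<in> J"
      proof -
        obtain s' where "1 \<le> s'" "s' \<le> 2" "x = a + s' * d" using J(3)[OF xJ] by blast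
        then have "s' = s" using d x by simp
        then show ?thesis using \<open>1 \<le> s'\<close> \<open>s' \<le> 2\<close> s by auto
      qed
      have E1: "0 < s \<and> s < 1" if "x \<in> ?E1"
      proof (cases "0 < d")
        case True
        with that have "0 \<le> s * d" "s * d \<le> 1 * d" by (auto simp: x min_def max_def split: if_splits)
        then show ?thesis using True s by (auto simp: zero_le_mult_iff mult_le_cancel_right)
      next
        case False
        with that d have "s * d \<le> 0" "1 * d \<le> s * d" by (auto simp: x min_def max_def split: if_splits)
        then show ?thesis using False d s by (auto simp: mult_le_0_iff mult_le_cancel_right)
      qed
      have "\<not> (x \<in> J \<and> x \<in> ?E1)"
      proof
        assume "x \<in> J \<and> x \<in> ?E1"
        with J1 E1 have "1 < s" "s < 1" by blast+
        then show False by simp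
      qed
      then consider "x \<in> J" "x \<notin> ?E1" | "x \<notin> J" "x \<in> ?E1" | "x \<notin> J" "x \<notin> ?E1" by blast
      then show ?case
      proof cases
        case 1
        have "x \<in> ?G ?E1 \<and> x \<in> ?G ?E2" using J1[OF 1(1)] by (intro G1) blast+
        with 1 show ?thesis by (simp add: indicator_def)
      next
        case 2
        have "x \<in> ?G ?E1 \<or> x \<in> ?G ?E2" using E1[OF 2(2)] by (intro G2) auto
        with 2 show ?thesis by (auto simp: indicator_def)
      next
        case 3
        then show ?thesis by (simp add: indicator_def)
      qed
    qed
    have [measurable]: "?E1 \<in> sets um" "J \<in> sets um" "?G ?E1 \<in> sets um" "?G ?E2 \<in> sets um"
      using J(2) m by simp_all
    have "ennreal (3 * t) = ennreal t + 2 * ennreal t"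
      using t by (simp add: ennreal_plus[symmetric] ennreal_mult[symmetric] ennreal_numeral[symmetric] del: ennreal_plus ennreal_numeral)
    also have "\<dots> = (\<integral>\<^sup>+x. indicator ?E1 x \<partial>um) + (\<integral>\<^sup>+x. 2 * indicator J x \<partial>um)"
      using E J(1,2) by (simp add: nn_integral_cmult_indicator)
    also have "\<dots> = (\<integral>\<^sup>+x. indicator ?E1 x + 2 * indicator J x \<partial>um)"
      by (rule nn_integral_add[symmetric]) measurable
    also have "\<dots> \<le> (\<integral>\<^sup>+x. indicator (?G ?E1) x + indicator (?G ?E2) x \<partial>um)"
    proof (rule nn_integral_mono_AE)
      show "AE x in um. (indicator ?E1 x + 2 * indicator J x :: ennreal) \<le> indicator (?G ?E1) x + indicator (?G ?E2) x"
        unfolding umeas_def by (subst AE_density) (use ae in auto)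
    qed
    also have "\<dots> = (\<integral>\<^sup>+x. indicator (?G ?E1) x \<partial>um) + (\<integral>\<^sup>+x. indicator (?G ?E2) x \<partial>um)"
      by (rule nn_integral_add) measurable
    also have "\<dots> = emeasure um (?G ?E1) + emeasure um (?G ?E2)"
      by (simp only: nn_integral_indicator[OF \<open>?G ?E1 \<in> sets um\<close>] nn_integral_indicator[OF \<open>?G ?E2 \<in> sets um\<close>])
    finally have sum: "ennreal (3 * t) \<le> emeasure um (?G ?E1) + emeasure um (?G ?E2)" .
    have "ennreal (3/2 * t) \<le> emeasure um (?G ?E1) \<or> ennreal (3/2 * t) \<le> emeasure um (?G ?E2)"
    proof (rule ccontr)
      assume "\<not> ?thesis"
      then have "emeasure um (?G ?E1) + emeasure um (?G ?E2) < ennreal (3/2 * t) + ennreal (3/2 * t)"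
        by (intro add_strict_mono) auto
      also have "\<dots> = ennreal (3 * t)" using t by (simp add: ennreal_plus[symmetric] del: ennreal_plus)
      finally show False using sum by auto
    qed
    then have "emeasure wm {s. ennreal s < ennreal (3/2 * t)} \<le> max (V (?G ?E1)) (V (?G ?E2))"
      unfolding cap_def le_max_iff_disj by (auto intro!: emeasure_mono intro: less_le_trans)
    also have "\<dots> \<le> ennreal (C * \<kappa> powr (- p)) * V ?E1"
    proof (rule max.boundedI)
      show "V (?G ?E1) \<le> ennreal (C * \<kappa> powr (- p)) * V ?E1" by (rule *)
      have "?E2 \<subseteq> ?E1" by (auto simp: min_def max_def split: if_splits)
      then have "V ?E2 \<le> V ?E1" by (rule cap_mono) simp
      then show "V (?G ?E2) \<le> ennreal (C * \<kappa> powr (- p)) * V ?E1"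
        by (intro order_trans[OF *] mult_left_mono) auto
    qed
    finally show ?thesis using E by (simp add: cap_def)
  qed
  have "emeasure wm {s. ennreal s < ennreal (3/2 * t)} \<le> ennreal (C * \<kappa> powr (- p)) * emeasure wm {s. ennreal s < ennreal t}"
    if t: "0 < t" for t
  proof -
    obtain a m b where i: "a < m" "m < b" "emeasure um {a..m} = ennreal t" "emeasure um {m..b} = ennreal t"
      using exists_adjacent_intervals[OF um_UNIV t] by blast
    show ?thesis
    \<comment> \<open>The longer interval has to be the test interval, so that its neighbour stays
      within s <= 2.\<close>
    proof (cases "b - m \<le> m - a")
      case True
      show ?thesis
      proof (rule main[OF t, of "m - a" a "{m..b}"])
        show "emeasure um {min a (a + (m - a))..max a (a + (m - a))} = ennreal t" using i by simp
        fix x assume x: "x \<in> {m..b}"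
        show "\<exists>s\<ge>1. s \<le> 2 \<and> x = a + s * (m - a)"
          using x i True by (intro exI[of _ "(x - a) / (m - a)"]) (auto simp: field_simps)
      qed (use i in auto)
    next
      case False
      show ?thesis
      proof (rule main[OF t, of "m - b" b "{a..m}"])
        show "emeasure um {min b (b + (m - b))..max b (b + (m - b))} = ennreal t" using i by simp
        fix x assume x: "x \<in> {a..m}"
        show "\<exists>s\<ge>1. s \<le> 2 \<and> x = b + s * (m - b)"
          using x i False by (intro exI[of _ "(b - x) / (b - m)"]) (auto simp: field_simps)
      qed (use i in auto)
    qed
  qed
  moreover have "0 < C * \<kappa> powr (- p)" using C k by simp
  ultimately show thesis by (rule that[rotated])
qed

lemma wm_doubling:
  obtains K where "1 \<le> K" "\<And>t. 0 < t \<Longrightarrow> emeasure wm {s. ennreal s < ennreal (2 * t)} \<le> ennreal K * emeasure wm {s. ennreal s < ennreal t}"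
proof -
  obtain C where C: "0 < C" "\<And>t. 0 < t \<Longrightarrow> emeasure wm {s. ennreal s < ennreal (3/2 * t)} \<le> ennreal C * emeasure wm {s. ennreal s < ennreal t}"
    using wm_three_halves by blast
  have "emeasure wm {s. ennreal s < ennreal (2 * t)} \<le> ennreal (max 1 (C * C)) * emeasure wm {s. ennreal s < ennreal t}" if t: "0 < t" for t
  proof -
    \<comment> \<open>Two steps suffice, as (3/2)^2 = 9/4 >= 2.\<close>
    have "emeasure wm {s. ennreal s < ennreal (2 * t)} \<le> emeasure wm {s. ennreal s < ennreal (3/2 * (3/2 * t))}"
    proof (rule emeasure_mono)
      have "ennreal (2 * t) \<le> ennreal (3/2 * (3/2 * t))" using t by (intro ennreal_leI) simp
      then show "{s. ennreal s < ennreal (2 * t)} \<subseteq> {s. ennreal s < ennreal (3/2 * (3/2 * t))}"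
        by (auto intro: less_le_trans)
    qed auto
    also have "\<dots> \<le> ennreal C * emeasure wm {s. ennreal s < ennreal (3/2 * t)}"
      using t by (intro C(2)) simp
    also have "\<dots> \<le> ennreal C * (ennreal C * emeasure wm {s. ennreal s < ennreal t})"
      using t by (intro mult_left_mono C(2)) auto
    also have "\<dots> = ennreal (C * C) * emeasure wm {s. ennreal s < ennreal t}"
      using C(1) by (simp add: ennreal_mult mult.assoc)
    also have "\<dots> \<le> ennreal (max 1 (C * C)) * emeasure wm {s. ennreal s < ennreal t}"
      by (intro mult_right_mono ennreal_leI) auto
    finally show ?thesis .
  qed
  then show thesis by (intro that[of "max 1 (C * C)"]) auto
qed

text \<open>The mass of a union is at most twice the larger of the two masses, so doubling of W
  applies. Masses 0 and infinity lie outside the range of the doubling inequality and are treated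
  directly.\<close>

lemma cap_quasi_subadditive:
  obtains K where "1 \<le> K" "\<And>A B. A \<in> sets lebesgue \<Longrightarrow> B \<in> sets lebesgue \<Longrightarrow> V (A \<union> B) \<le> ennreal K * (V A + V B)"
proof -
  obtain K where K: "1 \<le> K" "\<And>t. 0 < t \<Longrightarrow> emeasure wm {s. ennreal s < ennreal (2 * t)} \<le> ennreal K * emeasure wm {s. ennreal s < ennreal t}"
    using wm_doubling by blast
  have *: "V (A \<union> B) \<le> ennreal K * V A" if AB: "A \<in> sets lebesgue" "B \<in> sets lebesgue" "emeasure um B \<le> emeasure um A" for A B
  proof -
    have le: "emeasure um (A \<union> B) \<le> emeasure um A + emeasure um A"
      using AB by (intro order_trans[OF emeasure_subadditive] add_left_mono) auto
    show ?thesis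
    proof (cases "emeasure um A = \<infinity>")
      case True
      then have "V (A \<union> B) \<le> V A" by (intro cap_mono_um) simp
      also have "\<dots> \<le> ennreal K * V A" using mult_right_mono[of 1 "ennreal K" "V A"] K(1) by simp
      finally show ?thesis .
    next
      case False
      then obtain t where t: "emeasure um A = ennreal t" "0 \<le> t" by (cases "emeasure um A") auto
      show ?thesis
      proof (cases "t = 0")
        case True
        then have "emeasure um (A \<union> B) = 0" using le t by simp
        then show ?thesis by (simp add: cap_um_0)
      next
        case False
        have "ennreal t + ennreal t = ennreal (2 * t)" using t by (simp flip: ennreal_plus)
        then have "V (A \<union> B) \<le> emeasure wm {s. ennreal s < ennreal (2 * t)}"
          unfolding cap_def using le t by (intro emeasure_mono) (auto intro: less_le_trans)
        also have "\<dots> \<le> ennreal K * V A" unfolding cap_def t(1) using False t by (intro K(2)) simp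
        finally show ?thesis .
      qed
    qed
  qed
  have "V (A \<union> B) \<le> ennreal K * (V A + V B)" if AB: "A \<in> sets lebesgue" "B \<in> sets lebesgue" for A B
  proof (cases "emeasure um B \<le> emeasure um A")
    case True
    then show ?thesis using *[OF AB True] by (rule_tac order_trans[OF _ mult_left_mono]) auto
  next
    case False
    then have "V (B \<union> A) \<le> ennreal K * V B" using * AB by simp
    then show ?thesis by (rule_tac order_trans[OF _ mult_left_mono]) (auto simp: Un_commute)
  qed
  with K(1) show thesis by (rule that)
qed

text \<open>If W vanished at some t > 0, doubling would spread the zero to all 2^n t and hence to
  \<open>V UNIV\<close>, which is infinite.\<close>

lemma cap_pos:
  assumes "0 < emeasure um E"
  shows "0 < V E"
proof (rule ccontr)
  assume "\<not> 0 < V E"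
  then have V0: "V E = 0" by simp
  obtain z where z: "0 < z" "z < emeasure um E" using dense[OF assms] by blast
  then have "z \<noteq> \<infinity>" by auto
  then obtain t where t: "z = ennreal t" "0 \<le> t" by (cases z) auto
  with z have t0: "0 < t" by auto
  obtain K where K: "1 \<le> K" "\<And>t. 0 < t \<Longrightarrow> emeasure wm {s. ennreal s < ennreal (2 * t)} \<le> ennreal K * emeasure wm {s. ennreal s < ennreal t}"
    using wm_doubling by blast
  have n: "emeasure wm {s. ennreal s < ennreal (2 ^ n * t)} = 0" for n
  proof (induction n)
    case 0
    have "emeasure wm {s. ennreal s < ennreal t} \<le> V E"
      unfolding cap_def using z t by (intro emeasure_mono) (auto intro: less_trans)
    then show ?case using V0 by simp
  next
    case (Suc n)
    from K(2)[of "2 ^ n * t"] t0 Suc show ?case by (simp add: mult.assoc)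
  qed
  have "V UNIV \<le> 0" unfolding cap_def
  proof (rule wm_less_le)
    fix \<tau> :: real assume "0 < \<tau>"
    obtain n where "\<tau> / t < 2 ^ n" using real_arch_pow[of 2 "\<tau> / t"] by auto
    then have "\<tau> < 2 ^ n * t" using t0 by (simp add: divide_less_eq)
    then have "emeasure wm {s. s < \<tau>} \<le> emeasure wm {s. ennreal s < ennreal (2 ^ n * t)}"
      using \<open>0 < \<tau>\<close> by (intro emeasure_mono) (auto intro!: ennreal_lessI)
    then show "emeasure wm {s. s < \<tau>} \<le> 0" using n by simp
  qed
  then show False by (simp add: cap_UNIV)
qed

end

section \<open>The restricted estimate for rational functions\<close>

text \<open>The inequality ln z <= z - 1 at z = (t - 1) / (t + 1) gives ln ((t + 1) / (t - 1)) >= 2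
  / (t + 1) >= 1 / t. So the transform of an indicator decays no faster than 1 / |x|, which is what
  makes weak type informative at infinity.\<close>

lemma abs_hilbert_indicator_ge:
  assumes "2 < \<bar>x\<bar>"
  shows "1 / (pi * \<bar>x\<bar>) \<le> \<bar>hilbert (indicator {-1..1::real}) x\<bar>"
proof -
  have key: "1 / t \<le> ln ((t + 1) / (t - 1))" if "2 < t" for t :: real
  proof -
    have "ln ((t - 1) / (t + 1)) \<le> (t - 1) / (t + 1) - 1" using that by (intro ln_le_minus_one) auto
    moreover have "ln ((t - 1) / (t + 1)) = - ln ((t + 1) / (t - 1))"
      using that by (simp add: ln_divide_pos)
    moreover have "1 / t \<le> 1 - (t - 1) / (t + 1)" using that by (simp add: field_simps)
    ultimately show ?thesis by linarith
  qed
  have H: "hilbert (indicator {-1..1}) x = ln (\<bar>x - (-1)\<bar> / \<bar>x - 1\<bar>) / pi"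
    using assms by (intro hilbert_indicator_Icc(2)) auto
  have "1 / \<bar>x\<bar> \<le> \<bar>ln (\<bar>x - (-1)\<bar> / \<bar>x - 1\<bar>)\<bar>"
  proof (cases "0 < x")
    case True
    then show ?thesis using key[of x] assms by auto
  next
    case False
    have "ln (\<bar>x - (-1)\<bar> / \<bar>x - 1\<bar>) = ln ((- x - 1) / (- x + 1))" using False assms by auto
    also have "\<dots> = - ln ((- x + 1) / (- x - 1))" using False assms by (subst (1 2) ln_divide_pos) auto
    finally show ?thesis using key[of "- x"] False assms by auto
  qed
  then have "1 / \<bar>x\<bar> / pi \<le> \<bar>ln (\<bar>x - (-1)\<bar> / \<bar>x - 1\<bar>)\<bar> / pi" by (intro divide_right_mono) auto
  then show ?thesis unfolding H by (simp add: abs_divide mult.commute)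
qed

lemma powr_divide_minus: "0 < y \<Longrightarrow> 0 < c \<Longrightarrow> (y / c) powr (- e) = c powr e * y powr (- e)" for y c e :: real
  by (simp add: powr_divide powr_minus field_simps)

lemma one_le_powr_minus: "0 < x \<Longrightarrow> x \<le> 1 \<Longrightarrow> 0 \<le> a \<Longrightarrow> 1 \<le> x powr (- a)" for x a :: real
  using powr_mono'[of "- a" 0 x] by simp

context hilbert_weak
begin

text \<open>Outside [-2, 2] the function 1 / (1 + |x|) is dominated by a multiple of |H f| with f
  the indicator of [-1, 1], to which weak type applies. The remaining interval has finite
  \<open>V\<close>, which y^(-p) >= 1 absorbs when y < 1; for y >= 1 the level set is empty.\<close>

lemma cap_decay:
  obtains C where "0 < C" "\<And>y. 0 < y \<Longrightarrow> V {x. y < 1 / (1 + \<bar>x\<bar>)} \<le> ennreal (C * y powr (- p))"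
proof -
  obtain C0 where C0: "0 < C0" "\<And>f y. f \<in> borel_measurable lebesgue \<Longrightarrow> N p f < \<infinity> \<Longrightarrow> 0 < y \<Longrightarrow>
     V {x. y < \<bar>hilbert f x\<bar>} \<le> ennreal (C0 * y powr (- p)) * N p f"
    using weak_bound by blast
  obtain K where K: "1 \<le> K" "\<And>A B. A \<in> sets lebesgue \<Longrightarrow> B \<in> sets lebesgue \<Longrightarrow> V (A \<union> B) \<le> ennreal K * (V A + V B)"
    using cap_quasi_subadditive by blast
  obtain v where v: "V {-2..2} = ennreal v" "0 \<le> v" using cap_Icc_finite[of "-2" 2] by (cases "V {-2..2}") auto
  obtain v1 where v1: "V {-1..1} = ennreal v1" "0 \<le> v1" using cap_Icc_finite[of "-1" 1] by (cases "V {-1..1}") auto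
  let ?f = "indicat_real {-1..1::real}"
  have f: "?f \<in> borel_measurable lebesgue" by (rule borel_measurable_indicator) simp
  have Nf: "N p ?f = ennreal v1" using p_pos v1 by (subst lint_indicator) auto
  have Hm: "hilbert ?f \<in> borel_measurable lebesgue" using f Nf by (intro weak_measurable) auto
  define D where "D = K * (v + C0 * 4 powr p * v1) + 1"
  have "V {x. y < 1 / (1 + \<bar>x\<bar>)} \<le> ennreal (D * y powr (- p))" if y: "0 < y" for y
  proof (cases "y < 1")
    case False
    have e: "{x::real. y < 1 / (1 + \<bar>x\<bar>)} = {}"
    proof -
      have le1: "1 / (1 + \<bar>x\<bar>) \<le> 1" for x :: real by (simp add: divide_le_eq)
      show ?thesis using False by (auto simp: not_less intro: order_trans[OF le1])
    qed
    show ?thesis unfolding e by simp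
  next
    case True
    \<comment> \<open>The factor 4 stands in for pi in the lower bound 1 / (pi |x|).\<close>
    have sub: "{x. y < 1 / (1 + \<bar>x\<bar>)} \<subseteq> {-2..2} \<union> {x. y / 4 < \<bar>hilbert ?f x\<bar>}"
    proof
      fix x assume x: "x \<in> {x. y < 1 / (1 + \<bar>x\<bar>)}"
      show "x \<in> {-2..2} \<union> {x. y / 4 < \<bar>hilbert ?f x\<bar>}"
      proof (cases "2 < \<bar>x\<bar>")
        case big: True
        have "y < 1 / \<bar>x\<bar>" using x big y by (auto simp: field_simps)
        then have "y / pi < 1 / \<bar>x\<bar> / pi" by (intro divide_strict_right_mono) auto
        moreover have "y / 4 \<le> y / pi" using y pi_less_4 by (intro divide_left_mono) auto
        ultimately have "y / 4 < 1 / \<bar>x\<bar> / pi" by linarith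
        also have "\<dots> = 1 / (pi * \<bar>x\<bar>)" by (simp add: mult.commute)
        finally have "y / 4 < 1 / (pi * \<bar>x\<bar>)" .
        then show ?thesis using abs_hilbert_indicator_ge[OF big] by auto
      qed auto
    qed
    have "V {x. y < 1 / (1 + \<bar>x\<bar>)} \<le> V ({-2..2} \<union> {x. y / 4 < \<bar>hilbert ?f x\<bar>})"
      by (rule cap_mono[OF sub]) (intro sets.Un sets_Collect_less_abs Hm, simp)
    also have "\<dots> \<le> ennreal K * (V {-2..2} + V {x. y / 4 < \<bar>hilbert ?f x\<bar>})"
      by (rule K(2)) (simp, intro sets_Collect_less_abs Hm)
    also have "\<dots> \<le> ennreal K * (ennreal (v * y powr (- p)) + ennreal (C0 * (y / 4) powr (- p)) * N p ?f)"
    proof (intro mult_left_mono add_mono)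
      have "1 \<le> y powr (- p)" using y True p_pos by (intro one_le_powr_minus) auto
      then have "v * 1 \<le> v * y powr (- p)" using v by (intro mult_left_mono)
      then show "V {-2..2} \<le> ennreal (v * y powr (- p))" using v by (auto intro: ennreal_leI)
      show "V {x. y / 4 < \<bar>hilbert ?f x\<bar>} \<le> ennreal (C0 * (y / 4) powr (- p)) * N p ?f"
        using f Nf y by (intro C0) auto
    qed auto
    also have "\<dots> = ennreal (K * (v + C0 * 4 powr p * v1) * y powr (- p))"
      using K C0 v v1 unfolding Nf powr_divide_minus[OF y, of 4, simplified]
      by (simp add: ennreal_mult[symmetric] ennreal_plus[symmetric] algebra_simps del: ennreal_plus)
    also have "\<dots> \<le> ennreal (D * y powr (- p))" unfolding D_def by (intro ennreal_leI mult_right_mono) auto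
    finally show ?thesis .
  qed
  moreover have "0 < D" unfolding D_def using K C0 v v1 by (intro add_nonneg_pos mult_nonneg_nonneg add_nonneg_nonneg) auto
  ultimately show thesis by (rule that[rotated])
qed

text \<open>Quadratic decay halves the exponent: V(|h| > y) is at most a multiple of y^(-p/2), and
  y^(q - 1 - p/2) is integrable at 0 for q >= p. Linear decay would only give the bound y^(-p),
  whose integral diverges at q = p.\<close>

lemma lint_decay_finite:
  assumes h[measurable]: "h \<in> borel_measurable lebesgue" and b: "\<And>x. \<bar>h x\<bar> \<le> c / (1 + \<bar>x\<bar>)\<^sup>2" and q: "p \<le> q"
  shows "N q h < \<infinity>"
proof -
  obtain C where C: "0 < C" "\<And>y. 0 < y \<Longrightarrow> V {x. y < 1 / (1 + \<bar>x\<bar>)} \<le> ennreal (C * y powr (- p))"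
    using cap_decay by blast
  define d where "d = max c 1"
  have d: "0 < d" by (simp add: d_def)
  have b: "\<bar>h x\<bar> \<le> d / (1 + \<bar>x\<bar>)\<^sup>2" for x
    using b[of x] by (rule order_trans) (auto simp: d_def intro!: divide_right_mono)
  have q0: "0 < q" using q p_pos by simp
  have le: "ennreal (q * y powr (q - 1)) * V {x. y < \<bar>h x\<bar>} * indicator {0<..} y
     \<le> ennreal (q * C * d powr (p/2)) * (ennreal (y powr ((q - p/2) - 1)) * indicator {0<..<d} y)" for y
  proof (cases "0 < y \<and> y < d")
    case True
    have "{x. y < \<bar>h x\<bar>} \<subseteq> {x. sqrt (y / d) < 1 / (1 + \<bar>x\<bar>)}"
    proof
      fix x assume "x \<in> {x. y < \<bar>h x\<bar>}"
      then have "y < d / (1 + \<bar>x\<bar>)\<^sup>2" using b[of x] by auto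
      then have "y / d < 1 / (1 + \<bar>x\<bar>)\<^sup>2" using d by (simp add: field_simps)
      then have "y / d < (1 / (1 + \<bar>x\<bar>))\<^sup>2" by (simp add: power_divide)
      then have "sqrt (y / d) < 1 / (1 + \<bar>x\<bar>)" by (intro real_less_lsqrt) (use True d in auto)
      then show "x \<in> {x. sqrt (y / d) < 1 / (1 + \<bar>x\<bar>)}" by simp
    qed
    moreover have "{x::real. s < 1 / (1 + \<bar>x\<bar>)} \<in> sets lebesgue" for s
    proof -
      have "{x::real. s < 1 / (1 + \<bar>x\<bar>)} \<in> sets borel" by measurable
      then show ?thesis by simp
    qed
    ultimately have "V {x. y < \<bar>h x\<bar>} \<le> V {x. sqrt (y / d) < 1 / (1 + \<bar>x\<bar>)}" by (rule cap_mono)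
    also have "\<dots> \<le> ennreal (C * sqrt (y / d) powr (- p))" using True d by (intro C) auto
    also have "sqrt (y / d) powr (- p) = d powr (p/2) * y powr (- p / 2)"
    proof -
      have "sqrt (y / d) powr (- p) = (y / d) powr (- p / 2)"
        using True d by (simp add: powr_half_sqrt[symmetric] powr_powr)
      also have "\<dots> = d powr (p/2) * y powr (- p / 2)"
        using True d powr_divide_minus[of y d "p / 2"] by simp
      finally show ?thesis .
    qed
    finally have "ennreal (q * y powr (q - 1)) * V {x. y < \<bar>h x\<bar>} \<le> ennreal (q * y powr (q - 1)) * ennreal (C * (d powr (p/2) * y powr (- p / 2)))"
      by (rule mult_left_mono) simp
    also have "\<dots> = ennreal (q * C * d powr (p/2)) * ennreal (y powr ((q - p/2) - 1))"
    proof -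
      have "y powr (q - 1) * y powr (- p / 2) = y powr ((q - p/2) - 1)"
        using True by (simp add: powr_add[symmetric] algebra_simps)
      then show ?thesis using q0 C(1) by (simp add: ennreal_mult[symmetric] mult_ac)
    qed
    finally show ?thesis using True by simp
  next
    case False
    have "d / (1 + \<bar>x\<bar>)\<^sup>2 \<le> d / 1" for x
      using d by (intro divide_left_mono) (auto simp: one_le_power intro!: mult_pos_pos)
    then have "d / (1 + \<bar>x\<bar>)\<^sup>2 \<le> d" for x by simp
    then have "\<bar>h x\<bar> \<le> d" for x using b[of x] order_trans by blast
    then have "{x. y < \<bar>h x\<bar>} = {}" if "d \<le> y" using that order_trans by (auto simp: not_less)
    then show ?thesis using False by (auto simp: indicator_def)
  qed
  have "N q h \<le> (\<integral>\<^sup>+y. ennreal (q * C * d powr (p/2)) * (ennreal (y powr ((q - p/2) - 1)) * indicator {0<..<d} y) \<partial>lborel)"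
    unfolding lint_eq[OF h q0] by (rule nn_integral_mono) (rule le)
  also have "\<dots> = ennreal (q * C * d powr (p/2)) * ennreal (d powr (q - p/2) / (q - p/2))"
    using q p_pos d by (subst nn_integral_cmult) (auto simp: nn_integral_powr_lessThan)
  also have "\<dots> < \<infinity>" by (simp add: ennreal_mult_less_top)
  finally show ?thesis .
qed


lemma rat_eval_lebesgue[measurable]:
  "(\<lambda>x. Re (rat_eval Q x)) \<in> borel_measurable lebesgue" "(\<lambda>x. Im (rat_eval Q x)) \<in> borel_measurable lebesgue"
proof -
  have "(\<lambda>x. Re (rat_eval Q x)) \<in> borel_measurable borel" "(\<lambda>x. Im (rat_eval Q x)) \<in> borel_measurable borel"
    by measurable
  then show "(\<lambda>x. Re (rat_eval Q x)) \<in> borel_measurable lebesgue" "(\<lambda>x. Im (rat_eval Q x)) \<in> borel_measurable lebesgue"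
    by (auto intro: measurable_completion)
qed

text \<open>Each factor decays like 1 / |x|, so the product has the quadratic decay that guarantees
  membership in \<Lambda>^p. This admits 2 f g as a test function for weak type p.\<close>

lemma lint_cotlar_product_finite:
  assumes "poly Q 0 = 0"
  shows "N p (\<lambda>x. 2 * Re (rat_eval Q x) * Im (rat_eval Q x)) < \<infinity>"
proof -
  obtain C where C: "0 < C" "\<And>x. norm (rat_eval Q x) \<le> C / (1 + \<bar>x\<bar>)"
    using rat_eval_bound[OF assms] by blast
  have "\<bar>2 * Re (rat_eval Q x) * Im (rat_eval Q x)\<bar> \<le> (2 * C\<^sup>2) / (1 + \<bar>x\<bar>)\<^sup>2" for x
  proof -
    have "\<bar>Re (rat_eval Q x)\<bar> * \<bar>Im (rat_eval Q x)\<bar> \<le> (C / (1 + \<bar>x\<bar>)) * (C / (1 + \<bar>x\<bar>))"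
      by (intro mult_mono order_trans[OF abs_Re_le_cmod C(2)] order_trans[OF abs_Im_le_cmod C(2)]) (use C in auto)
    then show ?thesis by (simp add: abs_mult power2_eq_square)
  qed
  then show ?thesis by (intro lint_decay_finite) auto
qed

text \<open>The finiteness on which absorption depends; \<open>b\<close> may vary with
  \<open>Q\<close>. Linear decay gives a bound of order y^(-p), and since the level sets are empty
  for y >= C, a further factor (y / C)^(-p) >= 1 may be put in.\<close>

lemma cap_rat_eval_Im_finite:
  assumes "poly Q 0 = 0"
  obtains b where "0 \<le> b" "\<And>y. 0 < y \<Longrightarrow> V {x. y < \<bar>Im (rat_eval Q x)\<bar>} \<le> ennreal (b * y powr (- (2 * p)))"
proof -
  obtain C where C: "0 < C" "\<And>x. norm (rat_eval Q x) \<le> C / (1 + \<bar>x\<bar>)"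
    using rat_eval_bound[OF assms] by blast
  obtain D where D: "0 < D" "\<And>y. 0 < y \<Longrightarrow> V {x. y < 1 / (1 + \<bar>x\<bar>)} \<le> ennreal (D * y powr (- p))"
    using cap_decay by blast
  have g: "\<bar>Im (rat_eval Q x)\<bar> \<le> C / (1 + \<bar>x\<bar>)" for x
    using order_trans[OF abs_Im_le_cmod C(2)] .
  have "V {x. y < \<bar>Im (rat_eval Q x)\<bar>} \<le> ennreal (D * C powr (2 * p) * y powr (- (2 * p)))" if y: "0 < y" for y
  proof (cases "y < C")
    case True
    have "{x::real. s < 1 / (1 + \<bar>x\<bar>)} \<in> sets lebesgue" for s
    proof -
      have "{x::real. s < 1 / (1 + \<bar>x\<bar>)} \<in> sets borel" by measurable
      then show ?thesis by simp
    qed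
    moreover have "{x. y < \<bar>Im (rat_eval Q x)\<bar>} \<subseteq> {x. y / C < 1 / (1 + \<bar>x\<bar>)}"
    proof
      fix x assume "x \<in> {x. y < \<bar>Im (rat_eval Q x)\<bar>}"
      then have "y < C / (1 + \<bar>x\<bar>)" using g[of x] by auto
      then show "x \<in> {x. y / C < 1 / (1 + \<bar>x\<bar>)}" using C(1) by (simp add: field_simps)
    qed
    ultimately have "V {x. y < \<bar>Im (rat_eval Q x)\<bar>} \<le> V {x. y / C < 1 / (1 + \<bar>x\<bar>)}" by (intro cap_mono)
    also have "\<dots> \<le> ennreal (D * (y / C) powr (- p))" using y C by (intro D) auto
    also have "\<dots> \<le> ennreal (D * C powr (2 * p) * y powr (- (2 * p)))"
    proof (rule ennreal_leI)
      have "1 \<le> (y / C) powr (- p)" using y True C p_pos by (intro one_le_powr_minus) auto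
      then have "(y / C) powr (- p) * 1 \<le> (y / C) powr (- p) * (y / C) powr (- p)" by (intro mult_left_mono) auto
      also have "\<dots> = C powr (2 * p) * y powr (- (2 * p))"
        unfolding powr_add[symmetric] using powr_divide_minus[of y C "2 * p"] y C by simp
      finally show "D * (y / C) powr (- p) \<le> D * C powr (2 * p) * y powr (- (2 * p))" using D(1) by simp
    qed
    finally show ?thesis .
  next
    case False
    have "\<bar>Im (rat_eval Q x)\<bar> \<le> y" for x
    proof -
      have "C / (1 + \<bar>x\<bar>) \<le> C / 1" using C by (intro divide_left_mono) auto
      then show ?thesis using g[of x] False by simp
    qed
    then have "{x. y < \<bar>Im (rat_eval Q x)\<bar>} = {}" by (auto simp: not_less)
    then show ?thesis by simp
  qed
  then show thesis using D(1) by (intro that[of "D * C powr (2 * p)"]) auto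
qed

end

lemma nn_integral_add3:
  assumes [measurable]: "f \<in> borel_measurable M" "g \<in> borel_measurable M" "h \<in> borel_measurable M"
  shows "(\<integral>\<^sup>+x. f x + (g x + h x) \<partial>M) = integral\<^sup>N M f + (integral\<^sup>N M g + integral\<^sup>N M h)"
  by (simp add: nn_integral_add)

lemma powr_solve:
  fixes c a :: real
  assumes "0 < c" "a \<noteq> 0"
  obtains Y where "0 < Y" "Y powr a = c"
  using assms by (intro that[of "c powr (1 / a)"]) (auto simp: powr_powr)

context hilbert_weak
begin

text \<open>The absorption step: \<open>b\<close> is any admissible constant, and Cotlar's identity improves it.\<close>

lemma cotlar_improve:
  assumes q: "p < q" "q < 2 * p"
  obtains A where "0 < A" "\<And>Q b. poly Q 0 = 0 \<Longrightarrow> (\<And>x. \<bar>Re (rat_eval Q x)\<bar> \<le> 1) \<Longrightarrow> 0 \<le> b \<Longrightarrow>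
     (\<And>y. 0 < y \<Longrightarrow> V {x. y < \<bar>Im (rat_eval Q x)\<bar>} \<le> ennreal (b * y powr (- (2 * p)))) \<Longrightarrow>
     (\<And>y. 0 < y \<Longrightarrow> ennreal (y powr (2 * p)) * V {x. y < \<bar>Im (rat_eval Q x)\<bar>} \<le> ennreal A * N q (\<lambda>x. Re (rat_eval Q x)) + ennreal (b / 2))"
proof -
  obtain C0 where C0: "0 < C0" "\<And>f y. f \<in> borel_measurable lebesgue \<Longrightarrow> N p f < \<infinity> \<Longrightarrow> 0 < y \<Longrightarrow>
     V {x. y < \<bar>hilbert f x\<bar>} \<le> ennreal (C0 * y powr (- p)) * N p f"
    using weak_bound by blast
  obtain K where K: "1 \<le> K" "\<And>A B. A \<in> sets lebesgue \<Longrightarrow> B \<in> sets lebesgue \<Longrightarrow> V (A \<union> B) \<le> ennreal K * (V A + V B)"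
    using cap_quasi_subadditive by blast
  \<comment> \<open>The product is split at |f| of size s^\<alpha> and |g| of size s^(1 - \<alpha>).
    The choice \<alpha> = p / q makes the f-part an integral of order p / \<alpha> = q; the g-part
    leaves s^(\<beta> - 1), integrable at 0 because q < 2 p makes \<beta> positive.\<close>
  define \<alpha> where "\<alpha> = p / q"
  define \<beta> where "\<beta> = p * (2 * \<alpha> - 1)"
  have q0: "0 < q" using q p_pos by simp
  have al: "0 < \<alpha>" "1/2 < \<alpha>" "p / \<alpha> = q" using q p_pos by (auto simp: \<alpha>_def field_simps)
  have be: "0 < \<beta>" using al p_pos by (simp add: \<beta>_def)
  \<comment> \<open>The factor in front of \<open>N p h\<close> once the weak type bound at level
    y^2 / 2, including the constant of quasi-subadditivity, is multiplied by y^(2 p).\<close>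
  define M where "M = K * C0 * 2 powr p"
  have M: "0 < M" using K C0 by (simp add: M_def)
  \<comment> \<open>\<open>Y\<close> is the height beyond which only |f| <= 1 is used: the tail s >=
    Y costs b / (4 M). Then \<open>D\<close>, which shifts weight from f to g in the splitting, is
    taken so large that the g-part below \<open>Y\<close> costs another b / (4 M). After
    multiplication by \<open>M\<close> the total is b / 2.\<close>
  obtain Y where Y: "0 < Y" "Y powr (- p) = 1 / (4 * M * 2 powr (2 * p))"
    using powr_solve[of "1 / (4 * M * 2 powr (2 * p))" "- p"] M p_pos by auto
  obtain D where D: "0 < D" "D powr (- (2 * p)) = \<beta> / (4 * M * p * K * 2 powr (2 * p) * Y powr \<beta>)"
    using powr_solve[of "\<beta> / (4 * M * p * K * 2 powr (2 * p) * Y powr \<beta>)" "- (2 * p)"] M p_pos K Y(1) be by auto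
  define A where "A = K * 4 powr p + M * (K * D powr q)"
  have A: "0 < A" unfolding A_def using K M D by (intro add_pos_pos mult_pos_pos) auto
  have "ennreal (y powr (2 * p)) * V {x. y < \<bar>Im (rat_eval Q x)\<bar>} \<le> ennreal A * N q (\<lambda>x. Re (rat_eval Q x)) + ennreal (b / 2)"
    if Q: "poly Q 0 = 0" and f1: "\<And>x. \<bar>Re (rat_eval Q x)\<bar> \<le> 1" and b0: "0 \<le> b"
      and b: "\<And>y. 0 < y \<Longrightarrow> V {x. y < \<bar>Im (rat_eval Q x)\<bar>} \<le> ennreal (b * y powr (- (2 * p)))" and y: "0 < y" for Q b y
  proof -
    define f where "f = (\<lambda>x. Re (rat_eval Q x))"
    define g where "g = (\<lambda>x. Im (rat_eval Q x))"
    define h where "h = (\<lambda>x. 2 * f x * g x)"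
    have fm: "f \<in> borel_measurable lebesgue" and gm: "g \<in> borel_measurable lebesgue"
      by (auto simp: f_def g_def)
    have hm: "h \<in> borel_measurable lebesgue" unfolding h_def using fm gm by measurable
    have Nh: "N p h < \<infinity>" unfolding h_def f_def g_def by (rule lint_cotlar_product_finite[OF Q])
    have Hh: "hilbert h x = (g x)\<^sup>2 - (f x)\<^sup>2" for x
      unfolding h_def f_def g_def by (rule hilbert_cotlar(2)[OF Q])
    have Hm: "hilbert h \<in> borel_measurable lebesgue" by (rule weak_measurable[OF hm Nh])
    have b: "V {x. s < \<bar>g x\<bar>} \<le> ennreal (b * s powr (- (2 * p)))" if "0 < s" for s
      using b[OF that] by (simp add: g_def)
    have f1: "\<bar>f x\<bar> \<le> 1" for x using f1 by (simp add: f_def)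
    \<comment> \<open>If |g| > y and |f| <= y / 2, then H h = g^2 - f^2 > 3 y^2 / 4, which exceeds
      y^2 / 2.\<close>
    have "{x. y < \<bar>g x\<bar>} \<subseteq> {x. y / 2 < \<bar>f x\<bar>} \<union> {x. y\<^sup>2 / 2 < \<bar>hilbert h x\<bar>}"
    proof
      fix x assume x: "x \<in> {x. y < \<bar>g x\<bar>}"
      show "x \<in> {x. y / 2 < \<bar>f x\<bar>} \<union> {x. y\<^sup>2 / 2 < \<bar>hilbert h x\<bar>}"
      proof (cases "y / 2 < \<bar>f x\<bar>")
        case False
        then have "(f x)\<^sup>2 \<le> (y / 2)\<^sup>2" using y by (intro abs_le_square_iff[THEN iffD1]) auto
        moreover have "y\<^sup>2 < (g x)\<^sup>2" using x y power_strict_mono[of y "\<bar>g x\<bar>" 2] by simp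
        moreover have "(y / 2)\<^sup>2 = y\<^sup>2 / 4" by (simp add: power_divide)
        ultimately have "y\<^sup>2 / 2 < hilbert h x" using zero_le_power2[of y] unfolding Hh by linarith
        then show ?thesis by auto
      qed auto
    qed
    then have "V {x. y < \<bar>g x\<bar>} \<le> V ({x. y / 2 < \<bar>f x\<bar>} \<union> {x. y\<^sup>2 / 2 < \<bar>hilbert h x\<bar>})"
      by (rule cap_mono) (intro sets.Un sets_Collect_less_abs fm Hm)
    also have "\<dots> \<le> ennreal K * (V {x. y / 2 < \<bar>f x\<bar>} + V {x. y\<^sup>2 / 2 < \<bar>hilbert h x\<bar>})"
      by (intro K(2) sets_Collect_less_abs fm Hm)
    also have "\<dots> \<le> ennreal K * (V {x. y / 2 < \<bar>f x\<bar>} + ennreal (C0 * (y\<^sup>2 / 2) powr (- p)) * N p h)"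
      using hm Nh y by (intro mult_left_mono add_left_mono C0(2)) auto
    finally have "ennreal (y powr (2 * p)) * V {x. y < \<bar>g x\<bar>} \<le> ennreal (y powr (2 * p)) * (ennreal K * (V {x. y / 2 < \<bar>f x\<bar>} + ennreal (C0 * (y\<^sup>2 / 2) powr (- p)) * N p h))"
      by (rule mult_left_mono) simp
    also have "\<dots> = ennreal K * (ennreal (y powr (2 * p)) * V {x. y / 2 < \<bar>f x\<bar>}) + ennreal M * N p h"
    proof -
      have "(y\<^sup>2 / 2) powr (- p) = 2 powr p * y powr (- (2 * p))"
      proof -
        have e: "y\<^sup>2 = y powr 2" using y by simp
        have "0 < y powr 2" "0 < (2::real)" using y by auto
        from powr_divide_minus[OF this, of p] show ?thesis unfolding e powr_powr mult_minus_right .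
      qed
      then have "y powr (2 * p) * (K * (C0 * (y\<^sup>2 / 2) powr (- p))) = M"
        using y by (simp add: M_def powr_minus field_simps)
      then have "ennreal (y powr (2 * p)) * (ennreal K * ennreal (C0 * (y\<^sup>2 / 2) powr (- p))) = ennreal M"
        using K C0 by (simp add: ennreal_mult[symmetric])
      then have "ennreal (y powr (2 * p)) * (ennreal K * (ennreal (C0 * (y\<^sup>2 / 2) powr (- p)) * N p h)) = ennreal M * N p h"
        by (simp only: mult.assoc[symmetric])
      then show ?thesis by (simp add: distrib_left mult_ac)
    qed
    also have "\<dots> \<le> ennreal K * (ennreal (4 powr p) * N q f) + ennreal M * (ennreal (K * D powr q) * N q f + ennreal (b / (2 * M)))"
    proof (intro add_mono mult_left_mono)
      show "ennreal (y powr (2 * p)) * V {x. y / 2 < \<bar>f x\<bar>} \<le> ennreal (4 powr p) * N q f"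
      \<comment> \<open>Here the exponents 2 p and q meet: y / 2 < 1 and q < 2 p give (y / 2)^(2 p)
        <= (y / 2)^q, and for y >= 2 the level set is empty because |f| <= 1.\<close>
      proof (cases "y < 2")
        case True
        have "y powr (2 * p) = 4 powr p * (y / 2) powr (2 * p)"
        proof -
          have "y powr (2 * p) = (2 * (y / 2)) powr (2 * p)" by simp
          also have "\<dots> = 2 powr (2 * p) * (y / 2) powr (2 * p)" using y by (subst powr_mult) auto
          also have "2 powr (2 * p) = (2 powr 2) powr p" by (simp only: powr_powr)
          finally show ?thesis by simp
        qed
        also have "\<dots> \<le> 4 powr p * (y / 2) powr q"
          using True y q by (intro mult_left_mono powr_mono') auto
        finally have "ennreal (y powr (2 * p)) * V {x. y / 2 < \<bar>f x\<bar>} \<le> ennreal (4 powr p * (y / 2) powr q) * V {x. y / 2 < \<bar>f x\<bar>}"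
          by (intro mult_right_mono ennreal_leI) auto
        also have "\<dots> = ennreal (4 powr p) * (ennreal ((y / 2) powr q) * V {x. y / 2 < \<bar>f x\<bar>})"
          by (simp add: ennreal_mult mult.assoc)
        also have "\<dots> \<le> ennreal (4 powr p) * N q f"
          using y fm q0 by (intro mult_left_mono lint_chebyshev) auto
        finally show ?thesis .
      next
        case False
        have "\<bar>f x\<bar> \<le> y / 2" for x using f1[of x] False by linarith
        then have "{x. y / 2 < \<bar>f x\<bar>} = {}" by (auto simp: not_less)
        then show ?thesis by simp
      qed
      show "N p h \<le> ennreal (K * D powr q) * N q f + ennreal (b / (2 * M))"
      proof -
        let ?i1 = "\<lambda>y. ennreal (y powr (- p - 1)) * indicator {Y..} y"
        let ?i2 = "\<lambda>y. ennreal (p * y powr (p - 1)) * V {x. y powr \<alpha> / D < \<bar>f x\<bar>} * indicator {0<..} y"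
        let ?i3 = "\<lambda>y. ennreal (y powr (\<beta> - 1)) * indicator {0<..<Y} y"
        let ?c1 = "p * b * 2 powr (2 * p)" and ?c3 = "p * K * b * 2 powr (2 * p) * D powr (- (2 * p))"
        have pt: "ennreal (p * s powr (p - 1)) * V {x. s < \<bar>h x\<bar>} * indicator {0<..} s \<le> ennreal ?c1 * ?i1 s + (ennreal K * ?i2 s + ennreal ?c3 * ?i3 s)" for s
        proof -
          consider "s \<le> 0" | "Y \<le> s" | "0 < s" "s < Y" by linarith
          then show ?thesis
          proof cases
            case 1
            then show ?thesis by simp
          next
            case 2
            then have s: "0 < s" using Y(1) by simp
            have "{x. s < \<bar>h x\<bar>} \<subseteq> {x. s / 2 < \<bar>g x\<bar>}"
            proof
              fix x assume "x \<in> {x. s < \<bar>h x\<bar>}"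
              then have "s < 2 * (\<bar>f x\<bar> * \<bar>g x\<bar>)" by (simp add: h_def abs_mult)
              moreover have "\<bar>f x\<bar> * \<bar>g x\<bar> \<le> 1 * \<bar>g x\<bar>" by (intro mult_right_mono f1) auto
              ultimately show "x \<in> {x. s / 2 < \<bar>g x\<bar>}" by simp
            qed
            then have "V {x. s < \<bar>h x\<bar>} \<le> V {x. s / 2 < \<bar>g x\<bar>}" by (rule cap_mono) (intro sets_Collect_less_abs gm)
            also have "\<dots> \<le> ennreal (b * (s / 2) powr (- (2 * p)))" using s by (intro b) auto
            finally have "ennreal (p * s powr (p - 1)) * V {x. s < \<bar>h x\<bar>} \<le> ennreal (p * s powr (p - 1)) * ennreal (b * (s / 2) powr (- (2 * p)))"
              by (rule mult_left_mono) simp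
            also have "\<dots> = ennreal (?c1 * s powr (- p - 1))"
            proof -
              have "s powr (p - 1) * (s / 2) powr (- (2 * p)) = 2 powr (2 * p) * (s powr (p - 1) * s powr (- (2 * p)))"
                unfolding powr_divide_minus[OF s, of 2, simplified] by (simp only: mult_ac)
              also have "s powr (p - 1) * s powr (- (2 * p)) = s powr (- p - 1)" by (simp add: powr_add[symmetric])
              finally have "(p * s powr (p - 1)) * (b * (s / 2) powr (- (2 * p))) = ?c1 * s powr (- p - 1)" by (simp add: mult_ac)
              then show ?thesis using p_pos b0 by (simp add: ennreal_mult[symmetric])
            qed
            also have "\<dots> = ennreal ?c1 * ?i1 s" using 2 p_pos b0 by (simp add: ennreal_mult)
            finally show ?thesis using s by (simp add: add_increasing2)
          next
            case 3
            \<comment> \<open>The two thresholds multiply to s / 2, so |h| = 2 |f g| > s forces one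
              of them to be exceeded.\<close>
            have "{x. s < \<bar>h x\<bar>} \<subseteq> {x. s powr \<alpha> / D < \<bar>f x\<bar>} \<union> {x. D * s powr (1 - \<alpha>) / 2 < \<bar>g x\<bar>}"
            proof
              fix x assume "x \<in> {x. s < \<bar>h x\<bar>}"
              then have x: "s < 2 * (\<bar>f x\<bar> * \<bar>g x\<bar>)" by (simp add: h_def abs_mult)
              show "x \<in> {x. s powr \<alpha> / D < \<bar>f x\<bar>} \<union> {x. D * s powr (1 - \<alpha>) / 2 < \<bar>g x\<bar>}"
              proof (rule ccontr)
                assume "\<not> ?thesis"
                then have "\<bar>f x\<bar> * \<bar>g x\<bar> \<le> (s powr \<alpha> / D) * (D * s powr (1 - \<alpha>) / 2)"
                  using D by (intro mult_mono) (auto simp: not_less)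
                also have "\<dots> = s powr \<alpha> * s powr (1 - \<alpha>) / 2" using D by simp
                also have "s powr \<alpha> * s powr (1 - \<alpha>) = s" using 3 by (simp add: powr_add[symmetric])
                finally show False using x by simp
              qed
            qed
            then have "V {x. s < \<bar>h x\<bar>} \<le> V ({x. s powr \<alpha> / D < \<bar>f x\<bar>} \<union> {x. D * s powr (1 - \<alpha>) / 2 < \<bar>g x\<bar>})"
              by (rule cap_mono) (intro sets.Un sets_Collect_less_abs fm gm)
            also have "\<dots> \<le> ennreal K * (V {x. s powr \<alpha> / D < \<bar>f x\<bar>} + V {x. D * s powr (1 - \<alpha>) / 2 < \<bar>g x\<bar>})"
              by (intro K(2) sets_Collect_less_abs fm gm)
            also have "\<dots> \<le> ennreal K * (V {x. s powr \<alpha> / D < \<bar>f x\<bar>} + ennreal (b * (D * s powr (1 - \<alpha>) / 2) powr (- (2 * p))))"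
              using D 3 by (intro mult_left_mono add_left_mono b) auto
            finally have "ennreal (p * s powr (p - 1)) * V {x. s < \<bar>h x\<bar>} \<le> ennreal (p * s powr (p - 1)) *
               (ennreal K * (V {x. s powr \<alpha> / D < \<bar>f x\<bar>} + ennreal (b * (D * s powr (1 - \<alpha>) / 2) powr (- (2 * p)))))"
              by (rule mult_left_mono) simp
            also have "\<dots> = ennreal K * ?i2 s + ennreal (p * s powr (p - 1)) * (ennreal K * ennreal (b * (D * s powr (1 - \<alpha>) / 2) powr (- (2 * p))))"
              using 3 by (simp add: distrib_left mult_ac)
            also have "ennreal (p * s powr (p - 1)) * (ennreal K * ennreal (b * (D * s powr (1 - \<alpha>) / 2) powr (- (2 * p)))) = ennreal (?c3 * s powr (\<beta> - 1))"
            proof -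
              have "(D * s powr (1 - \<alpha>) / 2) powr (- (2 * p)) = D powr (- (2 * p)) * (s powr (1 - \<alpha>)) powr (- (2 * p)) * 2 powr (2 * p)"
              proof -
                have "0 < D * s powr (1 - \<alpha>)" using D 3 by simp
                from powr_divide_minus[OF this, of 2 "2 * p"] show ?thesis using D 3 by (simp add: powr_mult)
              qed
              also have "(s powr (1 - \<alpha>)) powr (- (2 * p)) = s powr (- (2 * p) * (1 - \<alpha>))" by (simp add: powr_powr mult.commute)
              finally have "s powr (p - 1) * (D * s powr (1 - \<alpha>) / 2) powr (- (2 * p)) = D powr (- (2 * p)) * 2 powr (2 * p) * (s powr (p - 1) * s powr (- (2 * p) * (1 - \<alpha>)))"
                by (simp only: mult_ac)
              also have "s powr (p - 1) * s powr (- (2 * p) * (1 - \<alpha>)) = s powr (\<beta> - 1)"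
                unfolding powr_add[symmetric] \<beta>_def by (rule arg_cong[where f="\<lambda>e. s powr e"]) (simp add: algebra_simps)
              finally have "(p * s powr (p - 1)) * (K * (b * (D * s powr (1 - \<alpha>) / 2) powr (- (2 * p)))) = ?c3 * s powr (\<beta> - 1)"
                by (simp add: mult_ac)
              then show ?thesis using p_pos b0 K by (simp add: ennreal_mult[symmetric])
            qed
            also have "ennreal (?c3 * s powr (\<beta> - 1)) = ennreal ?c3 * ?i3 s" using 3 p_pos b0 K by (simp add: ennreal_mult)
            finally show ?thesis using 3 by (simp add: add_increasing)
          qed
        qed
        have [measurable]: "(\<lambda>y. V {x. y powr \<alpha> / D < \<bar>f x\<bar>}) \<in> borel_measurable borel"
          using measurable_compose[OF _ cap_level_measurable[OF fm], of "\<lambda>y. y powr \<alpha> / D" borel] by measurable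
        have "N p h \<le> (\<integral>\<^sup>+s. ennreal ?c1 * ?i1 s + (ennreal K * ?i2 s + ennreal ?c3 * ?i3 s) \<partial>lborel)"
          unfolding lint_eq[OF hm p_pos] by (rule nn_integral_mono) (rule pt)
        also have "\<dots> = (\<integral>\<^sup>+s. ennreal ?c1 * ?i1 s \<partial>lborel) + ((\<integral>\<^sup>+s. ennreal K * ?i2 s \<partial>lborel) + (\<integral>\<^sup>+s. ennreal ?c3 * ?i3 s \<partial>lborel))"
          by (rule nn_integral_add3) measurable
        also have "(\<integral>\<^sup>+s. ennreal ?c1 * ?i1 s \<partial>lborel) = ennreal ?c1 * ennreal (Y powr (- p) / p)"
          using p_pos Y by (subst nn_integral_cmult) (auto simp: nn_integral_powr_atLeast)
        also have "(\<integral>\<^sup>+s. ennreal K * ?i2 s \<partial>lborel) = ennreal K * (ennreal (D powr q) * N q f)"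
          using layer_cake_powr[OF fm p_pos al(1) D(1)] al by (subst nn_integral_cmult) auto
        also have "(\<integral>\<^sup>+s. ennreal ?c3 * ?i3 s \<partial>lborel) = ennreal ?c3 * ennreal (Y powr \<beta> / \<beta>)"
          using be Y by (subst nn_integral_cmult) (auto simp: nn_integral_powr_lessThan)
        also have "ennreal ?c1 * ennreal (Y powr (- p) / p) = ennreal (b / (4 * M))"
        proof -
          have "?c1 * (Y powr (- p) / p) = b / (4 * M)" unfolding Y(2) using p_pos M by (simp add: field_simps)
          then show ?thesis using p_pos b0 by (simp add: ennreal_mult[symmetric])
        qed
        also have "ennreal ?c3 * ennreal (Y powr \<beta> / \<beta>) = ennreal (b / (4 * M))"
        proof -
          have "?c3 * (Y powr \<beta> / \<beta>) = b / (4 * M)" unfolding D(2) using p_pos M K be Y by (simp add: field_simps)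
          then show ?thesis using p_pos b0 K be by (simp add: ennreal_mult[symmetric])
        qed
        also have "ennreal (b / (4 * M)) + (ennreal K * (ennreal (D powr q) * N q f) + ennreal (b / (4 * M)))
           = ennreal (K * D powr q) * N q f + (ennreal (b / (4 * M)) + ennreal (b / (4 * M)))"
          using K by (simp add: ennreal_mult mult.assoc add_ac)
        also have "ennreal (b / (4 * M)) + ennreal (b / (4 * M)) = ennreal (b / (2 * M))"
          using b0 M by (simp add: ennreal_plus[symmetric] field_simps del: ennreal_plus)
        finally show ?thesis .
      qed
    qed auto
    also have "\<dots> = ennreal A * N q f + ennreal (b / 2)"
    proof -
      have "ennreal M * ennreal (b / (2 * M)) = ennreal (b / 2)"
        using M b0 by (simp add: ennreal_mult[symmetric])
      moreover have "ennreal A * N q f = ennreal K * (ennreal (4 powr p) * N q f) + ennreal M * (ennreal (K * D powr q) * N q f)"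
        unfolding A_def using K M by (simp add: ennreal_mult distrib_right mult.assoc)
      ultimately show ?thesis by (simp add: distrib_left add.assoc)
    qed
    finally show ?thesis by (simp add: f_def g_def)
  qed
  with A show thesis by (rule that)
qed

end

section \<open>From rational functions to bounded functions of compact support\<close>

context hilbert_weak
begin

text \<open>\<open>B\<close> is the least admissible constant in \<open>cotlar_improve\<close> and
  is finite, so it may be fed back into that estimate. The resulting \<open>C\<close> depends
  neither on \<open>Q\<close> nor on the qualitative bound \<open>b0\<close>.\<close>

lemma cotlar_weak:
  assumes q: "p < q" "q < 2 * p"
  obtains C where "0 < C" "\<And>Q y. poly Q 0 = 0 \<Longrightarrow> (\<And>x. \<bar>Re (rat_eval Q x)\<bar> \<le> 1) \<Longrightarrow> 0 < y \<Longrightarrow>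
     V {x. y < \<bar>Im (rat_eval Q x)\<bar>} \<le> ennreal (C * y powr (- (2 * p))) * N q (\<lambda>x. Re (rat_eval Q x))"
proof -
  obtain A where A: "0 < A" "\<And>Q b y. poly Q 0 = 0 \<Longrightarrow> (\<And>x. \<bar>Re (rat_eval Q x)\<bar> \<le> 1) \<Longrightarrow> 0 \<le> b \<Longrightarrow>
     (\<And>y. 0 < y \<Longrightarrow> V {x. y < \<bar>Im (rat_eval Q x)\<bar>} \<le> ennreal (b * y powr (- (2 * p)))) \<Longrightarrow> 0 < y \<Longrightarrow>
     ennreal (y powr (2 * p)) * V {x. y < \<bar>Im (rat_eval Q x)\<bar>} \<le> ennreal A * N q (\<lambda>x. Re (rat_eval Q x)) + ennreal (b / 2)"
    using cotlar_improve[OF q] by blast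
  have "V {x. y < \<bar>Im (rat_eval Q x)\<bar>} \<le> ennreal (2 * A * y powr (- (2 * p))) * N q (\<lambda>x. Re (rat_eval Q x))"
    if Q: "poly Q 0 = 0" "\<And>x. \<bar>Re (rat_eval Q x)\<bar> \<le> 1" and y: "0 < y" for Q y
  proof (cases "N q (\<lambda>x. Re (rat_eval Q x))")
    case top
    then show ?thesis using A(1) y by (simp add: ennreal_mult_top)
  next
    case (real n)
    let ?v = "\<lambda>y. V {x. y < \<bar>Im (rat_eval Q x)\<bar>}"
    define B where "B = (SUP y\<in>{0<..}. ennreal (y powr (2 * p)) * ?v y)"
    obtain b0 where b0: "0 \<le> b0" "\<And>y. 0 < y \<Longrightarrow> ?v y \<le> ennreal (b0 * y powr (- (2 * p)))"
      using cap_rat_eval_Im_finite[OF Q(1)] by blast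
    have cancel: "ennreal (s powr (2 * p)) * ennreal (c * s powr (- (2 * p))) = ennreal c" if "0 < s" "0 \<le> c" for s c
      using that by (simp add: ennreal_mult[symmetric] powr_minus)
    have "B \<le> ennreal b0" unfolding B_def
    proof (rule SUP_least)
      fix s :: real assume "s \<in> {0<..}"
      then have s: "0 < s" by simp
      have "ennreal (s powr (2 * p)) * ?v s \<le> ennreal (s powr (2 * p)) * ennreal (b0 * s powr (- (2 * p)))"
        by (intro mult_left_mono b0(2) s) simp
      then show "ennreal (s powr (2 * p)) * ?v s \<le> ennreal b0" using cancel[OF s b0(1)] by simp
    qed
    then obtain b where b: "B = ennreal b" "0 \<le> b" by (cases B) (auto simp: top_unique)
    have vb: "?v s \<le> ennreal (b * s powr (- (2 * p)))" if s: "0 < s" for s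
    proof -
      have "ennreal (s powr (2 * p)) * ?v s \<le> ennreal b" unfolding b(1)[symmetric] B_def using s by (intro SUP_upper) auto
      then have "ennreal (s powr (- (2 * p))) * (ennreal (s powr (2 * p)) * ?v s) \<le> ennreal (s powr (- (2 * p))) * ennreal b"
        by (rule mult_left_mono) simp
      moreover have "ennreal (s powr (- (2 * p))) * (ennreal (s powr (2 * p)) * ?v s) = ?v s"
        using s by (simp add: mult.assoc[symmetric] ennreal_mult[symmetric] powr_minus)
      moreover have "ennreal (s powr (- (2 * p))) * ennreal b = ennreal (b * s powr (- (2 * p)))"
        using b(2) by (simp add: ennreal_mult[symmetric] mult.commute)
      ultimately show ?thesis by simp
    qed
    have "B \<le> ennreal (A * n + b / 2)" unfolding B_def
    proof (rule SUP_least)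
      fix s :: real assume "s \<in> {0<..}"
      then have s: "0 < s" by simp
      show "ennreal (s powr (2 * p)) * ?v s \<le> ennreal (A * n + b / 2)"
        using A(2)[OF Q b(2) vb s] A(1) real b(2) by (simp add: ennreal_mult)
    qed
    then have "b \<le> A * n + b / 2"
      unfolding b(1) using b(2) A(1) real(1) by (subst (asm) ennreal_le_iff) auto
    then have "b \<le> 2 * A * n" by simp
    then have "ennreal (b * y powr (- (2 * p))) \<le> ennreal (2 * A * n * y powr (- (2 * p)))"
      by (intro ennreal_leI mult_right_mono) auto
    also have "\<dots> = ennreal (2 * A * y powr (- (2 * p))) * ennreal n"
      using A(1) real by (simp add: ennreal_mult[symmetric] mult_ac)
    finally show ?thesis using vb[OF y] real by (simp add: order_trans)
  qed
  then show thesis using A(1) by (intro that[of "2 * A"]) auto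
qed

lemma lint_add:
  assumes "0 < q"
  obtains C where "1 \<le> C" "\<And>f g. f \<in> borel_measurable lebesgue \<Longrightarrow> g \<in> borel_measurable lebesgue \<Longrightarrow> N q (\<lambda>x. f x + g x) \<le> ennreal C * (N q f + N q g)"
proof -
  obtain K where K: "1 \<le> K" "\<And>A B. A \<in> sets lebesgue \<Longrightarrow> B \<in> sets lebesgue \<Longrightarrow> V (A \<union> B) \<le> ennreal K * (V A + V B)"
    using cap_quasi_subadditive by blast
  have "N q (\<lambda>x. f x + g x) \<le> ennreal (K * 2 powr q) * (N q f + N q g)"
    if f: "f \<in> borel_measurable lebesgue" and g: "g \<in> borel_measurable lebesgue" for f g
  proof -
    let ?i = "\<lambda>f y. ennreal (q * y powr (q - 1)) * V {x. y / 2 < \<bar>f x\<bar>} * indicator {0<..} y"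
    have m: "?i f \<in> borel_measurable lborel" if "f \<in> borel_measurable lebesgue" for f
    proof -
      have [measurable]: "(\<lambda>y. V {x. y / 2 < \<bar>f x\<bar>}) \<in> borel_measurable borel"
        using measurable_compose[OF _ cap_level_measurable[OF that], of "\<lambda>y. y / 2" borel] by measurable
      show ?thesis by measurable
    qed
    have fg: "(\<lambda>x. f x + g x) \<in> borel_measurable lebesgue" using f g by measurable
    have pt: "V {x. y < \<bar>f x + g x\<bar>} \<le> ennreal K * (V {x. y / 2 < \<bar>f x\<bar>} + V {x. y / 2 < \<bar>g x\<bar>})" for y
    proof -
      have "{x. y < \<bar>f x + g x\<bar>} \<subseteq> {x. y / 2 < \<bar>f x\<bar>} \<union> {x. y / 2 < \<bar>g x\<bar>}" by auto
      then have "V {x. y < \<bar>f x + g x\<bar>} \<le> V ({x. y / 2 < \<bar>f x\<bar>} \<union> {x. y / 2 < \<bar>g x\<bar>})"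
        by (rule cap_mono) (intro sets.Un sets_Collect_less_abs f g)
      also have "\<dots> \<le> ennreal K * (V {x. y / 2 < \<bar>f x\<bar>} + V {x. y / 2 < \<bar>g x\<bar>})"
        by (intro K(2) sets_Collect_less_abs f g)
      finally show ?thesis .
    qed
    have "N q (\<lambda>x. f x + g x) \<le> (\<integral>\<^sup>+y. ennreal K * (?i f y + ?i g y) \<partial>lborel)"
      unfolding lint_eq[OF fg assms]
    proof (rule nn_integral_mono)
      fix y :: real
      have "ennreal (q * y powr (q - 1)) * V {x. y < \<bar>f x + g x\<bar>} * indicator {0<..} y
         \<le> ennreal (q * y powr (q - 1)) * (ennreal K * (V {x. y / 2 < \<bar>f x\<bar>} + V {x. y / 2 < \<bar>g x\<bar>})) * indicator {0<..} y"
        by (intro mult_right_mono mult_left_mono pt) auto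
      also have "\<dots> = ennreal K * (?i f y + ?i g y)" by (simp only: distrib_left distrib_right mult_ac)
      finally show "ennreal (q * y powr (q - 1)) * V {x. y < \<bar>f x + g x\<bar>} * indicator {0<..} y \<le> ennreal K * (?i f y + ?i g y)" .
    qed
    also have "\<dots> = ennreal K * ((\<integral>\<^sup>+y. ?i f y \<partial>lborel) + (\<integral>\<^sup>+y. ?i g y \<partial>lborel))"
      using m[OF f] m[OF g] by (simp add: nn_integral_cmult nn_integral_add)
    also have "\<dots> = ennreal K * (ennreal (2 powr q) * N q f + ennreal (2 powr q) * N q g)"
      using lint_scale[OF f assms, of 2] lint_scale[OF g assms, of 2] by simp
    also have "\<dots> = ennreal (K * 2 powr q) * (N q f + N q g)"
      using K(1) by (simp add: ennreal_mult distrib_left mult.assoc)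
    finally show ?thesis .
  qed
  moreover have "1 \<le> K * 2 powr q" using K(1) assms mult_mono[of 1 K 1 "2 powr q"] by (simp add: ge_one_powr_ge_zero)
  ultimately show thesis by (rule that[rotated])
qed

text \<open>Dominated convergence twice: u(E n) tends to 0 inside the bounded interval, and then the
  sets of s below u(E n) shrink to a null set of \<open>wm\<close>, under the finite bound
  V([-R, R]).\<close>

lemma cap_tendsto_0:
  assumes E: "\<And>n. E n \<in> sets lebesgue" "\<And>n. E n \<subseteq> {-R..R}" and ae: "AE x in lebesgue. \<forall>\<^sub>F n in sequentially. x \<notin> E n"
  shows "(\<lambda>n. V (E n)) \<longlonglongrightarrow> 0"
proof -
  have "(\<lambda>n. \<integral>\<^sup>+x. indicator (E n) x \<partial>um) \<longlonglongrightarrow> (\<integral>\<^sup>+x. 0 \<partial>um)"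
  proof (rule nn_integral_dominated_convergence[where w="indicator {-R..R}"])
    show "(\<integral>\<^sup>+x. indicator {-R..R} x \<partial>um) < \<infinity>" using emeasure_um_Icc by simp
    have "AE x in lebesgue. (\<lambda>n. indicator (E n) x :: ennreal) \<longlonglongrightarrow> 0"
      using ae
    proof eventually_elim
      case (elim x)
      then have "\<forall>\<^sub>F n in sequentially. (indicator (E n) x :: ennreal) = 0" by eventually_elim simp
      then show ?case by (rule tendsto_eventually)
    qed
    then show "AE x in um. (\<lambda>n. indicator (E n) x :: ennreal) \<longlonglongrightarrow> 0"
      unfolding umeas_def by (subst AE_density) auto
    show "AE x in um. (indicator (E n) x :: ennreal) \<le> indicator {-R..R} x" for n
      using E(2)[of n] by (intro AE_I2) (auto simp: indicator_def)
    have "{-R..R} \<in> sets um" "\<And>n. E n \<in> sets um" using E(1) by auto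
    then show "indicator {-R..R} \<in> borel_measurable um" "\<And>n. indicator (E n) \<in> borel_measurable um"
      by (auto intro!: borel_measurable_indicator)
  qed simp
  then have um0: "(\<lambda>n. emeasure um (E n)) \<longlonglongrightarrow> 0" using E by simp
  let ?S = "\<lambda>n. {s. ennreal s < emeasure um (E n)}"
  have "(\<lambda>n. \<integral>\<^sup>+s. indicator (?S n) s \<partial>wm) \<longlonglongrightarrow> (\<integral>\<^sup>+s. 0 \<partial>wm)"
  proof (rule nn_integral_dominated_convergence[where w="indicator {s. ennreal s < emeasure um {-R..R}}"])
    show "(\<integral>\<^sup>+s. indicator {s. ennreal s < emeasure um {-R..R}} s \<partial>wm) < \<infinity>"
      using cap_Icc_finite[of "-R" R] by (simp add: cap_def)
    have "emeasure um (E n) \<le> emeasure um {-R..R}" for n using E by (intro emeasure_mono) auto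
    then show "AE s in wm. (indicator (?S n) s :: ennreal) \<le> indicator {s. ennreal s < emeasure um {-R..R}} s" for n
      by (intro AE_I2) (auto simp: indicator_def intro: less_le_trans)
    have "{..0} \<in> null_sets wm" using wm_le_0 by (simp add: null_sets_def)
    from AE_not_in[OF this] show "AE s in wm. (\<lambda>n. indicator (?S n) s :: ennreal) \<longlonglongrightarrow> 0"
    proof eventually_elim
      case (elim s)
      then have "0 < ennreal s" by simp
      with um0 have "\<forall>\<^sub>F n in sequentially. emeasure um (E n) < ennreal s" by (rule order_tendstoD)
      then have "\<forall>\<^sub>F n in sequentially. (indicator (?S n) s :: ennreal) = 0" by eventually_elim (auto simp: indicator_def)
      then show ?case by (rule tendsto_eventually)
    qed
    have "{s. ennreal s < T} \<in> sets wm" for T using Collect_ennreal_less by simp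
    then show "indicator {s. ennreal s < emeasure um {-R..R}} \<in> borel_measurable wm" "\<And>n. indicator (?S n) \<in> borel_measurable wm"
      by (auto intro!: borel_measurable_indicator)
  qed simp
  then show ?thesis by (simp add: cap_def)
qed

lemma decay_measurable: "(\<lambda>x::real. c / (1 + \<bar>x\<bar>)\<^sup>2) \<in> borel_measurable lebesgue"
proof -
  have "(\<lambda>x::real. c / (1 + \<bar>x\<bar>)\<^sup>2) \<in> borel_measurable borel" by measurable
  then show ?thesis by (intro measurable_completion) simp
qed

text \<open>The common majorant c / (1 + |x|)^2 lies in \<Lambda>^q and keeps every level set inside
  [-c / y, c / y], so \<open>cap_tendsto_0\<close> applies level by level and dominated convergence
  in y does the rest.\<close>

lemma lint_tendsto_0:
  assumes h: "\<And>n. h n \<in> borel_measurable lebesgue" and b: "\<And>n x. \<bar>h n x\<bar> \<le> c / (1 + \<bar>x\<bar>)\<^sup>2"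
    and ae: "AE x in lebesgue. (\<lambda>n. h n x) \<longlonglongrightarrow> 0" and q: "p \<le> q"
  shows "(\<lambda>n. N q (h n)) \<longlonglongrightarrow> 0"
proof -
  have q0: "0 < q" using q p_pos by simp
  define H where "H = (\<lambda>x::real. c / (1 + \<bar>x\<bar>)\<^sup>2)"
  have H: "H \<in> borel_measurable lebesgue" unfolding H_def by (rule decay_measurable)
  have c0: "0 \<le> c" using b[of 0 0] by simp
  have Hb: "\<bar>H x\<bar> \<le> c / (1 + \<bar>x\<bar>)\<^sup>2" for x using c0 by (simp add: H_def)
  let ?i = "\<lambda>f y. ennreal (q * y powr (q - 1)) * V {x. y < \<bar>f x\<bar>} * indicator {0<..} y"
  have m: "?i f \<in> borel_measurable lborel" if "f \<in> borel_measurable lebesgue" for f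
    using cap_level_measurable[OF that] by measurable
  have "(\<lambda>n. \<integral>\<^sup>+y. ?i (h n) y \<partial>lborel) \<longlonglongrightarrow> (\<integral>\<^sup>+(y::real). 0 \<partial>lborel)"
  proof (rule nn_integral_dominated_convergence[where w="?i H"])
    show "(\<integral>\<^sup>+y. ?i H y \<partial>lborel) < \<infinity>" using lint_decay_finite[OF H Hb q] lint_eq[OF H q0] by simp
    have "\<bar>h n x\<bar> \<le> \<bar>H x\<bar>" for n x using b[of n x] c0 by (simp add: H_def)
    then have "V {x. y < \<bar>h n x\<bar>} \<le> V {x. y < \<bar>H x\<bar>}" for n y
      using H by (intro cap_mono) (auto intro: less_le_trans)
    then show "AE y in lborel. ?i (h n) y \<le> ?i H y" for n
      by (intro AE_I2 mult_right_mono mult_left_mono) auto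
    show "AE y in lborel. (\<lambda>n. ?i (h n) y) \<longlonglongrightarrow> 0"
    proof (rule AE_I2)
      fix y :: real
      show "(\<lambda>n. ?i (h n) y) \<longlonglongrightarrow> 0"
      proof (cases "0 < y")
        case True
        have "(\<lambda>n. V {x. y < \<bar>h n x\<bar>}) \<longlonglongrightarrow> 0"
        proof (rule cap_tendsto_0[where R="c / y"])
          show "{x. y < \<bar>h n x\<bar>} \<in> sets lebesgue" for n by (rule sets_Collect_less_abs[OF h])
          show "{x. y < \<bar>h n x\<bar>} \<subseteq> {- (c / y)..c / y}" for n
          proof
            fix x assume "x \<in> {x. y < \<bar>h n x\<bar>}"
            then have "y < c / (1 + \<bar>x\<bar>)\<^sup>2" using b[of n x] by auto
            then have "y * (1 + \<bar>x\<bar>)\<^sup>2 < c" by (simp add: pos_less_divide_eq)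
            moreover have "\<bar>x\<bar> \<le> (1 + \<bar>x\<bar>)\<^sup>2" by (simp add: power2_eq_square algebra_simps)
            then have "y * \<bar>x\<bar> \<le> y * (1 + \<bar>x\<bar>)\<^sup>2" using True by (intro mult_left_mono) auto
            ultimately have "y * \<bar>x\<bar> \<le> c" by linarith
            then have "\<bar>x\<bar> \<le> c / y" using True by (simp add: pos_le_divide_eq mult.commute)
            then show "x \<in> {- (c / y)..c / y}" by (auto simp: abs_le_iff)
          qed
          show "AE x in lebesgue. \<forall>\<^sub>F n in sequentially. x \<notin> {x. y < \<bar>h n x\<bar>}"
            using ae
          proof eventually_elim
            case (elim x)
            from tendstoD[OF this True] show ?case by eventually_elim auto
          qed
        qed
        then have "(\<lambda>n. (ennreal (q * y powr (q - 1)) * indicator {0<..} y) * V {x. y < \<bar>h n x\<bar>}) \<longlonglongrightarrow> (ennreal (q * y powr (q - 1)) * indicator {0<..} y) * 0"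
          by (intro ennreal_tendsto_cmult) (auto simp: indicator_def)
        then show ?thesis by (simp add: mult_ac)
      qed simp
    qed
  qed (use m h H in auto)
  then show ?thesis by (simp add: lint_eq[OF h q0])
qed

text \<open>The estimate for rational functions passes to f by writing f as the real part of a
  rational function plus an error e_n. The error tends to 0 in both \<Lambda>^p and \<Lambda>^q, and
  weak type p controls H e_n. Only the level 1 is recorded, tied to |f| <= 1; scaling supplies the
  other levels.\<close>

lemma small_bound:
  assumes q: "p < q" "q < 2 * p"
  obtains C where "0 < C" "\<And>f M. f \<in> borel_measurable lebesgue \<Longrightarrow> (\<And>x. \<bar>f x\<bar> \<le> 1) \<Longrightarrow> (\<And>x. M < \<bar>x\<bar> \<Longrightarrow> f x = 0) \<Longrightarrow>
    V {x. 1 < \<bar>hilbert f x\<bar>} \<le> ennreal C * N q f"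
proof -
  obtain C0 where C0: "0 < C0" "\<And>f y. f \<in> borel_measurable lebesgue \<Longrightarrow> N p f < \<infinity> \<Longrightarrow> 0 < y \<Longrightarrow>
     V {x. y < \<bar>hilbert f x\<bar>} \<le> ennreal (C0 * y powr (- p)) * N p f"
    using weak_bound by blast
  obtain K where K: "1 \<le> K" "\<And>A B. A \<in> sets lebesgue \<Longrightarrow> B \<in> sets lebesgue \<Longrightarrow> V (A \<union> B) \<le> ennreal K * (V A + V B)"
    using cap_quasi_subadditive by blast
  obtain C1 where C1: "0 < C1" "\<And>Q y. poly Q 0 = 0 \<Longrightarrow> (\<And>x. \<bar>Re (rat_eval Q x)\<bar> \<le> 1) \<Longrightarrow> 0 < y \<Longrightarrow>
     V {x. y < \<bar>Im (rat_eval Q x)\<bar>} \<le> ennreal (C1 * y powr (- (2 * p))) * N q (\<lambda>x. Re (rat_eval Q x))"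
    using cotlar_weak[OF q] by blast
  have q0: "0 < q" using q p_pos by simp
  obtain L where L: "1 \<le> L" "\<And>f g. f \<in> borel_measurable lebesgue \<Longrightarrow> g \<in> borel_measurable lebesgue \<Longrightarrow> N q (\<lambda>x. f x + g x) \<le> ennreal L * (N q f + N q g)"
    using lint_add[OF q0] by blast
  define a where "a = C1 * (1/2) powr (- (2 * p))"
  define c where "c = C0 * (1/2) powr (- p)"
  have a: "0 < a" and c: "0 < c" using C0 C1 by (auto simp: a_def c_def)
  have "V {x. 1 < \<bar>hilbert f x\<bar>} \<le> ennreal (K * (a * L)) * N q f"
    if f: "f \<in> borel_measurable lebesgue" and f1: "\<And>x. \<bar>f x\<bar> \<le> 1" and M: "\<And>x. M < \<bar>x\<bar> \<Longrightarrow> f x = 0" for f M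
  proof -
    obtain Q :: "nat \<Rightarrow> complex poly" and c0 where Q: "\<And>n. poly (Q n) 0 = 0"
      "\<And>n x. \<bar>Re (rat_eval (Q n) x)\<bar> \<le> 1" "\<And>n x. \<bar>Re (rat_eval (Q n) x)\<bar> \<le> c0 / (1 + x\<^sup>2)"
      "AE x in lebesgue. (\<lambda>n. Re (rat_eval (Q n) x)) \<longlonglongrightarrow> f x"
      using rational_approximation_AE[OF f f1 M] by blast
    let ?R = "\<lambda>n x. Re (rat_eval (Q n) x)"
    define e where "e = (\<lambda>n x. f x - ?R n x)"
    have em: "e n \<in> borel_measurable lebesgue" for n unfolding e_def using f by measurable
    have c0: "0 \<le> c0" using Q(3)[of 0 0] by simp
    define c1 where "c1 = (1 + \<bar>M\<bar>)\<^sup>2"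
    have fb: "\<bar>f x\<bar> \<le> c1 / (1 + \<bar>x\<bar>)\<^sup>2" for x
    proof (cases "M < \<bar>x\<bar>")
      case True
      then show ?thesis using M by (simp add: c1_def)
    next
      case False
      then have "(1 + \<bar>x\<bar>)\<^sup>2 \<le> c1" unfolding c1_def by (intro power_mono) auto
      then have "1 \<le> c1 / (1 + \<bar>x\<bar>)\<^sup>2" by (simp add: pos_le_divide_eq)
      with f1[of x] show ?thesis by linarith
    qed
    have eb: "\<bar>e n x\<bar> \<le> (c1 + 2 * c0) / (1 + \<bar>x\<bar>)\<^sup>2" for n x
    proof -
      have "(1 + \<bar>x\<bar>)\<^sup>2 \<le> 2 * (1 + x\<^sup>2)" using sum_squares_ge_zero[of "1 - \<bar>x\<bar>" 0] by (simp add: power2_eq_square algebra_simps)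
      then have "c0 * (1 + \<bar>x\<bar>)\<^sup>2 \<le> c0 * (2 * (1 + x\<^sup>2))" using c0 by (rule mult_left_mono)
      moreover have "0 < 1 + x\<^sup>2" by (simp add: add_pos_nonneg)
      ultimately have "c0 / (1 + x\<^sup>2) \<le> 2 * c0 / (1 + \<bar>x\<bar>)\<^sup>2" by (simp add: divide_le_eq pos_le_divide_eq mult_ac)
      with Q(3)[of n x] fb[of x] show ?thesis unfolding e_def add_divide_distrib by linarith
    qed
    have e0: "AE x in lebesgue. (\<lambda>n. e n x) \<longlonglongrightarrow> 0"
      using Q(4)
    proof eventually_elim
      case (elim x)
      have "(\<lambda>n. f x - ?R n x) \<longlonglongrightarrow> f x - f x" by (intro tendsto_intros elim)
      then show ?case by (simp add: e_def)
    qed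
    have limp: "(\<lambda>n. N p (e n)) \<longlonglongrightarrow> 0" by (rule lint_tendsto_0[OF em eb e0]) simp
    have limq: "(\<lambda>n. N q (e n)) \<longlonglongrightarrow> 0" by (rule lint_tendsto_0[OF em eb e0]) (use q in simp)
    have Nf: "N p f < \<infinity>" by (rule lint_decay_finite[OF f fb]) simp
    have Ne: "N p (e n) < \<infinity>" for n by (rule lint_decay_finite[OF em eb]) simp
    have main: "V {x. 1 < \<bar>hilbert f x\<bar>} \<le> ennreal K * (ennreal a * (ennreal L * (N q f + N q (e n))) + ennreal c * N p (e n))" for n
    proof -
      have "AE x in lebesgue. x \<in> {x. 1 < \<bar>hilbert f x\<bar>} \<longrightarrow> x \<in> {x. 1/2 < \<bar>Im (rat_eval (Q n) x)\<bar>} \<union> {x. 1/2 < \<bar>hilbert (e n) x\<bar>}"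
        using weak_defined[OF f Nf]
      proof eventually_elim
        case (elim x)
        have "hilbert (e n) x = hilbert f x - Im (rat_eval (Q n) x)"
          unfolding e_def using hilbert_diff(2)[OF elim hilbert_rat_eval(1)[OF Q(1)]] hilbert_rat_eval(2)[OF Q(1)] by simp
        then show ?case unfolding mem_Collect_eq Un_iff by linarith
      qed
      then have "V {x. 1 < \<bar>hilbert f x\<bar>} \<le> V ({x. 1/2 < \<bar>Im (rat_eval (Q n) x)\<bar>} \<union> {x. 1/2 < \<bar>hilbert (e n) x\<bar>})"
        by (rule cap_mono_AE) (intro sets.Un sets_Collect_less_abs rat_eval_lebesgue weak_measurable[OF em Ne])
      also have "\<dots> \<le> ennreal K * (V {x. 1/2 < \<bar>Im (rat_eval (Q n) x)\<bar>} + V {x. 1/2 < \<bar>hilbert (e n) x\<bar>})"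
        by (intro K(2) sets_Collect_less_abs rat_eval_lebesgue weak_measurable[OF em Ne])
      also have "\<dots> \<le> ennreal K * (ennreal a * N q (?R n) + ennreal c * N p (e n))"
        unfolding a_def c_def using Q by (intro mult_left_mono add_mono C1(2) C0(2) em Ne) auto
      also have "\<dots> \<le> ennreal K * (ennreal a * (ennreal L * (N q f + N q (e n))) + ennreal c * N p (e n))"
      proof (intro mult_left_mono add_right_mono)
        have eq: "?R n = (\<lambda>x. f x + (- 1) * e n x)" by (simp add: e_def)
        have "N q (?R n) \<le> ennreal L * (N q f + N q (\<lambda>x. (- 1) * e n x))"
          unfolding eq using em f by (intro L(2)) auto
        also have "N q (\<lambda>x. (- 1) * e n x) = N q (e n)" using lint_cmult[OF em q0, of "- 1"] by simp
        finally show "N q (?R n) \<le> ennreal L * (N q f + N q (e n))" .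
      qed auto
      finally show ?thesis .
    qed
    have "(\<lambda>n. ennreal K * (ennreal a * (ennreal L * (N q f + N q (e n))) + ennreal c * N p (e n)))
       \<longlonglongrightarrow> ennreal K * (ennreal a * (ennreal L * (N q f + 0)) + ennreal c * 0)"
      by (intro ennreal_tendsto_cmult tendsto_add tendsto_const limp limq) auto
    from LIMSEQ_le_const[OF this] main
    have "V {x. 1 < \<bar>hilbert f x\<bar>} \<le> ennreal K * (ennreal a * (ennreal L * (N q f + 0)) + ennreal c * 0)" by blast
    also have "\<dots> = ennreal (K * (a * L)) * N q f" using K(1) L(1) a by (simp add: ennreal_mult mult.assoc)
    finally show ?thesis .
  qed
  moreover have "0 < K * (a * L)" using K L a by simp
  ultimately show thesis by (rule that[rotated])
qed

end

section \<open>Interpolation\<close>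

lemma nn_integral_powr_greaterThanAtMost:
  fixes a Y :: real
  assumes "0 < a" "0 \<le> Y"
  shows "(\<integral>\<^sup>+y. ennreal (y powr (a - 1)) * indicator {0<..Y} y \<partial>lborel) = ennreal (Y powr a / a)"
proof -
  have "(\<integral>\<^sup>+y. ennreal (y powr (a - 1)) * indicator {0<..Y} y \<partial>lborel)
      = (\<integral>\<^sup>+y. ennreal (y powr (a - 1)) * indicator {0<..<Y} y \<partial>lborel)"
    by (rule nn_integral_cong_AE, rule AE_mp[OF AE_lborel_singleton[of Y]]) (auto simp: indicator_def)
  then show ?thesis by (simp add: nn_integral_powr_lessThan[OF assms])
qed

text \<open>Tonelli in the shape of the two Hardy type estimates below, the region of integration
  being given as a measurable relation.\<close>

lemma nn_integral_swap_indicator: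
  fixes a b :: "real \<Rightarrow> ennreal"
  assumes [measurable]: "a \<in> borel_measurable borel" "b \<in> borel_measurable borel"
    and R: "Measurable.pred (borel \<Otimes>\<^sub>M borel) (\<lambda>z. R (fst z) (snd z))"
  shows "(\<integral>\<^sup>+y. a y * (\<integral>\<^sup>+s. b s * indicator {s. R y s} s \<partial>lborel) \<partial>lborel)
    = (\<integral>\<^sup>+s. b s * (\<integral>\<^sup>+y. a y * indicator {y. R y s} y \<partial>lborel) \<partial>lborel)"
proof -
  have [measurable]: "{z. R (fst z) (snd z)} \<in> sets (borel \<Otimes>\<^sub>M borel)"
    using R unfolding pred_def by (simp add: space_pair_measure)
  have "(\<lambda>(y, s). a y * (b s * indicator {z. R (fst z) (snd z)} (y, s))) \<in> borel_measurable (borel \<Otimes>\<^sub>M borel)"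
    by measurable
  then have m: "(\<lambda>(y, s). a y * (b s * indicator {s. R y s} s)) \<in> borel_measurable (borel \<Otimes>\<^sub>M borel)"
    by (simp add: indicator_def)
  have "(\<lambda>z. indicator {z. R (fst z) (snd z)} z :: ennreal) \<in> borel_measurable (borel \<Otimes>\<^sub>M borel)" by measurable
  from measurable_Pair2[OF this] measurable_Pair1[OF this]
  have [measurable]: "(\<lambda>s. indicator {s. R y s} s :: ennreal) \<in> borel_measurable borel"
    "(\<lambda>y. indicator {y. R y s} y :: ennreal) \<in> borel_measurable borel" for y s
    by (auto simp: indicator_def)
  have "(\<integral>\<^sup>+y. a y * (\<integral>\<^sup>+s. b s * indicator {s. R y s} s \<partial>lborel) \<partial>lborel)
     = (\<integral>\<^sup>+y. (\<integral>\<^sup>+s. a y * (b s * indicator {s. R y s} s) \<partial>lborel) \<partial>lborel)"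
    by (subst nn_integral_cmult) auto
  also have "\<dots> = (\<integral>\<^sup>+s. (\<integral>\<^sup>+y. a y * (b s * indicator {s. R y s} s) \<partial>lborel) \<partial>lborel)"
    by (rule lborel_pair.Fubini'[symmetric])
       (use m in \<open>subst measurable_cong_sets[OF sets_pair_measure_cong[OF sets_lborel sets_lborel] refl]\<close>)
  also have "\<dots> = (\<integral>\<^sup>+s. (\<integral>\<^sup>+y. b s * (a y * indicator {y. R y s} y) \<partial>lborel) \<partial>lborel)"
    by (intro nn_integral_cong) (auto simp: indicator_def mult_ac)
  also have "\<dots> = (\<integral>\<^sup>+s. b s * (\<integral>\<^sup>+y. a y * indicator {y. R y s} y \<partial>lborel) \<partial>lborel)"
    by (subst nn_integral_cmult) auto
  finally show ?thesis .
qed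

section \<open>Hardy type estimates and truncation at a height\<close>

context lorentz_weights
begin

text \<open>After Tonelli the inner integral of y^(r - p - 1) over (0, s] is s^(r - p) / (r - p),
  finite because p < r. It sums up the large parts of f over all heights y.\<close>

lemma hardy_upper:
  assumes f: "f \<in> borel_measurable lebesgue" and pr: "0 < p" "p < r"
  shows "(\<integral>\<^sup>+y. ennreal (r * y powr (r - p - 1)) * indicator {0<..} y *
      (\<integral>\<^sup>+s. ennreal (p * s powr (p - 1)) * V {x. s < \<bar>f x\<bar>} * indicator {s. 0 < y \<and> y \<le> s} s \<partial>lborel) \<partial>lborel)
     = ennreal (p / (r - p)) * N r f"
proof -
  have [measurable]: "(\<lambda>s. V {x. s < \<bar>f x\<bar>}) \<in> borel_measurable borel" by (rule cap_level_measurable[OF f])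
  have "(\<integral>\<^sup>+y. ennreal (r * y powr (r - p - 1)) * indicator {0<..} y *
      (\<integral>\<^sup>+s. ennreal (p * s powr (p - 1)) * V {x. s < \<bar>f x\<bar>} * indicator {s. 0 < y \<and> y \<le> s} s \<partial>lborel) \<partial>lborel)
     = (\<integral>\<^sup>+s. ennreal (p * s powr (p - 1)) * V {x. s < \<bar>f x\<bar>} *
       (\<integral>\<^sup>+y. ennreal (r * y powr (r - p - 1)) * indicator {0<..} y * indicator {y. 0 < y \<and> y \<le> s} y \<partial>lborel) \<partial>lborel)"
    by (rule nn_integral_swap_indicator) measurable
  also have "\<dots> = (\<integral>\<^sup>+s. ennreal (p / (r - p)) * (ennreal (r * s powr (r - 1)) * V {x. s < \<bar>f x\<bar>} * indicator {0<..} s) \<partial>lborel)"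
  proof (rule nn_integral_cong)
    fix s :: real
    have "(\<integral>\<^sup>+y. ennreal (r * y powr (r - p - 1)) * indicator {0<..} y * indicator {y. 0 < y \<and> y \<le> s} y \<partial>lborel)
       = (\<integral>\<^sup>+y. ennreal r * (ennreal (y powr (r - p - 1)) * indicator {0<..s} y) \<partial>lborel)"
      using pr by (intro nn_integral_cong) (auto simp: indicator_def ennreal_mult)
    also have "\<dots> = ennreal (r * (s powr (r - p) / (r - p))) * indicator {0<..} s"
    proof (cases "0 < s")
      case True
      have "(\<integral>\<^sup>+y. ennreal r * (ennreal (y powr (r - p - 1)) * indicator {0<..s} y) \<partial>lborel)
         = ennreal r * ennreal (s powr (r - p) / (r - p))"
        using True pr nn_integral_powr_greaterThanAtMost[of "r - p" s] by (subst nn_integral_cmult) auto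
      then show ?thesis using True pr by (simp add: ennreal_mult[symmetric])
    next
      case False
      then have "{0<..s} = {}" by auto
      then show ?thesis using False by simp
    qed
    finally have i: "(\<integral>\<^sup>+y. ennreal (r * y powr (r - p - 1)) * indicator {0<..} y * indicator {y. 0 < y \<and> y \<le> s} y \<partial>lborel)
      = ennreal (r * (s powr (r - p) / (r - p))) * indicator {0<..} s" .
    have e: "(p * s powr (p - 1)) * (r * (s powr (r - p) / (r - p))) = p / (r - p) * (r * s powr (r - 1))"
    proof -
      have "s powr (p - 1) * s powr (r - p) = s powr (r - 1)" by (simp add: powr_add[symmetric])
      then show ?thesis by (simp add: mult_ac)
    qed
    have "ennreal (p * s powr (p - 1)) * V {x. s < \<bar>f x\<bar>} * (ennreal (r * (s powr (r - p) / (r - p))) * indicator {0<..} s)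
       = (ennreal (p * s powr (p - 1)) * ennreal (r * (s powr (r - p) / (r - p)))) * (V {x. s < \<bar>f x\<bar>} * indicator {0<..} s)"
      by (simp only: mult_ac)
    also have "ennreal (p * s powr (p - 1)) * ennreal (r * (s powr (r - p) / (r - p))) = ennreal (p / (r - p)) * ennreal (r * s powr (r - 1))"
      using pr e by (simp only: ennreal_mult[symmetric] mult_nonneg_nonneg divide_nonneg_nonneg powr_ge_zero less_imp_le diff_ge_0_iff_ge order_less_trans[OF pr])
    finally show "ennreal (p * s powr (p - 1)) * V {x. s < \<bar>f x\<bar>} *
       (\<integral>\<^sup>+y. ennreal (r * y powr (r - p - 1)) * indicator {0<..} y * indicator {y. 0 < y \<and> y \<le> s} y \<partial>lborel) =
      ennreal (p / (r - p)) * (ennreal (r * s powr (r - 1)) * V {x. s < \<bar>f x\<bar>} * indicator {0<..} s)"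
      unfolding i by (simp only: mult_ac)
  qed
  also have "\<dots> = ennreal (p / (r - p)) * N r f"
    using pr by (subst nn_integral_cmult) (auto simp: lint_eq[OF f])
  finally show ?thesis .
qed

text \<open>The counterpart for the small parts: the integral of y^(r - q - 1) over y > s converges
  because r < q.\<close>

lemma hardy_lower:
  assumes f: "f \<in> borel_measurable lebesgue" and rq: "0 < r" "r < q"
  shows "(\<integral>\<^sup>+y. ennreal (r * y powr (r - q - 1)) * indicator {0<..} y *
      (\<integral>\<^sup>+s. ennreal (q * s powr (q - 1)) * V {x. s < \<bar>f x\<bar>} * indicator {s. 0 < s \<and> s < y} s \<partial>lborel) \<partial>lborel)
     \<le> ennreal (q / (q - r)) * N r f"
proof -
  have [measurable]: "(\<lambda>s. V {x. s < \<bar>f x\<bar>}) \<in> borel_measurable borel" by (rule cap_level_measurable[OF f])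
  have "(\<integral>\<^sup>+y. ennreal (r * y powr (r - q - 1)) * indicator {0<..} y *
      (\<integral>\<^sup>+s. ennreal (q * s powr (q - 1)) * V {x. s < \<bar>f x\<bar>} * indicator {s. 0 < s \<and> s < y} s \<partial>lborel) \<partial>lborel)
     = (\<integral>\<^sup>+s. ennreal (q * s powr (q - 1)) * V {x. s < \<bar>f x\<bar>} *
       (\<integral>\<^sup>+y. ennreal (r * y powr (r - q - 1)) * indicator {0<..} y * indicator {y. 0 < s \<and> s < y} y \<partial>lborel) \<partial>lborel)"
    by (rule nn_integral_swap_indicator) measurable
  also have "\<dots> \<le> (\<integral>\<^sup>+s. ennreal (q / (q - r)) * (ennreal (r * s powr (r - 1)) * V {x. s < \<bar>f x\<bar>} * indicator {0<..} s) \<partial>lborel)"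
  proof (rule nn_integral_mono)
    fix s :: real
    have i: "(\<integral>\<^sup>+y. ennreal (r * y powr (r - q - 1)) * indicator {0<..} y * indicator {y. 0 < s \<and> s < y} y \<partial>lborel)
       \<le> ennreal (r * (s powr (- (q - r)) / (q - r))) * indicator {0<..} s"
    proof (cases "0 < s")
      case True
      have "(\<integral>\<^sup>+y. ennreal (r * y powr (r - q - 1)) * indicator {0<..} y * indicator {y. 0 < s \<and> s < y} y \<partial>lborel)
         \<le> (\<integral>\<^sup>+y. ennreal r * (ennreal (y powr (- (q - r) - 1)) * indicator {s..} y) \<partial>lborel)"
        using rq by (intro nn_integral_mono) (auto simp: indicator_def ennreal_mult)
      also have "\<dots> = ennreal r * ennreal (s powr (- (q - r)) / (q - r))"
        using True rq nn_integral_powr_atLeast[of "q - r" s] by (subst nn_integral_cmult) auto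
      finally show ?thesis using True rq by (simp add: ennreal_mult[symmetric])
    qed simp
    have e: "(q * s powr (q - 1)) * (r * (s powr (- (q - r)) / (q - r))) = q / (q - r) * (r * s powr (r - 1))"
    proof -
      have "s powr (q - 1) * s powr (- (q - r)) = s powr (r - 1)" unfolding powr_add[symmetric] by simp
      then show ?thesis by (simp add: mult_ac)
    qed
    have "ennreal (q * s powr (q - 1)) * V {x. s < \<bar>f x\<bar>} *
       (\<integral>\<^sup>+y. ennreal (r * y powr (r - q - 1)) * indicator {0<..} y * indicator {y. 0 < s \<and> s < y} y \<partial>lborel)
      \<le> ennreal (q * s powr (q - 1)) * V {x. s < \<bar>f x\<bar>} * (ennreal (r * (s powr (- (q - r)) / (q - r))) * indicator {0<..} s)"
      by (rule mult_left_mono[OF i]) simp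
    also have "\<dots> = (ennreal (q * s powr (q - 1)) * ennreal (r * (s powr (- (q - r)) / (q - r)))) * (V {x. s < \<bar>f x\<bar>} * indicator {0<..} s)"
      by (simp only: mult_ac)
    also have "ennreal (q * s powr (q - 1)) * ennreal (r * (s powr (- (q - r)) / (q - r))) = ennreal (q / (q - r)) * ennreal (r * s powr (r - 1))"
      using rq e by (simp only: ennreal_mult[symmetric] mult_nonneg_nonneg divide_nonneg_nonneg powr_ge_zero less_imp_le diff_ge_0_iff_ge order_less_trans[OF rq])
    finally show "ennreal (q * s powr (q - 1)) * V {x. s < \<bar>f x\<bar>} *
       (\<integral>\<^sup>+y. ennreal (r * y powr (r - q - 1)) * indicator {0<..} y * indicator {y. 0 < s \<and> s < y} y \<partial>lborel) \<le>
      ennreal (q / (q - r)) * (ennreal (r * s powr (r - 1)) * V {x. s < \<bar>f x\<bar>} * indicator {0<..} s)"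
      by (simp only: mult_ac)
  qed
  also have "\<dots> = ennreal (q / (q - r)) * N r f"
    using rq by (subst nn_integral_cmult) (auto simp: lint_eq[OF f])
  finally show ?thesis .
qed

text \<open>Below the height y the truncated function has the constant distribution value V(|f| >
  y), which integrates to the boundary term; above it the distribution is that of f.\<close>

lemma lint_large_part:
  assumes f: "f \<in> borel_measurable lebesgue" and p: "0 < p" and y: "0 < y"
  shows "N p (\<lambda>x. if y < \<bar>f x\<bar> then f x else 0) \<le> ennreal (y powr p) * V {x. y < \<bar>f x\<bar>} +
    (\<integral>\<^sup>+s. ennreal (p * s powr (p - 1)) * V {x. s < \<bar>f x\<bar>} * indicator {s. 0 < y \<and> y \<le> s} s \<partial>lborel)"
proof -
  have [measurable]: "(\<lambda>s. V {x. s < \<bar>f x\<bar>}) \<in> borel_measurable borel" by (rule cap_level_measurable[OF f])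
  let ?g = "\<lambda>x. if y < \<bar>f x\<bar> then f x else 0"
  have g: "?g \<in> borel_measurable lebesgue" using f by measurable
  have "N p ?g \<le> (\<integral>\<^sup>+s. (ennreal p * V {x. y < \<bar>f x\<bar>}) * (ennreal (s powr (p - 1)) * indicator {0<..<y} s)
      + ennreal (p * s powr (p - 1)) * V {x. s < \<bar>f x\<bar>} * indicator {s. 0 < y \<and> y \<le> s} s \<partial>lborel)"
    unfolding lint_eq[OF g p]
  proof (rule nn_integral_mono)
    fix s :: real
    consider "s \<le> 0" | "0 < s" "s < y" | "y \<le> s" by linarith
    then show "ennreal (p * s powr (p - 1)) * V {x. s < \<bar>?g x\<bar>} * indicator {0<..} s \<le>
       (ennreal p * V {x. y < \<bar>f x\<bar>}) * (ennreal (s powr (p - 1)) * indicator {0<..<y} s)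
      + ennreal (p * s powr (p - 1)) * V {x. s < \<bar>f x\<bar>} * indicator {s. 0 < y \<and> y \<le> s} s"
    proof cases
      case 2
      have "V {x. s < \<bar>?g x\<bar>} \<le> V {x. y < \<bar>f x\<bar>}"
        using 2 f by (intro cap_mono) auto
      then have "ennreal (p * s powr (p - 1)) * V {x. s < \<bar>?g x\<bar>} \<le> ennreal (p * s powr (p - 1)) * V {x. y < \<bar>f x\<bar>}"
        by (rule mult_left_mono) simp
      then show ?thesis using 2 p by (simp add: ennreal_mult mult_ac)
    next
      case 3
      have "V {x. s < \<bar>?g x\<bar>} \<le> V {x. s < \<bar>f x\<bar>}"
        using 3 y f by (intro cap_mono) auto
      then have "ennreal (p * s powr (p - 1)) * V {x. s < \<bar>?g x\<bar>} \<le> ennreal (p * s powr (p - 1)) * V {x. s < \<bar>f x\<bar>}"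
        by (rule mult_left_mono) simp
      then show ?thesis using 3 y by simp
    qed simp
  qed
  also have "\<dots> = (\<integral>\<^sup>+s. (ennreal p * V {x. y < \<bar>f x\<bar>}) * (ennreal (s powr (p - 1)) * indicator {0<..<y} s) \<partial>lborel)
     + (\<integral>\<^sup>+s. ennreal (p * s powr (p - 1)) * V {x. s < \<bar>f x\<bar>} * indicator {s. 0 < y \<and> y \<le> s} s \<partial>lborel)"
    by (rule nn_integral_add) measurable
  also have "(\<integral>\<^sup>+s. (ennreal p * V {x. y < \<bar>f x\<bar>}) * (ennreal (s powr (p - 1)) * indicator {0<..<y} s) \<partial>lborel)
     = ennreal p * V {x. y < \<bar>f x\<bar>} * ennreal (y powr p / p)"
    using p y by (subst nn_integral_cmult) (auto simp: nn_integral_powr_lessThan)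
  also have "\<dots> = (ennreal p * ennreal (y powr p / p)) * V {x. y < \<bar>f x\<bar>}" by (simp only: mult_ac)
  also have "ennreal p * ennreal (y powr p / p) = ennreal (y powr p)" using p by (simp add: ennreal_mult[symmetric])
  finally show ?thesis .
qed

lemma lint_small_part:
  assumes f: "f \<in> borel_measurable lebesgue" and q: "0 < q"
  shows "N q (\<lambda>x. if y < \<bar>f x\<bar> then 0 else f x) \<le>
    (\<integral>\<^sup>+s. ennreal (q * s powr (q - 1)) * V {x. s < \<bar>f x\<bar>} * indicator {s. 0 < s \<and> s < y} s \<partial>lborel)"
proof -
  let ?g = "\<lambda>x. if y < \<bar>f x\<bar> then 0 else f x"
  have g: "?g \<in> borel_measurable lebesgue" using f by measurable
  show ?thesis unfolding lint_eq[OF g q]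
  proof (rule nn_integral_mono)
    fix s :: real
    show "ennreal (q * s powr (q - 1)) * V {x. s < \<bar>?g x\<bar>} * indicator {0<..} s \<le>
      ennreal (q * s powr (q - 1)) * V {x. s < \<bar>f x\<bar>} * indicator {s. 0 < s \<and> s < y} s"
    proof (cases "0 < s \<and> s < y")
      case True
      have "V {x. s < \<bar>?g x\<bar>} \<le> V {x. s < \<bar>f x\<bar>}" using True f by (intro cap_mono) (auto split: if_splits)
      then have "ennreal (q * s powr (q - 1)) * V {x. s < \<bar>?g x\<bar>} \<le> ennreal (q * s powr (q - 1)) * V {x. s < \<bar>f x\<bar>}"
        by (rule mult_left_mono) simp
      then show ?thesis using True by simp
    next
      case False
      have "{x. s < \<bar>?g x\<bar>} = {}" if "0 < s" using False that by (auto split: if_splits)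
      then show ?thesis using False by (auto simp: indicator_def)
    qed
  qed
qed

end

context hilbert_weak
begin

lemma lint_bounded_compact:
  assumes f: "f \<in> borel_measurable lebesgue" and b: "\<And>x. \<bar>f x\<bar> \<le> m" "0 < m" and M: "\<And>x. M < \<bar>x\<bar> \<Longrightarrow> f x = 0" and q: "0 < q"
  shows "N q f < \<infinity>"
proof -
  have i: "indicat_real {-M..M} \<in> borel_measurable lebesgue" by (rule borel_measurable_indicator) simp
  have "N q f \<le> N q (\<lambda>x. m * indicat_real {-M..M} x)"
  proof (rule lint_mono[OF f _ q])
    show "(\<lambda>x. m * indicat_real {-M..M} x) \<in> borel_measurable lebesgue" using i by measurable
    show "\<bar>f x\<bar> \<le> \<bar>m * indicat_real {-M..M} x\<bar>" for x
      using b(1)[of x] b(2) M[of x] by (cases "M < \<bar>x\<bar>") (auto simp: indicator_def abs_le_iff not_less)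
  qed
  also have "\<dots> = ennreal (\<bar>m\<bar> powr q) * V {-M..M}"
    using b(2) q by (subst lint_cmult[OF i q]) (auto simp: lint_indicator)
  also have "\<dots> < \<infinity>" using cap_Icc_finite by (simp add: ennreal_mult_less_top)
  finally show ?thesis .
qed

text \<open>Homogeneity, applied to f / y. Height bound and level are the same y, which fits the
  part of a function left after truncation at y.\<close>

lemma small_bound_scaled:
  assumes q: "p < q" "q < 2 * p"
  obtains C where "0 < C" "\<And>f M y. f \<in> borel_measurable lebesgue \<Longrightarrow> 0 < y \<Longrightarrow> (\<And>x. \<bar>f x\<bar> \<le> y) \<Longrightarrow> (\<And>x. M < \<bar>x\<bar> \<Longrightarrow> f x = 0) \<Longrightarrow>
    V {x. y < \<bar>hilbert f x\<bar>} \<le> ennreal (C * y powr (- q)) * N q f"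
proof -
  obtain C where C: "0 < C" "\<And>f M. f \<in> borel_measurable lebesgue \<Longrightarrow> (\<And>x. \<bar>f x\<bar> \<le> 1) \<Longrightarrow> (\<And>x. M < \<bar>x\<bar> \<Longrightarrow> f x = 0) \<Longrightarrow>
    V {x. 1 < \<bar>hilbert f x\<bar>} \<le> ennreal C * N q f"
    using small_bound[OF q] by blast
  have "V {x. y < \<bar>hilbert f x\<bar>} \<le> ennreal (C * y powr (- q)) * N q f"
    if f: "f \<in> borel_measurable lebesgue" and y: "0 < y" and b: "\<And>x. \<bar>f x\<bar> \<le> y" and M: "\<And>x. M < \<bar>x\<bar> \<Longrightarrow> f x = 0" for f M y
  proof -
    let ?g = "\<lambda>x. (1 / y) * f x"
    have g: "?g \<in> borel_measurable lebesgue" using f by measurable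
    have g1: "\<bar>?g x\<bar> \<le> 1" for x using b[of x] y by (simp add: abs_mult)
    have gM: "?g x = 0" if "M < \<bar>x\<bar>" for x using M[OF that] by simp
    have Np: "N p f < \<infinity>" by (rule lint_bounded_compact[OF f b y M p_pos])
    have Ng: "N p ?g < \<infinity>" by (rule lint_bounded_compact[OF g g1 _ gM p_pos]) simp
    have "V {x. y < \<bar>hilbert f x\<bar>} \<le> V {x. 1 < \<bar>hilbert ?g x\<bar>}"
    proof (rule cap_mono_AE)
      show "AE x in lebesgue. x \<in> {x. y < \<bar>hilbert f x\<bar>} \<longrightarrow> x \<in> {x. 1 < \<bar>hilbert ?g x\<bar>}"
        using weak_defined[OF f Np]
      proof eventually_elim
        case (elim x)
        show ?case using hilbert_cmult(2)[OF elim, of "1 / y"] y by (simp add: abs_mult)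
      qed
      show "{x. 1 < \<bar>hilbert ?g x\<bar>} \<in> sets lebesgue" by (rule sets_Collect_less_abs[OF weak_measurable[OF g Ng]])
    qed
    also have "\<dots> \<le> ennreal C * N q ?g" by (rule C(2)[OF g g1 gM])
    also have "N q ?g = ennreal (y powr (- q)) * N q f"
      using lint_cmult[OF f _, of q "1 / y"] q p_pos y by (simp add: powr_minus_divide powr_divide)
    also have "ennreal C * (ennreal (y powr (- q)) * N q f) = ennreal (C * y powr (- q)) * N q f"
      using C(1) by (simp add: ennreal_mult mult.assoc)
    finally show ?thesis .
  qed
  with C(1) show thesis by (rule that)
qed

text \<open>For s >= y the power s^(p - 1) is at most y^(p - r) s^(r - 1). So the large part of a
  function in \<Lambda>^r lies in \<Lambda>^p, where H is known to exist.\<close>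

lemma lint_large_part_finite:
  assumes f: "f \<in> borel_measurable lebesgue" and r: "p < r" and N: "N r f < \<infinity>" and y: "0 < y"
  shows "N p (\<lambda>x. if y < \<bar>f x\<bar> then f x else 0) < \<infinity>"
proof -
  have r0: "0 < r" using r p_pos by simp
  have [measurable]: "(\<lambda>s. V {x. s < \<bar>f x\<bar>}) \<in> borel_measurable borel" by (rule cap_level_measurable[OF f])
  have "(\<integral>\<^sup>+s. ennreal (p * s powr (p - 1)) * V {x. s < \<bar>f x\<bar>} * indicator {s. 0 < y \<and> y \<le> s} s \<partial>lborel)
     \<le> (\<integral>\<^sup>+s. ennreal (y powr (p - r)) * (ennreal (r * s powr (r - 1)) * V {x. s < \<bar>f x\<bar>} * indicator {0<..} s) \<partial>lborel)"
  proof (rule nn_integral_mono)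
    fix s :: real
    show "ennreal (p * s powr (p - 1)) * V {x. s < \<bar>f x\<bar>} * indicator {s. 0 < y \<and> y \<le> s} s \<le>
      ennreal (y powr (p - r)) * (ennreal (r * s powr (r - 1)) * V {x. s < \<bar>f x\<bar>} * indicator {0<..} s)"
    proof (cases "y \<le> s")
      case True
      have "p * s powr (p - 1) = p * (s powr (p - r) * s powr (r - 1))" by (simp add: powr_add[symmetric])
      also have "\<dots> \<le> r * (y powr (p - r) * s powr (r - 1))"
      proof -
        have "s powr (p - r) \<le> y powr (p - r)" using True y r by (intro powr_mono2') auto
        then show ?thesis using r p_pos by (intro mult_mono) auto
      qed
      finally have "ennreal (p * s powr (p - 1)) \<le> ennreal (r * (y powr (p - r) * s powr (r - 1)))" by (rule ennreal_leI)
      also have "\<dots> = ennreal (y powr (p - r)) * ennreal (r * s powr (r - 1))"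
        using r0 by (simp add: ennreal_mult[symmetric] mult_ac)
      finally have "ennreal (p * s powr (p - 1)) * V {x. s < \<bar>f x\<bar>} \<le> ennreal (y powr (p - r)) * ennreal (r * s powr (r - 1)) * V {x. s < \<bar>f x\<bar>}"
        by (rule mult_right_mono) simp
      then show ?thesis using True y by (simp add: mult.assoc)
    qed simp
  qed
  also have "\<dots> = ennreal (y powr (p - r)) * N r f"
    using r0 by (subst nn_integral_cmult) (auto simp: lint_eq[OF f])
  also have "\<dots> < \<infinity>" using N by (simp add: ennreal_mult_less_top)
  finally have A: "(\<integral>\<^sup>+s. ennreal (p * s powr (p - 1)) * V {x. s < \<bar>f x\<bar>} * indicator {s. 0 < y \<and> y \<le> s} s \<partial>lborel) < \<infinity>" .
  have "V {x. y < \<bar>f x\<bar>} < \<infinity>"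
  proof (rule ccontr)
    assume "\<not> V {x. y < \<bar>f x\<bar>} < \<infinity>"
    then have "V {x. y < \<bar>f x\<bar>} = \<infinity>" by (simp add: not_less top_unique)
    then have "ennreal (y powr r) * V {x. y < \<bar>f x\<bar>} = \<infinity>" using y by (simp add: ennreal_mult_top)
    with lint_chebyshev[OF f r0, of y] y N show False by (simp add: top_unique)
  qed
  with A have "ennreal (y powr p) * V {x. y < \<bar>f x\<bar>} +
    (\<integral>\<^sup>+s. ennreal (p * s powr (p - 1)) * V {x. s < \<bar>f x\<bar>} * indicator {s. 0 < y \<and> y \<le> s} s \<partial>lborel) < \<infinity>"
    by (simp add: ennreal_mult_less_top)
  with lint_large_part[OF f p_pos y] show ?thesis by (rule le_less_trans)
qed

text \<open>The large values are covered by \<open>lint_large_part_finite\<close>, and bounded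
  values on a bounded set have finite norm of every order. Compact support thus opens weak type p to
  functions of \<Lambda>^r.\<close>

lemma lint_compact_finite:
  assumes f: "f \<in> borel_measurable lebesgue" and r: "p < r" and N: "N r f < \<infinity>" and M: "\<And>x. M < \<bar>x\<bar> \<Longrightarrow> f x = 0"
  shows "N p f < \<infinity>"
proof -
  let ?f1 = "\<lambda>x. if 1 < \<bar>f x\<bar> then f x else 0" and ?f2 = "\<lambda>x. if 1 < \<bar>f x\<bar> then 0 else f x"
  have m: "?f1 \<in> borel_measurable lebesgue" "?f2 \<in> borel_measurable lebesgue" using f by measurable
  obtain L where L: "1 \<le> L" "\<And>f g. f \<in> borel_measurable lebesgue \<Longrightarrow> g \<in> borel_measurable lebesgue \<Longrightarrow> N p (\<lambda>x. f x + g x) \<le> ennreal L * (N p f + N p g)"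
    using lint_add[OF p_pos] by blast
  have eq: "f = (\<lambda>x. ?f1 x + ?f2 x)" by auto
  have "N p f \<le> ennreal L * (N p ?f1 + N p ?f2)" by (subst eq) (rule L(2)[OF m])
  also have "\<dots> < \<infinity>"
  proof -
    have "N p ?f1 < \<infinity>" by (rule lint_large_part_finite[OF f r N]) simp
    moreover have "N p ?f2 < \<infinity>" by (rule lint_bounded_compact[OF m(2), of 1 M]) (use M p_pos in auto)
    ultimately show ?thesis by (simp add: ennreal_mult_less_top)
  qed
  finally show ?thesis .
qed

text \<open>The usual splitting at a height tied to the level, with an unusual upper endpoint: at
  \<open>q\<close> only the estimate for |f| <= y at level y has been established, and the small
  part satisfies just that restriction. The constant does not depend on \<open>M\<close>, which the
  later removal of truncations exploits.\<close>

lemma marcinkiewicz: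
  assumes r: "p < r" "r < 2 * p"
  obtains C where "0 < C" "\<And>f M. f \<in> borel_measurable lebesgue \<Longrightarrow> N r f < \<infinity> \<Longrightarrow> (\<And>x. M < \<bar>x\<bar> \<Longrightarrow> f x = 0) \<Longrightarrow>
    N r (hilbert f) \<le> ennreal C * N r f"
proof -
  \<comment> \<open>Any exponent strictly between r and 2 p would do; the midpoint is taken.\<close>
  define q where "q = (r + 2 * p) / 2"
  have q: "p < q" "q < 2 * p" "r < q" using r by (auto simp: q_def)
  have r0: "0 < r" and q0: "0 < q" using r q p_pos by auto
  obtain C0 where C0: "0 < C0" "\<And>f y. f \<in> borel_measurable lebesgue \<Longrightarrow> N p f < \<infinity> \<Longrightarrow> 0 < y \<Longrightarrow>
     V {x. y < \<bar>hilbert f x\<bar>} \<le> ennreal (C0 * y powr (- p)) * N p f"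
    using weak_bound by blast
  obtain K where K: "1 \<le> K" "\<And>A B. A \<in> sets lebesgue \<Longrightarrow> B \<in> sets lebesgue \<Longrightarrow> V (A \<union> B) \<le> ennreal K * (V A + V B)"
    using cap_quasi_subadditive by blast
  obtain C2 where C2: "0 < C2" "\<And>f M y. f \<in> borel_measurable lebesgue \<Longrightarrow> 0 < y \<Longrightarrow> (\<And>x. \<bar>f x\<bar> \<le> y) \<Longrightarrow> (\<And>x. M < \<bar>x\<bar> \<Longrightarrow> f x = 0) \<Longrightarrow>
    V {x. y < \<bar>hilbert f x\<bar>} \<le> ennreal (C2 * y powr (- q)) * N q f"
    using small_bound_scaled[OF q(1,2)] by blast
  \<comment> \<open>The factor 2^r comes from the level 2 y, the summand 1 from the boundary term of
    the large part, and the two quotients from the Hardy type estimates.\<close>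
  define B where "B = 2 powr r * (K * (C0 * (1 + p / (r - p)) + C2 * (q / (q - r))))"
  have "N r (hilbert f) \<le> ennreal B * N r f"
    if f: "f \<in> borel_measurable lebesgue" and Nf: "N r f < \<infinity>" and M: "\<And>x. M < \<bar>x\<bar> \<Longrightarrow> f x = 0" for f M
  proof -
    have [measurable]: "(\<lambda>s. V {x. s < \<bar>f x\<bar>}) \<in> borel_measurable borel" by (rule cap_level_measurable[OF f])
    have Np: "N p f < \<infinity>" by (rule lint_compact_finite[OF f r(1) Nf M])
    have Hm: "hilbert f \<in> borel_measurable lebesgue" by (rule weak_measurable[OF f Np])
    let ?d = "\<lambda>y. V {x. y < \<bar>f x\<bar>}"
    define U where "U = (\<lambda>y. \<integral>\<^sup>+s. ennreal (p * s powr (p - 1)) * ?d s * indicator {s. 0 < y \<and> y \<le> s} s \<partial>lborel)"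
    define T where "T = (\<lambda>y. \<integral>\<^sup>+s. ennreal (q * s powr (q - 1)) * ?d s * indicator {s. 0 < s \<and> s < y} s \<partial>lborel)"
    have [measurable]: "U \<in> borel_measurable borel" "T \<in> borel_measurable borel"
      unfolding U_def T_def indicator_def by measurable
    have pt: "V {x. 2 * y < \<bar>hilbert f x\<bar>} \<le> ennreal K * (ennreal (C0 * y powr (- p)) * (ennreal (y powr p) * ?d y + U y) + ennreal (C2 * y powr (- q)) * T y)"
      if y: "0 < y" for y
    proof -
      let ?f1 = "\<lambda>x. if y < \<bar>f x\<bar> then f x else 0" and ?f2 = "\<lambda>x. if y < \<bar>f x\<bar> then 0 else f x"
      have m: "?f1 \<in> borel_measurable lebesgue" "?f2 \<in> borel_measurable lebesgue" using f by measurable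
      have N1: "N p ?f1 < \<infinity>" by (rule lint_large_part_finite[OF f r(1) Nf y])
      have N2: "N p ?f2 < \<infinity>" by (rule lint_bounded_compact[OF m(2), of y M]) (use M p_pos y in auto)
      have eq: "f = (\<lambda>x. ?f1 x + ?f2 x)" by auto
      have "V {x. 2 * y < \<bar>hilbert f x\<bar>} \<le> V ({x. y < \<bar>hilbert ?f1 x\<bar>} \<union> {x. y < \<bar>hilbert ?f2 x\<bar>})"
      proof (rule cap_mono_AE)
        show "AE x in lebesgue. x \<in> {x. 2 * y < \<bar>hilbert f x\<bar>} \<longrightarrow> x \<in> {x. y < \<bar>hilbert ?f1 x\<bar>} \<union> {x. y < \<bar>hilbert ?f2 x\<bar>}"
          using weak_defined[OF m(1) N1] weak_defined[OF m(2) N2]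
        proof eventually_elim
          case (elim x)
          have "hilbert f x = hilbert ?f1 x + hilbert ?f2 x" by (subst eq) (rule hilbert_add(2)[OF elim])
          then show ?case unfolding mem_Collect_eq Un_iff by linarith
        qed
        show "{x. y < \<bar>hilbert ?f1 x\<bar>} \<union> {x. y < \<bar>hilbert ?f2 x\<bar>} \<in> sets lebesgue"
          by (intro sets.Un sets_Collect_less_abs weak_measurable m N1 N2)
      qed
      also have "\<dots> \<le> ennreal K * (V {x. y < \<bar>hilbert ?f1 x\<bar>} + V {x. y < \<bar>hilbert ?f2 x\<bar>})"
        by (intro K(2) sets_Collect_less_abs weak_measurable m N1 N2)
      also have "\<dots> \<le> ennreal K * (ennreal (C0 * y powr (- p)) * N p ?f1 + ennreal (C2 * y powr (- q)) * N q ?f2)"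
      proof (intro mult_left_mono add_mono)
        show "V {x. y < \<bar>hilbert ?f1 x\<bar>} \<le> ennreal (C0 * y powr (- p)) * N p ?f1" by (rule C0(2)[OF m(1) N1 y])
        show "V {x. y < \<bar>hilbert ?f2 x\<bar>} \<le> ennreal (C2 * y powr (- q)) * N q ?f2"
          by (rule C2(2)[OF m(2) y, of M]) (use M y in auto)
      qed auto
      also have "\<dots> \<le> ennreal K * (ennreal (C0 * y powr (- p)) * (ennreal (y powr p) * ?d y + U y) + ennreal (C2 * y powr (- q)) * T y)"
        unfolding U_def T_def
        by (intro mult_left_mono add_mono lint_large_part[OF f p_pos y] lint_small_part[OF f q0]) auto
      finally show ?thesis .
    qed
    let ?i0 = "\<lambda>y. ennreal C0 * (ennreal (r * y powr (r - 1)) * ?d y * indicator {0<..} y)"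
    let ?i1 = "\<lambda>y. ennreal C0 * (ennreal (r * y powr (r - p - 1)) * indicator {0<..} y * U y)"
    let ?i2 = "\<lambda>y. ennreal C2 * (ennreal (r * y powr (r - q - 1)) * indicator {0<..} y * T y)"
    have "ennreal ((1/2) powr r) * N r (hilbert f) = (\<integral>\<^sup>+y. ennreal (r * y powr (r - 1)) * V {x. y / (1/2) < \<bar>hilbert f x\<bar>} * indicator {0<..} y \<partial>lborel)"
      using lint_scale[OF Hm r0, of "1/2"] by simp
    also have "\<dots> \<le> (\<integral>\<^sup>+y. ennreal K * (?i0 y + (?i1 y + ?i2 y)) \<partial>lborel)"
    proof (rule nn_integral_mono)
      fix y :: real
      show "ennreal (r * y powr (r - 1)) * V {x. y / (1/2) < \<bar>hilbert f x\<bar>} * indicator {0<..} y \<le> ennreal K * (?i0 y + (?i1 y + ?i2 y))"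
      proof (cases "0 < y")
        case True
        have e1: "ennreal (r * y powr (r - 1)) * (ennreal (C0 * y powr (- p)) * (ennreal (y powr p) * ?d y)) = ?i0 y"
        proof -
          have "ennreal (r * y powr (r - 1)) * (ennreal (C0 * y powr (- p)) * ennreal (y powr p)) = ennreal C0 * ennreal (r * y powr (r - 1))"
            using True C0(1) r0 by (simp add: ennreal_mult[symmetric] powr_minus)
          then have "ennreal (r * y powr (r - 1)) * (ennreal (C0 * y powr (- p)) * ennreal (y powr p)) * ?d y = ennreal C0 * ennreal (r * y powr (r - 1)) * ?d y" by simp
          then show ?thesis using True by (simp add: mult_ac)
        qed
        have e2: "ennreal (r * y powr (r - 1)) * (ennreal (c * y powr (- t)) * z) = ennreal c * (ennreal (r * y powr (r - t - 1)) * indicator {0<..} y * z)" if c: "0 < c" for c t z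
        proof -
          have "y powr (r - 1) * y powr (- t) = y powr (r - t - 1)" unfolding powr_add[symmetric] by (simp add: algebra_simps)
          then have "(r * y powr (r - 1)) * (c * y powr (- t)) = c * (r * y powr (r - t - 1))" by (simp add: mult_ac)
          then have "ennreal (r * y powr (r - 1)) * ennreal (c * y powr (- t)) = ennreal c * ennreal (r * y powr (r - t - 1))"
            using c r0 by (simp add: ennreal_mult[symmetric])
          then have "ennreal (r * y powr (r - 1)) * ennreal (c * y powr (- t)) * z = ennreal c * ennreal (r * y powr (r - t - 1)) * z" by simp
          then show ?thesis using True by (simp add: mult_ac)
        qed
        have "ennreal (r * y powr (r - 1)) * V {x. 2 * y < \<bar>hilbert f x\<bar>} \<le> ennreal (r * y powr (r - 1)) *
          (ennreal K * (ennreal (C0 * y powr (- p)) * (ennreal (y powr p) * ?d y + U y) + ennreal (C2 * y powr (- q)) * T y))"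
          by (rule mult_left_mono[OF pt[OF True]]) simp
        also have "\<dots> = ennreal K * ((ennreal (r * y powr (r - 1)) * (ennreal (C0 * y powr (- p)) * (ennreal (y powr p) * ?d y))) +
           ((ennreal (r * y powr (r - 1)) * (ennreal (C0 * y powr (- p)) * U y)) + (ennreal (r * y powr (r - 1)) * (ennreal (C2 * y powr (- q)) * T y))))"
          by (simp only: distrib_left mult_ac add_ac)
        also have "\<dots> = ennreal K * (?i0 y + (?i1 y + ?i2 y))" unfolding e1 e2[OF C0(1), of p "U y"] e2[OF C2(1), of q "T y"] ..
        finally show ?thesis using True by (simp add: mult.commute)
      qed simp
    qed
    also have "\<dots> = ennreal K * (\<integral>\<^sup>+y. ?i0 y + (?i1 y + ?i2 y) \<partial>lborel)"
      by (rule nn_integral_cmult) measurable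
    also have "(\<integral>\<^sup>+y. ?i0 y + (?i1 y + ?i2 y) \<partial>lborel) = (\<integral>\<^sup>+y. ?i0 y \<partial>lborel) + ((\<integral>\<^sup>+y. ?i1 y \<partial>lborel) + (\<integral>\<^sup>+y. ?i2 y \<partial>lborel))"
      by (rule nn_integral_add3) measurable
    also have "(\<integral>\<^sup>+y. ?i0 y \<partial>lborel) = ennreal C0 * N r f"
      unfolding lint_eq[OF f r0] by (rule nn_integral_cmult) measurable
    also have "(\<integral>\<^sup>+y. ?i1 y \<partial>lborel) = ennreal C0 * (\<integral>\<^sup>+y. ennreal (r * y powr (r - p - 1)) * indicator {0<..} y * U y \<partial>lborel)"
      by (rule nn_integral_cmult) measurable
    also have "(\<integral>\<^sup>+y. ennreal (r * y powr (r - p - 1)) * indicator {0<..} y * U y \<partial>lborel) = ennreal (p / (r - p)) * N r f"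
      unfolding U_def by (rule hardy_upper[OF f p_pos r(1)])
    also have "(\<integral>\<^sup>+y. ?i2 y \<partial>lborel) = ennreal C2 * (\<integral>\<^sup>+y. ennreal (r * y powr (r - q - 1)) * indicator {0<..} y * T y \<partial>lborel)"
      by (rule nn_integral_cmult) measurable
    finally have "ennreal ((1/2) powr r) * N r (hilbert f) \<le> ennreal K * (ennreal C0 * N r f + (ennreal C0 * (ennreal (p / (r - p)) * N r f) + ennreal C2 *
       (\<integral>\<^sup>+y. ennreal (r * y powr (r - q - 1)) * indicator {0<..} y * T y \<partial>lborel)))" .
    also have "\<dots> \<le> ennreal K * (ennreal C0 * N r f + (ennreal C0 * (ennreal (p / (r - p)) * N r f) + ennreal C2 * (ennreal (q / (q - r)) * N r f)))"
      unfolding T_def by (intro mult_left_mono add_left_mono hardy_lower[OF f r0 q(3)]) auto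
    also have "\<dots> = ennreal (K * (C0 * (1 + p / (r - p)) + C2 * (q / (q - r)))) * N r f"
    proof -
      obtain n where n: "N r f = ennreal n" "0 \<le> n" using Nf by (cases "N r f") auto
      show ?thesis unfolding n using K(1) C0(1) C2(1) p_pos r q q0 n(2)
        by (simp add: ennreal_mult[symmetric] ennreal_plus[symmetric] distrib_left distrib_right mult_ac del: ennreal_plus)
    qed
    finally have le: "ennreal ((1/2) powr r) * N r (hilbert f) \<le> ennreal (K * (C0 * (1 + p / (r - p)) + C2 * (q / (q - r)))) * N r f" .
    have "N r (hilbert f) = ennreal (2 powr r) * (ennreal ((1/2) powr r) * N r (hilbert f))"
      by (simp add: mult.assoc[symmetric] ennreal_mult[symmetric] powr_mult[symmetric])
    also have "\<dots> \<le> ennreal (2 powr r) * (ennreal (K * (C0 * (1 + p / (r - p)) + C2 * (q / (q - r)))) * N r f)"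
      by (rule mult_left_mono[OF le]) simp
    also have "\<dots> = ennreal B * N r f" unfolding B_def using K(1) C0(1) C2(1) p_pos r q q0
      by (simp add: ennreal_mult mult.assoc)
    finally show ?thesis .
  qed
  moreover have "0 < B" unfolding B_def using K(1) C0(1) C2(1) p_pos r q q0
    by (intro mult_pos_pos add_pos_pos divide_pos_pos) auto
  ultimately show thesis by (rule that[rotated])
qed

end

section \<open>Extension to the whole space\<close>

text \<open>Truncation at \<epsilon> < 1 cuts nothing off the support of g, so the principal value
  at x is an absolutely convergent integral.\<close>

lemma hilbert_away_from_support:
  assumes i: "integrable lebesgue (\<lambda>y. g y / (x - y))" and g: "\<And>y. \<bar>x - y\<bar> < 1 \<Longrightarrow> g y = 0"
  shows "hilbert_defined g x" "hilbert g x = (\<integral>y. g y / (x - y) \<partial>lebesgue) / pi"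
proof -
  have eq: "(\<lambda>y. indicator {y. \<epsilon> < \<bar>x - y\<bar>} y *\<^sub>R (g y / (x - y))) = (\<lambda>y. g y / (x - y))" if "\<epsilon> < 1" for \<epsilon>
  proof
    fix y show "indicator {y. \<epsilon> < \<bar>x - y\<bar>} y *\<^sub>R (g y / (x - y)) = g y / (x - y)"
      using g[of y] that by (cases "\<epsilon> < \<bar>x - y\<bar>") auto
  qed
  have "\<forall>\<^sub>F \<epsilon> in at_right 0. \<epsilon> < (1::real)" by (auto simp: eventually_at_right_field intro!: exI[of _ 1])
  then have ev: "\<forall>\<^sub>F \<epsilon> in at_right 0. set_integrable lebesgue {y. \<epsilon> < \<bar>x - y\<bar>} (\<lambda>y. g y / (x - y)) \<and>
      hilbert_trunc g x \<epsilon> = (\<integral>y. g y / (x - y) \<partial>lebesgue)"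
  proof eventually_elim
    case (elim \<epsilon>)
    show ?case unfolding set_integrable_def hilbert_trunc_def set_lebesgue_integral_def eq[OF elim] using i by simp
  qed
  then have "(hilbert_trunc g x \<longlongrightarrow> (\<integral>y. g y / (x - y) \<partial>lebesgue)) (at_right 0)"
    by (intro tendsto_eventually) (auto simp: eventually_conj_iff)
  from hilbertI[OF _ this] ev show "hilbert_defined g x" "hilbert g x = (\<integral>y. g y / (x - y) \<partial>lebesgue) / pi"
    by (auto simp: eventually_conj_iff)
qed

lemma hilbert_defined_away_from_support:
  assumes d: "hilbert_defined g x" and g: "\<And>y. \<bar>x - y\<bar> < 1 \<Longrightarrow> g y = 0"
  shows "integrable lebesgue (\<lambda>y. g y / (x - y))"
proof -
  have "\<forall>\<^sub>F \<epsilon> in at_right 0. \<epsilon> < 1 \<and> set_integrable lebesgue {y. \<epsilon> < \<bar>x - y\<bar>} (\<lambda>y. g y / (x - y))"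
    using d unfolding hilbert_defined_def eventually_conj_iff
    by (auto simp: eventually_at_right_field intro!: exI[of _ 1])
  from eventually_happens'[OF trivial_limit_at_right_real this]
  obtain \<epsilon> where e: "\<epsilon> < 1" "set_integrable lebesgue {y. \<epsilon> < \<bar>x - y\<bar>} (\<lambda>y. g y / (x - y))" by blast
  have "(\<lambda>y. indicator {y. \<epsilon> < \<bar>x - y\<bar>} y *\<^sub>R (g y / (x - y))) = (\<lambda>y. g y / (x - y))"
  proof
    fix y show "indicator {y. \<epsilon> < \<bar>x - y\<bar>} y *\<^sub>R (g y / (x - y)) = g y / (x - y)"
      using g[of y] e(1) by (cases "\<epsilon> < \<bar>x - y\<bar>") auto
  qed
  with e(2) show ?thesis unfolding set_integrable_def by simp
qed

text \<open>With g >= 0 on one side of the origin and x on the other, the kernel has constant sign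
  and |x - y| <= 2 (1 + |y|). No cancellation occurs, and a single value of H g controls the whole
  weighted integral. The sign \<open>\<sigma>\<close> selects the side.\<close>

lemma hilbert_one_sided_lower:
  fixes \<sigma> :: real
  assumes d: "hilbert_defined g x" and g: "\<And>y. 0 \<le> g y" "\<And>y. 0 < \<sigma> * y \<Longrightarrow> g y = 0"
    and \<sigma>: "\<sigma> = 1 \<or> \<sigma> = -1" and x: "1 \<le> \<sigma> * x" "\<sigma> * x \<le> 2"
  shows "(\<integral>\<^sup>+y. ennreal (g y / (1 + \<bar>y\<bar>)) \<partial>lebesgue) \<le> ennreal (2 * pi * \<bar>hilbert g x\<bar>)"
proof -
  have away: "g y = 0" if "\<bar>x - y\<bar> < 1" for y
    using that x \<sigma> by (intro g(2)) auto
  note i = hilbert_defined_away_from_support[OF d away]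
  have H: "hilbert g x = (\<integral>y. g y / (x - y) \<partial>lebesgue) / pi" by (rule hilbert_away_from_support[OF i away])
  have b: "g y / (1 + \<bar>y\<bar>) \<le> 2 * (\<sigma> * (g y / (x - y)))" for y
  proof (cases "0 < \<sigma> * y")
    case True
    then show ?thesis using g(2) by simp
  next
    case False
    have "inverse \<sigma> = \<sigma>" using \<sigma> by auto
    then have "\<sigma> * (g y / (x - y)) = g y / (\<sigma> * (x - y))"
      by (simp add: divide_inverse inverse_mult_distrib mult_ac)
    moreover have "0 < \<sigma> * (x - y)" "\<sigma> * (x - y) \<le> 2 * (1 + \<bar>y\<bar>)"
      using False x \<sigma> by auto
    then have "g y / (2 * (1 + \<bar>y\<bar>)) \<le> g y / (\<sigma> * (x - y))"
      using g(1)[of y] by (intro divide_left_mono) (auto intro!: mult_pos_pos)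
    ultimately show ?thesis by (simp add: field_simps)
  qed
  have nn: "0 \<le> 2 * (\<sigma> * (g y / (x - y)))" for y
    using b[of y] g(1)[of y] by (rule_tac order_trans[OF _ b]) simp
  have "(\<integral>\<^sup>+y. ennreal (g y / (1 + \<bar>y\<bar>)) \<partial>lebesgue) \<le> (\<integral>\<^sup>+y. ennreal (2 * (\<sigma> * (g y / (x - y)))) \<partial>lebesgue)"
    by (intro nn_integral_mono ennreal_leI b)
  also have "\<dots> = ennreal (\<integral>y. 2 * (\<sigma> * (g y / (x - y))) \<partial>lebesgue)"
    using i nn by (intro nn_integral_eq_integral) (auto simp del: times_divide_eq_right)
  also have "(\<integral>y. 2 * (\<sigma> * (g y / (x - y))) \<partial>lebesgue) = 2 * (\<sigma> * (pi * hilbert g x))"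
  proof -
    have "(\<integral>y. g y / (x - y) \<partial>lebesgue) = pi * hilbert g x" using H by simp
    then show ?thesis by (simp del: times_divide_eq_right)
  qed
  also have "ennreal \<dots> \<le> ennreal (2 * pi * \<bar>hilbert g x\<bar>)"
    using \<sigma> by (intro ennreal_leI) (auto simp: abs_if)
  finally show ?thesis .
qed

context hilbert_weak
begin

text \<open>Truncations of |f| to bounded sets are admissible for \<open>marcinkiewicz\<close>. If
  their weighted integrals exceeded \<open>B\<close>, then H would be large on almost all of
  \<open>J\<close>, a set with V(J) > 0, against the uniform bound for \<open>N r\<close>. Fatou
  removes the truncation.\<close>

lemma one_sided_integrable:
  assumes r: "p < r" "r < 2 * p" and f: "f \<in> borel_measurable lebesgue" and Nf: "N r f < \<infinity>" and \<sigma>: "\<sigma> = 1 \<or> \<sigma> = -1"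
  shows "(\<integral>\<^sup>+y. ennreal (if 0 < \<sigma> * y then 0 else \<bar>f y\<bar> / (1 + \<bar>y\<bar>)) \<partial>lebesgue) < \<infinity>"
proof -
  obtain C where C: "0 < C" "\<And>f M. f \<in> borel_measurable lebesgue \<Longrightarrow> N r f < \<infinity> \<Longrightarrow> (\<And>x. M < \<bar>x\<bar> \<Longrightarrow> f x = 0) \<Longrightarrow>
    N r (hilbert f) \<le> ennreal C * N r f"
    using marcinkiewicz[OF r] by blast
  have r0: "0 < r" using r p_pos by simp
  obtain n where n: "N r f = ennreal n" "0 \<le> n" using Nf by (cases "N r f") auto
  define J where "J = {min \<sigma> (2 * \<sigma>)..max \<sigma> (2 * \<sigma>)}"
  have J: "x \<in> J \<Longrightarrow> 1 \<le> \<sigma> * x \<and> \<sigma> * x \<le> 2" for x using \<sigma> by (auto simp: J_def)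
  have "0 < emeasure um J"
  proof (rule ccontr)
    assume "\<not> 0 < emeasure um J"
    then have "J \<in> null_sets lebesgue" by (intro um_0_imp_null) (auto simp: J_def)
    then have "emeasure lebesgue J = 0" by auto
    then show False using \<sigma> by (auto simp: J_def)
  qed
  then have "0 < V J" by (rule cap_pos)
  moreover have "V J < \<infinity>" unfolding J_def by (rule cap_Icc_finite)
  ultimately obtain v where v: "V J = ennreal v" "0 < v" by (cases "V J") auto
  \<comment> \<open>Solving s^r V(J) <= C n for s and doubling with pi, as 2 pi s is the size of the
    weighted integral, gives this bound.\<close>
  define B where "B = 2 * pi * (C * n / v) powr (1 / r)"
  have B0: "0 \<le> B" by (simp add: B_def)
  define g where "g = (\<lambda>m y. if 0 < \<sigma> * y \<or> real m < \<bar>y\<bar> then 0 else \<bar>f y\<bar>)"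
  have [measurable]: "(\<lambda>y::real. \<sigma> * y) \<in> borel_measurable lebesgue" "(\<lambda>y::real. \<bar>y\<bar>) \<in> borel_measurable lebesgue"
    by (intro measurable_completion; measurable)+
  have gm: "g m \<in> borel_measurable lebesgue" for m unfolding g_def using f by measurable
  have bound: "(\<integral>\<^sup>+y. ennreal (g m y / (1 + \<bar>y\<bar>)) \<partial>lebesgue) \<le> ennreal B" for m
  proof -
    have gf: "N r (g m) \<le> ennreal n" unfolding n(1)[symmetric]
      by (rule lint_mono[OF gm f r0]) (auto simp: g_def)
    then have Nr: "N r (g m) < \<infinity>" using le_less_trans ennreal_less_top infinity_ennreal_def by metis
    have supp: "g m x = 0" if "real m < \<bar>x\<bar>" for x using that by (simp add: g_def)
    have Np: "N p (g m) < \<infinity>" by (rule lint_compact_finite[OF gm r(1) Nr supp])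
    have Hm: "hilbert (g m) \<in> borel_measurable lebesgue" by (rule weak_measurable[OF gm Np])
    let ?I = "\<integral>\<^sup>+y. ennreal (g m y / (1 + \<bar>y\<bar>)) \<partial>lebesgue"
    show ?thesis
    proof (rule ccontr)
      assume "\<not> ?I \<le> ennreal B"
      then obtain z where z: "ennreal B < z" "z < ?I" using dense[of "ennreal B" ?I] by (auto simp: not_le)
      then have "z \<noteq> \<infinity>" by auto
      then obtain c where c: "z = ennreal c" "0 \<le> c" by (cases z) auto
      have Bc: "B < c" using z(1) B0 c by (simp add: ennreal_less_iff)
      define s where "s = c / (2 * pi)"
      have s: "0 \<le> s" "2 * pi * s = c" using c by (auto simp: s_def)
      have "V J \<le> V {x. s < \<bar>hilbert (g m) x\<bar>}"
      proof (rule cap_mono_AE)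
        show "AE x in lebesgue. x \<in> J \<longrightarrow> x \<in> {x. s < \<bar>hilbert (g m) x\<bar>}"
          using weak_defined[OF gm Np]
        proof eventually_elim
          case (elim x)
          show ?case
          proof
            assume "x \<in> J"
            then have "?I \<le> ennreal (2 * pi * \<bar>hilbert (g m) x\<bar>)"
              using J by (intro hilbert_one_sided_lower[OF elim _ _ \<sigma>]) (auto simp: g_def)
            with z(2) have "ennreal c < ennreal (2 * pi * \<bar>hilbert (g m) x\<bar>)" unfolding c(1) by (rule less_le_trans)
            then have "2 * pi * s < 2 * pi * \<bar>hilbert (g m) x\<bar>" using c(2) s by (simp add: ennreal_less_iff)
            then show "x \<in> {x. s < \<bar>hilbert (g m) x\<bar>}" by simp
          qed
        qed
        show "{x. s < \<bar>hilbert (g m) x\<bar>} \<in> sets lebesgue" by (rule sets_Collect_less_abs[OF Hm])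
      qed
      then have "ennreal (s powr r) * V J \<le> ennreal (s powr r) * V {x. s < \<bar>hilbert (g m) x\<bar>}" by (rule mult_left_mono) simp
      also have "\<dots> \<le> N r (hilbert (g m))" by (rule lint_chebyshev[OF Hm r0 s(1)])
      also have "\<dots> \<le> ennreal C * N r (g m)" by (rule C(2)[OF gm Nr supp])
      also have "\<dots> \<le> ennreal C * ennreal n" by (rule mult_left_mono[OF gf]) simp
      finally have "ennreal (s powr r * v) \<le> ennreal (C * n)" using v C n by (simp add: ennreal_mult)
      then have "s powr r * v \<le> C * n" using C n by (subst (asm) ennreal_le_iff) auto
      then have "s powr r \<le> C * n / v" using v by (simp add: pos_le_divide_eq)
      then have "(s powr r) powr (1 / r) \<le> (C * n / v) powr (1 / r)" using r0 by (intro powr_mono2) auto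
      then have "s \<le> (C * n / v) powr (1 / r)" using r0 s(1) by (simp add: powr_powr)
      then have "2 * pi * s \<le> B" unfolding B_def by simp
      then show False using s Bc by simp
    qed
  qed
  have "(\<integral>\<^sup>+y. ennreal (if 0 < \<sigma> * y then 0 else \<bar>f y\<bar> / (1 + \<bar>y\<bar>)) \<partial>lebesgue)
     \<le> (\<integral>\<^sup>+y. liminf (\<lambda>m. ennreal (g m y / (1 + \<bar>y\<bar>))) \<partial>lebesgue)"
  proof (rule nn_integral_mono)
    fix y :: real
    obtain m0 where m0: "\<bar>y\<bar> \<le> real m0" using real_arch_simple by blast
    have "\<forall>\<^sub>F m in sequentially. ennreal (g m y / (1 + \<bar>y\<bar>)) = ennreal (if 0 < \<sigma> * y then 0 else \<bar>f y\<bar> / (1 + \<bar>y\<bar>))"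
      using eventually_ge_at_top[of m0] by eventually_elim (use m0 in \<open>auto simp: g_def\<close>)
    then have "(\<lambda>m. ennreal (g m y / (1 + \<bar>y\<bar>))) \<longlonglongrightarrow> ennreal (if 0 < \<sigma> * y then 0 else \<bar>f y\<bar> / (1 + \<bar>y\<bar>))"
      by (rule tendsto_eventually)
    from lim_imp_Liminf[OF _ this]
    show "ennreal (if 0 < \<sigma> * y then 0 else \<bar>f y\<bar> / (1 + \<bar>y\<bar>)) \<le> liminf (\<lambda>m. ennreal (g m y / (1 + \<bar>y\<bar>)))" by simp
  qed
  also have "\<dots> \<le> liminf (\<lambda>m. \<integral>\<^sup>+y. ennreal (g m y / (1 + \<bar>y\<bar>)) \<partial>lebesgue)"
    by (rule nn_integral_liminf) (use gm in measurable)
  also have "\<dots> \<le> ennreal B"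
    by (rule order_trans[OF Liminf_mono[OF always_eventually[OF allI[OF bound]]]]) (simp add: Liminf_const)
  finally show ?thesis by (rule le_less_trans) simp
qed

text \<open>The source of definedness on \<Lambda>^r: this integrability makes the tail of the
  Hilbert integral converge absolutely at every point.\<close>

lemma decay_integrable:
  assumes r: "p < r" "r < 2 * p" and f: "f \<in> borel_measurable lebesgue" and Nf: "N r f < \<infinity>"
  shows "integrable lebesgue (\<lambda>y. f y / (1 + \<bar>y\<bar>))"
proof (rule integrableI_bounded)
  have [measurable]: "(\<lambda>y::real. 1 + \<bar>y\<bar>) \<in> borel_measurable lebesgue" "(\<lambda>y::real. c * y) \<in> borel_measurable lebesgue" for c
    by (intro measurable_completion; measurable)+
  show "(\<lambda>y. f y / (1 + \<bar>y\<bar>)) \<in> borel_measurable lebesgue" using f by measurable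
  let ?h = "\<lambda>\<sigma> y. ennreal (if 0 < \<sigma> * y then 0 else \<bar>f y\<bar> / (1 + \<bar>y\<bar>))"
  have m: "?h \<sigma> \<in> borel_measurable lebesgue" for \<sigma> using f by measurable
  have "(\<integral>\<^sup>+y. ennreal (norm (f y / (1 + \<bar>y\<bar>))) \<partial>lebesgue) \<le> (\<integral>\<^sup>+y. ?h 1 y + ?h (-1) y \<partial>lebesgue)"
    by (intro nn_integral_mono) (auto simp: abs_divide)
  also have "\<dots> = (\<integral>\<^sup>+y. ?h 1 y \<partial>lebesgue) + (\<integral>\<^sup>+y. ?h (-1) y \<partial>lebesgue)" by (rule nn_integral_add[OF m m])
  also have "\<dots> < \<infinity>" using one_sided_integrable[OF r f Nf, of 1] one_sided_integrable[OF r f Nf, of "-1"] by simp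
  finally show "(\<integral>\<^sup>+y. ennreal (norm (f y / (1 + \<bar>y\<bar>))) \<partial>lebesgue) < \<infinity>" .
qed

text \<open>Fatou twice, for \<open>V\<close> at each level and for the integral over the
  levels.\<close>

lemma lint_liminf:
  assumes g: "g \<in> borel_measurable lebesgue" and gn: "\<And>n::nat. gn n \<in> borel_measurable lebesgue"
    and ae: "AE x in lebesgue. (\<lambda>n. gn n x) \<longlonglongrightarrow> g x" and r: "0 < r"
  shows "N r g \<le> liminf (\<lambda>n. N r (gn n))"
proof -
  define M where "M = density lborel (\<lambda>y. ennreal (r * y powr (r - 1)) * indicator {0<..} y)"
  have NM: "N r h = (\<integral>\<^sup>+y. V {x. y < \<bar>h x\<bar>} \<partial>M)" if h: "h \<in> borel_measurable lebesgue" for h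
  proof -
    have [measurable]: "(\<lambda>y. V {x. y < \<bar>h x\<bar>}) \<in> borel_measurable borel" by (rule cap_level_measurable[OF h])
    show ?thesis unfolding M_def lint_eq[OF h r] by (subst nn_integral_density) (auto simp: mult_ac)
  qed
  have pt: "V {x. y < \<bar>g x\<bar>} \<le> liminf (\<lambda>n. V {x. y < \<bar>gn n x\<bar>})" for y
  proof -
    have s: "{x. y < \<bar>gn n x\<bar>} \<in> sets lebesgue" for n by (rule sets_Collect_less_abs[OF gn])
    have "V {x. y < \<bar>g x\<bar>} \<le> V {x. \<forall>\<^sub>F n in sequentially. x \<in> {x. y < \<bar>gn n x\<bar>}}"
    proof (rule cap_mono_AE)
      show "AE x in lebesgue. x \<in> {x. y < \<bar>g x\<bar>} \<longrightarrow> x \<in> {x. \<forall>\<^sub>F n in sequentially. x \<in> {x. y < \<bar>gn n x\<bar>}}"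
        using ae
      proof eventually_elim
        case (elim x)
        have "(\<lambda>n. \<bar>gn n x\<bar>) \<longlonglongrightarrow> \<bar>g x\<bar>" by (intro tendsto_intros elim)
        then show ?case using order_tendstoD(1) by fastforce
      qed
      have "{x. \<forall>\<^sub>F n in sequentially. x \<in> {x. y < \<bar>gn n x\<bar>}} = (\<Union>m. \<Inter>k\<in>{m..}. {x. y < \<bar>gn k x\<bar>})"
        by (auto simp: eventually_sequentially)
      also have "\<dots> \<in> sets lebesgue" using s by (intro sets.countable_UN' sets.countable_INT') auto
      finally show "{x. \<forall>\<^sub>F n in sequentially. x \<in> {x. y < \<bar>gn n x\<bar>}} \<in> sets lebesgue" .
    qed
    also have "\<dots> \<le> liminf (\<lambda>n. V {x. y < \<bar>gn n x\<bar>})" by (rule cap_liminf[OF s])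
    finally show ?thesis .
  qed
  have "N r g \<le> (\<integral>\<^sup>+y. liminf (\<lambda>n. V {x. y < \<bar>gn n x\<bar>}) \<partial>M)" unfolding NM[OF g] by (rule nn_integral_mono) (rule pt)
  also have "\<dots> \<le> liminf (\<lambda>n. \<integral>\<^sup>+y. V {x. y < \<bar>gn n x\<bar>} \<partial>M)"
    using cap_level_measurable[OF gn] by (intro nn_integral_liminf) (simp add: M_def)
  finally show ?thesis unfolding NM[OF gn] .
qed

text \<open>Cut f at |y| <= n. Near a given x the remainder vanishes for large n, so its transform
  there is an absolutely convergent integral that tends to 0; hence H f exists at x and is the limit
  of the transforms of the cut functions. Their bounds pass to the limit by lower semicontinuity of
  \<open>N r\<close>.\<close>

theorem strong_type_below_double:
  assumes r: "p < r" "r < 2 * p"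
  shows "strong_type r"
proof -
  obtain C where C: "0 < C" "\<And>f M. f \<in> borel_measurable lebesgue \<Longrightarrow> N r f < \<infinity> \<Longrightarrow> (\<And>x. M < \<bar>x\<bar> \<Longrightarrow> f x = 0) \<Longrightarrow>
    N r (hilbert f) \<le> ennreal C * N r f"
    using marcinkiewicz[OF r] by blast
  have r0: "0 < r" using r p_pos by simp
  have "(AE x in lebesgue. hilbert_defined f x) \<and> N r (hilbert f) \<le> ennreal C * N r f"
    if f: "f \<in> borel_measurable lebesgue" and Nf: "N r f < \<infinity>" for f
  proof -
    note int = decay_integrable[OF r f Nf]
    define fn where "fn = (\<lambda>n y. if real n < \<bar>y\<bar> then 0 else f y)"
    have [measurable]: "(\<lambda>y::real. \<bar>y\<bar>) \<in> borel_measurable lebesgue" "(\<lambda>y::real. c - y) \<in> borel_measurable lebesgue" for c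
      by (intro measurable_completion; measurable)+
    have fm: "fn n \<in> borel_measurable lebesgue" for n unfolding fn_def using f by measurable
    have supp: "fn n x = 0" if "real n < \<bar>x\<bar>" for n x using that by (simp add: fn_def)
    have Nrle: "N r (fn n) \<le> N r f" for n by (rule lint_mono[OF fm f r0]) (auto simp: fn_def)
    have Nr: "N r (fn n) < \<infinity>" for n using Nrle[of n] Nf by (rule le_less_trans)
    have Np: "N p (fn n) < \<infinity>" for n by (rule lint_compact_finite[OF fm r(1) Nr supp])
    have "AE x in lebesgue. \<forall>n. hilbert_defined (fn n) x"
      unfolding AE_all_countable using weak_defined[OF fm Np] by blast
    then have ae: "AE x in lebesgue. hilbert_defined f x \<and> (\<lambda>n. hilbert (fn n) x) \<longlonglongrightarrow> hilbert f x"
    proof eventually_elim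
      case (elim x)
      let ?t = "\<lambda>n y. if real n < \<bar>y\<bar> then f y else 0"
      \<comment> \<open>For |x - y| >= 1 one has 1 + |y| <= (2 + |x|) |x - y|, which makes this an
        integrable majorant of every tail with n >= n0.\<close>
      let ?w = "\<lambda>y. (2 + \<bar>x\<bar>) * \<bar>f y / (1 + \<bar>y\<bar>)\<bar>"
      have w: "integrable lebesgue ?w" using int by (intro integrable_mult_right integrable_abs)
      obtain n0 where n0: "\<bar>x\<bar> + 1 \<le> real n0" using real_arch_simple by blast
      have b: "\<bar>?t n y / (x - y)\<bar> \<le> ?w y" if "n0 \<le> n" for n y
      proof (cases "real n < \<bar>y\<bar>")
        case True
        have "\<bar>x\<bar> + 1 \<le> real n" using n0 that by simp
        with True have "1 \<le> \<bar>x - y\<bar>" by linarith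
        moreover have "1 + \<bar>y\<bar> \<le> (1 + \<bar>x\<bar>) * 1 + 1 * \<bar>x - y\<bar>"
          using abs_triangle_ineq[of x "y - x"] abs_minus_commute[of x y] by simp
        moreover have "(1 + \<bar>x\<bar>) * 1 \<le> (1 + \<bar>x\<bar>) * \<bar>x - y\<bar>" using \<open>1 \<le> \<bar>x - y\<bar>\<close> by (intro mult_left_mono) auto
        ultimately have le: "1 + \<bar>y\<bar> \<le> (2 + \<bar>x\<bar>) * \<bar>x - y\<bar>" by (simp add: algebra_simps)
        have "\<bar>f y\<bar> / \<bar>x - y\<bar> \<le> (2 + \<bar>x\<bar>) * \<bar>f y\<bar> / (1 + \<bar>y\<bar>)"
        proof -
          have gen: "a / b \<le> d * a / c" if "a * c \<le> a * (d * b)" "0 < b" "0 < c" for a b c d :: real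
            using that by (simp add: field_simps)
          show ?thesis
            by (rule gen) (use \<open>1 \<le> \<bar>x - y\<bar>\<close> in \<open>auto intro!: mult_left_mono[OF le]\<close>)
        qed
        then show ?thesis using True by (simp add: abs_divide)
      qed simp
      have tm: "(\<lambda>y. ?t n y / (x - y)) \<in> borel_measurable lebesgue" for n using f by measurable
      have ti: "integrable lebesgue (\<lambda>y. ?t n y / (x - y))" if "n0 \<le> n" for n
        by (rule Bochner_Integration.integrable_bound[OF w tm]) (use b[OF that] in \<open>auto intro: order_trans\<close>)
      have t0: "?t n y = 0" if "n0 \<le> n" "\<bar>x - y\<bar> < 1" for n y
      proof -
        have "real n0 \<le> real n" using that by simp
        then have "\<not> real n < \<bar>y\<bar>" using n0 that(2) by linarith
        then show ?thesis by simp
      qed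
      have feq: "f = (\<lambda>y. fn n y + ?t n y)" for n by (auto simp: fn_def)
      have fd: "hilbert_defined f x"
        by (subst feq[of n0]) (rule hilbert_add(1)[OF elim[rule_format] hilbert_away_from_support(1)[OF ti t0]]; simp)
      have fe: "hilbert f x = hilbert (fn n) x + (\<integral>y. ?t n y / (x - y) \<partial>lebesgue) / pi" if n: "n0 \<le> n" for n
      proof -
        have "hilbert f x = hilbert (fn n) x + hilbert (?t n) x"
          by (subst feq[of n]) (rule hilbert_add(2)[OF elim[rule_format] hilbert_away_from_support(1)[OF ti[OF n] t0[OF n]]])
        then show ?thesis using hilbert_away_from_support(2)[OF ti[OF n] t0[OF n]] by simp
      qed
      have "(\<lambda>n. \<integral>y. ?t (n + n0) y / (x - y) \<partial>lebesgue) \<longlonglongrightarrow> (\<integral>y. 0 \<partial>(lebesgue :: real measure))"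
      proof (rule integral_dominated_convergence[OF _ tm w])
        show "AE y in lebesgue. (\<lambda>n. ?t (n + n0) y / (x - y)) \<longlonglongrightarrow> 0"
        proof (rule AE_I2)
          fix y :: real
          obtain m where m: "\<bar>y\<bar> \<le> real m" using real_arch_simple by blast
          have "\<forall>\<^sub>F n in sequentially. ?t (n + n0) y / (x - y) = 0"
            using eventually_ge_at_top[of m] by eventually_elim (use m in auto)
          then show "(\<lambda>n. ?t (n + n0) y / (x - y)) \<longlonglongrightarrow> 0" by (rule tendsto_eventually)
        qed
        show "AE y in lebesgue. norm (?t (n + n0) y / (x - y)) \<le> ?w y" for n
          unfolding real_norm_def by (intro AE_I2 b) simp
      qed simp
      then have "(\<lambda>n. hilbert f x - (\<integral>y. ?t (n + n0) y / (x - y) \<partial>lebesgue) / pi) \<longlonglongrightarrow> hilbert f x - (\<integral>y. 0 \<partial>(lebesgue :: real measure)) / pi"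
        by (intro tendsto_intros) auto
      moreover have "hilbert f x - (\<integral>y. ?t (n + n0) y / (x - y) \<partial>lebesgue) / pi = hilbert (fn (n + n0)) x" for n
        using fe[of "n + n0"] by simp
      ultimately have "(\<lambda>n. hilbert (fn (n + n0)) x) \<longlonglongrightarrow> hilbert f x" by simp
      then have "(\<lambda>n. hilbert (fn n) x) \<longlonglongrightarrow> hilbert f x" by (rule LIMSEQ_offset)
      with fd show ?case by blast
    qed
    have d: "AE x in lebesgue. hilbert_defined f x" using ae by eventually_elim blast
    have lim: "AE x in lebesgue. (\<lambda>n. hilbert (fn n) x) \<longlonglongrightarrow> hilbert f x" using ae by eventually_elim blast
    have "N r (hilbert f) \<le> liminf (\<lambda>n. N r (hilbert (fn n)))"
      by (rule lint_liminf[OF hilbert_measurable[OF f d] weak_measurable[OF fm Np] lim r0])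
    also have "\<dots> \<le> liminf (\<lambda>n::nat. ennreal C * N r f)"
    proof (rule Liminf_mono, rule always_eventually, rule allI)
      fix n
      have "N r (hilbert (fn n)) \<le> ennreal C * N r (fn n)" by (rule C(2)[OF fm Nr supp])
      also have "\<dots> \<le> ennreal C * N r f" by (rule mult_left_mono[OF Nrle]) simp
      finally show "N r (hilbert (fn n)) \<le> ennreal C * N r f" .
    qed
    also have "\<dots> = ennreal C * N r f" by (simp add: Liminf_const)
    finally show ?thesis using d by blast
  qed
  with C(1) show ?thesis unfolding strong_type_def by blast
qed

end

section \<open>Iteration to all exponents above \<open>p\<close>\<close>

context lorentz_weights
begin

text \<open>Strong type at an exponent gives weak type there, so the argument restarts from a larger
  base. The induction runs on the number n of doublings that carry the base past r.\<close>

theorem weak_type_imp_strong_type: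
  assumes fin: "\<And>t. emeasure wm {s. s < t} < \<infinity>" and "0 < p" "weak_type p" "p < r"
  shows "strong_type r"
proof -
  have step: "strong_type r" if "0 < p" "weak_type p" "p < r" "r < 2 ^ n * p" for n p r
    using that
  proof (induction n arbitrary: p)
    case 0
    then show ?case by simp
  next
    case (Suc n)
    interpret hilbert_weak u w p by unfold_locales (use Suc.prems fin in auto)
    show ?case
    proof (cases "r < 2 * p")
      case True
      then show ?thesis using Suc.prems by (intro strong_type_below_double)
    next
      case False
      define R where "R = r / 2 ^ n"
      \<comment> \<open>The midpoint between max p R and 2 p: above R = r / 2^n, so that n doublings
        of \<open>p'\<close> pass r, and strictly between p and 2 p, so that
        \<open>strong_type_below_double\<close> applies.\<close>
      define p' where "p' = (max p R + 2 * p) / 2"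
      have "R < 2 * p" using Suc.prems(4) by (simp add: R_def divide_less_eq mult_ac)
      then have p': "p < p'" "p' < 2 * p" "R < p'" using Suc.prems(1) by (auto simp: p'_def max_def)
      have "strong_type p'" by (rule strong_type_below_double[OF p'(1,2)])
      then have "weak_type p'" using p' Suc.prems(1) by (intro strong_imp_weak_type) auto
      moreover have "r < 2 ^ n * p'" using p'(3) by (simp add: R_def divide_less_eq mult_ac)
      ultimately show ?thesis using Suc.IH[of p'] p' False Suc.prems(1) by auto
    qed
  qed
  obtain n where "r / p < 2 ^ n" using real_arch_pow[of 2 "r / p"] by auto
  then have "r < 2 ^ n * p" using assms(2) by (simp add: divide_less_eq)
  then show ?thesis by (rule step[OF assms(2-4)])
qed

end

theorem theorem3p1:
  fixes u w :: "real \<Rightarrow> real" and p :: real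
  assumes "weight_R u" and "weight_pos w" and "0 < p"
    and "hilbert_bounded (lorentz_space u w p) (lorentz_norm u w p) (weak_lorentz_norm u w p)"
  shows "\<forall>r>p. hilbert_bounded (lorentz_space u w r) (lorentz_norm u w r) (lorentz_norm u w r)"
proof (intro allI impI)
  fix r assume r: "p < r"
  interpret lorentz_weights u w by unfold_locales (rule assms)+
  have "strong_type r"
  \<comment> \<open>An infinite value of W makes the space trivial; otherwise the hypothesis
    \<open>fin\<close> of the iteration holds.\<close>
  proof (cases "\<exists>t. emeasure wm {s. s < t} = \<infinity>")
    case True
    then obtain t where "emeasure wm {s. s < t} = \<infinity>" by blast
    then show ?thesis by (rule strong_type_infinite_weight) (use r assms(3) in simp)
  next
    case False
    then have fin: "emeasure wm {s. s < t} < \<infinity>" for t by (simp add: less_top)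
    show ?thesis
      by (rule weak_type_imp_strong_type[OF fin assms(3) weak_type_hilbert_boundedD[OF assms(4,3)] r])
  qed
  then show "hilbert_bounded (lorentz_space u w r) (lorentz_norm u w r) (lorentz_norm u w r)"
    using r assms(3) by (intro hilbert_bounded_strongI) auto
qed

end
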